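(* Let $(R,\mathfrak m,k)$ be a commutative Noetherian local ring with $\mathfrak m\neq 0$. If $\nu^1_{2n}=0$ for some integer $n>0$, then $\nu^1_2=0$.
   Context: For $i\ge 0$, $\nu^1_i\colon \operatorname{Tor}_i^R(k,R/\mathfrak m^{2})\to\operatorname{Tor}_i^R(k,R/\mathfrak m)$ denotes the map induced by the canonical surjection $R/\mathfrak m^{2}\to R/\mathfrak m$. *)

theory Defs
  imports "HOL-Algebra.Algebra"
begin

section \<open>Local rings\<close>

definition noetherian_local_ring :: "('a, 'c) ring_scheme \<Rightarrow> 'a set \<Rightarrow> bool" where
  "noetherian_local_ring R \<mm> \<longleftrightarrow>
     cring R \<and> noetherian_ring R \<and> maximalideal \<mm> R \<and> (\<forall>J. maximalideal J R \<longrightarrow> J = \<mm>)"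


section \<open>Modules and their quotients\<close>

text \<open>The record type of modules extends the one of rings, but the locale \<^locale>\<open>module\<close> puts no
  condition on the fields \<open>mult\<close> and \<open>one\<close>. They are left undefined in the modules built here.\<close>

definition regular_module :: "('a, 'c) ring_scheme \<Rightarrow> ('a, 'a) module" where
  "regular_module R =
     \<lparr>carrier = carrier R, monoid.mult = undefined, one = undefined,
      ring.zero = \<zero>\<^bsub>R\<^esub>, ring.add = ring.add R, module.smult = monoid.mult R\<rparr>"

definition linear_maps ::
    "('a, 'c) ring_scheme \<Rightarrow> ('a, 'b, 'e) module_scheme \<Rightarrow> ('a, 'd, 'f) module_scheme \<Rightarrow> ('b \<Rightarrow> 'd) set"
  where
  "linear_maps R M N =
     {f \<in> carrier M \<rightarrow> carrier N.
        (\<forall>x\<in>carrier M. \<forall>y\<in>carrier M. f (x \<oplus>\<^bsub>M\<^esub> y) = f x \<oplus>\<^bsub>N\<^esub> f y) \<and>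
        (\<forall>r\<in>carrier R. \<forall>x\<in>carrier M. f (r \<odot>\<^bsub>M\<^esub> x) = r \<odot>\<^bsub>N\<^esub> f x)}"

definition submodule_span ::
    "('a, 'c) ring_scheme \<Rightarrow> ('a, 'b, 'e) module_scheme \<Rightarrow> 'b set \<Rightarrow> 'b set" where
  "submodule_span R M A = \<Inter>{H. submodule H R M \<and> A \<subseteq> H}"

text \<open>As for \<^const>\<open>FactRing\<close>, the elements of a quotient are the cosets themselves.\<close>

definition quotient_module :: "('a, 'b, 'e) module_scheme \<Rightarrow> 'b set \<Rightarrow> ('a, 'b set) module" where
  "quotient_module M H =
     \<lparr>carrier = a_rcosets\<^bsub>M\<^esub> H, monoid.mult = undefined, one = undefined,
      ring.zero = H, ring.add = set_add M,
      module.smult = (\<lambda>r K. H <+>\<^bsub>M\<^esub> ((\<lambda>x. r \<odot>\<^bsub>M\<^esub> x) ` K))\<rparr>"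

text \<open>The map \<open>M/H \<rightarrow> M'/H'\<close> induced by a linear map \<open>f : M \<rightarrow> M'\<close> with \<open>f(H) \<subseteq> H'\<close>. For a
  coset \<open>K = H + x\<close> the set \<open>H' + f(K)\<close> is the coset \<open>H' + f(x)\<close>.\<close>

definition quotient_map ::
    "('a, 'd, 'f) module_scheme \<Rightarrow> 'd set \<Rightarrow> ('b \<Rightarrow> 'd) \<Rightarrow> 'b set \<Rightarrow> 'd set" where
  "quotient_map M' H' f K = H' <+>\<^bsub>M'\<^esub> (f ` K)"

text \<open>The \<open>R\<close>-module \<open>R/I\<close>, and the map \<open>R/I \<rightarrow> R/J\<close> induced by the identity of \<open>R\<close> when
  \<open>I \<subseteq> J\<close>.\<close>

definition residue_module :: "('a, 'c) ring_scheme \<Rightarrow> 'a set \<Rightarrow> ('a, 'a set) module" where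
  "residue_module R I = quotient_module (regular_module R) I"

definition residue_map :: "('a, 'c) ring_scheme \<Rightarrow> 'a set \<Rightarrow> 'a set \<Rightarrow> 'a set" where
  "residue_map R J = quotient_map (regular_module R) J (\<lambda>x. x)"


section \<open>Free modules\<close>

text \<open>The free module on a set \<open>S\<close> consists of the finitely supported functions \<open>S \<rightarrow> R\<close>,
  extended by zero outside \<open>S\<close>.\<close>

definition free_module :: "('a, 'c) ring_scheme \<Rightarrow> 's set \<Rightarrow> ('a, 's \<Rightarrow> 'a) module" where
  "free_module R S =
     \<lparr>carrier = {f. (\<forall>s. f s \<in> carrier R) \<and> (\<forall>s. s \<notin> S \<longrightarrow> f s = \<zero>\<^bsub>R\<^esub>) \<and>
                    finite {s. f s \<noteq> \<zero>\<^bsub>R\<^esub>}},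
      monoid.mult = undefined, one = undefined,
      ring.zero = (\<lambda>s. \<zero>\<^bsub>R\<^esub>), ring.add = (\<lambda>f g s. f s \<oplus>\<^bsub>R\<^esub> g s),
      module.smult = (\<lambda>r f s. r \<otimes>\<^bsub>R\<^esub> f s)\<rparr>"

definition free_gen :: "('a, 'c) ring_scheme \<Rightarrow> 's \<Rightarrow> 's \<Rightarrow> 'a" where
  "free_gen R s = (\<lambda>t. if t = s then \<one>\<^bsub>R\<^esub> else \<zero>\<^bsub>R\<^esub>)"

text \<open>The linear map of free modules with \<open>free_gen s \<mapsto> free_gen (h s)\<close>.\<close>

definition free_map ::
    "('a, 'c) ring_scheme \<Rightarrow> ('s \<Rightarrow> 't) \<Rightarrow> ('s \<Rightarrow> 'a) \<Rightarrow> ('t \<Rightarrow> 'a)" where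
  "free_map R h f = (\<lambda>t. \<Oplus>\<^bsub>R\<^esub>s\<in>{s. f s \<noteq> \<zero>\<^bsub>R\<^esub> \<and> h s = t}. f s)"

definition lincomb ::
    "('a, 'c) ring_scheme \<Rightarrow> ('a, 'b, 'e) module_scheme \<Rightarrow> ('b \<Rightarrow> 'a) \<Rightarrow> 'b" where
  "lincomb R M f = (\<Oplus>\<^bsub>M\<^esub>b\<in>{b. f b \<noteq> \<zero>\<^bsub>R\<^esub>}. f b \<odot>\<^bsub>M\<^esub> b)"

definition is_free :: "('a, 'c) ring_scheme \<Rightarrow> ('a, 'b, 'e) module_scheme \<Rightarrow> bool" where
  "is_free R M \<longleftrightarrow>
     module R M \<and>
     (\<exists>B \<subseteq> carrier M. bij_betw (lincomb R M) (carrier (free_module R B)) (carrier M))"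


section \<open>Tensor products\<close>

definition tensor_gens ::
    "('a, 'c) ring_scheme \<Rightarrow> ('a, 'b, 'e) module_scheme \<Rightarrow> ('a, 'd, 'f) module_scheme \<Rightarrow>
     ('b \<times> 'd \<Rightarrow> 'a) set" where
  "tensor_gens R M N =
     (let L = free_module R (carrier M \<times> carrier N); \<delta> = free_gen R in
       {\<delta> (x \<oplus>\<^bsub>M\<^esub> x', y) \<ominus>\<^bsub>L\<^esub> (\<delta> (x, y) \<oplus>\<^bsub>L\<^esub> \<delta> (x', y)) | x x' y.
          x \<in> carrier M \<and> x' \<in> carrier M \<and> y \<in> carrier N} \<union>
       {\<delta> (x, y \<oplus>\<^bsub>N\<^esub> y') \<ominus>\<^bsub>L\<^esub> (\<delta> (x, y) \<oplus>\<^bsub>L\<^esub> \<delta> (x, y')) | x y y'.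
          x \<in> carrier M \<and> y \<in> carrier N \<and> y' \<in> carrier N} \<union>
       {\<delta> (r \<odot>\<^bsub>M\<^esub> x, y) \<ominus>\<^bsub>L\<^esub> r \<odot>\<^bsub>L\<^esub> \<delta> (x, y) | r x y.
          r \<in> carrier R \<and> x \<in> carrier M \<and> y \<in> carrier N} \<union>
       {\<delta> (x, r \<odot>\<^bsub>N\<^esub> y) \<ominus>\<^bsub>L\<^esub> r \<odot>\<^bsub>L\<^esub> \<delta> (x, y) | r x y.
          r \<in> carrier R \<and> x \<in> carrier M \<and> y \<in> carrier N})"

definition tensor_rel ::
    "('a, 'c) ring_scheme \<Rightarrow> ('a, 'b, 'e) module_scheme \<Rightarrow> ('a, 'd, 'f) module_scheme \<Rightarrow>
     ('b \<times> 'd \<Rightarrow> 'a) set" where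
  "tensor_rel R M N =
     submodule_span R (free_module R (carrier M \<times> carrier N)) (tensor_gens R M N)"

definition tensor_product ::
    "('a, 'c) ring_scheme \<Rightarrow> ('a, 'b, 'e) module_scheme \<Rightarrow> ('a, 'd, 'f) module_scheme \<Rightarrow>
     ('a, ('b \<times> 'd \<Rightarrow> 'a) set) module" where
  "tensor_product R M N =
     quotient_module (free_module R (carrier M \<times> carrier N)) (tensor_rel R M N)"

text \<open>The map \<open>f \<otimes> g : M \<otimes> N \<rightarrow> M' \<otimes> N'\<close>. The codomain has to be given, the domain does not.\<close>

definition tensor_map ::
    "('a, 'c) ring_scheme \<Rightarrow> ('a, 'b2, 'e) module_scheme \<Rightarrow> ('a, 'd2, 'f) module_scheme \<Rightarrow>
     ('b \<Rightarrow> 'b2) \<Rightarrow> ('d \<Rightarrow> 'd2) \<Rightarrow> ('b \<times> 'd \<Rightarrow> 'a) set \<Rightarrow> ('b2 \<times> 'd2 \<Rightarrow> 'a) set" where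
  "tensor_map R M' N' f g =
     quotient_map (free_module R (carrier M' \<times> carrier N')) (tensor_rel R M' N')
       (free_map R (map_prod f g))"


section \<open>Complexes, homology and free resolutions\<close>

text \<open>A complex \<open>\<dots> \<rightarrow> C 2 \<rightarrow> C 1 \<rightarrow> C 0 \<rightarrow> 0\<close> is given by its modules \<open>C n\<close> and differentials
  \<open>d n : C (n + 1) \<rightarrow> C n\<close>.\<close>

fun cycles :: "(nat \<Rightarrow> ('a, 'b) module) \<Rightarrow> (nat \<Rightarrow> 'b \<Rightarrow> 'b) \<Rightarrow> nat \<Rightarrow> 'b set" where
  "cycles C d 0 = carrier (C 0)"
| "cycles C d (Suc n) = a_kernel (C (Suc n)) (C n) (d n)"

definition boundaries ::
    "(nat \<Rightarrow> ('a, 'b) module) \<Rightarrow> (nat \<Rightarrow> 'b \<Rightarrow> 'b) \<Rightarrow> nat \<Rightarrow> 'b set" where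
  "boundaries C d n = d n ` carrier (C (Suc n))"

definition homology ::
    "(nat \<Rightarrow> ('a, 'b) module) \<Rightarrow> (nat \<Rightarrow> 'b \<Rightarrow> 'b) \<Rightarrow> nat \<Rightarrow> ('a, 'b set) module" where
  "homology C d n = quotient_module ((C n)\<lparr>carrier := cycles C d n\<rparr>) (boundaries C d n)"

text \<open>The map on homology induced by a chain map \<open>f\<close> into the complex \<open>(C', d')\<close>.\<close>

definition homology_map ::
    "(nat \<Rightarrow> ('a, 'd) module) \<Rightarrow> (nat \<Rightarrow> 'd \<Rightarrow> 'd) \<Rightarrow> (nat \<Rightarrow> 'b \<Rightarrow> 'd) \<Rightarrow>
     nat \<Rightarrow> 'b set \<Rightarrow> 'd set" where
  "homology_map C' d' f n = quotient_map (C' n) (boundaries C' d' n) (f n)"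

definition free_resolution ::
    "('a, 'c) ring_scheme \<Rightarrow> ('a, 'd, 'e) module_scheme \<Rightarrow>
     (nat \<Rightarrow> ('a, 'b) module) \<Rightarrow> (nat \<Rightarrow> 'b \<Rightarrow> 'b) \<Rightarrow> ('b \<Rightarrow> 'd) \<Rightarrow> bool" where
  "free_resolution R M F d \<epsilon> \<longleftrightarrow>
     (\<forall>n. is_free R (F n)) \<and>
     (\<forall>n. d n \<in> linear_maps R (F (Suc n)) (F n)) \<and>
     \<epsilon> \<in> linear_maps R (F 0) M \<and>
     \<epsilon> ` carrier (F 0) = carrier M \<and>
     boundaries F d 0 = a_kernel (F 0) M \<epsilon> \<and>
     (\<forall>n. boundaries F d (Suc n) = cycles F d (Suc n))"


section \<open>Tor\<close>

text \<open>If \<open>(F, d)\<close> is a free resolution of \<open>M\<close>, then \<open>Tor R F d N i\<close> is \<open>Tor\<^sub>i(M, N)\<close>, computed as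
  the \<open>i\<close>-th homology of \<open>F \<otimes> N\<close>, and \<open>Tor_map R F d N' g i\<close> is the map
  \<open>Tor\<^sub>i(M, N) \<rightarrow> Tor\<^sub>i(M, N')\<close> induced by \<open>g : N \<rightarrow> N'\<close>.
  Another resolution of \<open>M\<close> gives isomorphic modules, naturally in \<open>N\<close>.\<close>

definition tensor_complex ::
    "('a, 'c) ring_scheme \<Rightarrow> (nat \<Rightarrow> ('a, 'b) module) \<Rightarrow> ('a, 'd) module \<Rightarrow>
     nat \<Rightarrow> ('a, ('b \<times> 'd \<Rightarrow> 'a) set) module" where
  "tensor_complex R F N n = tensor_product R (F n) N"

definition tensor_diff ::
    "('a, 'c) ring_scheme \<Rightarrow> (nat \<Rightarrow> ('a, 'b) module) \<Rightarrow> (nat \<Rightarrow> 'b \<Rightarrow> 'b) \<Rightarrow> ('a, 'd) module \<Rightarrow>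
     nat \<Rightarrow> ('b \<times> 'd \<Rightarrow> 'a) set \<Rightarrow> ('b \<times> 'd \<Rightarrow> 'a) set" where
  "tensor_diff R F d N n = tensor_map R (F n) N (d n) (\<lambda>y. y)"

definition Tor ::
    "('a, 'c) ring_scheme \<Rightarrow> (nat \<Rightarrow> ('a, 'b) module) \<Rightarrow> (nat \<Rightarrow> 'b \<Rightarrow> 'b) \<Rightarrow> ('a, 'd) module \<Rightarrow>
     nat \<Rightarrow> ('a, ('b \<times> 'd \<Rightarrow> 'a) set set) module" where
  "Tor R F d N i = homology (tensor_complex R F N) (tensor_diff R F d N) i"

definition Tor_map ::
    "('a, 'c) ring_scheme \<Rightarrow> (nat \<Rightarrow> ('a, 'b) module) \<Rightarrow> (nat \<Rightarrow> 'b \<Rightarrow> 'b) \<Rightarrow> ('a, 'd2) module \<Rightarrow>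
     ('d \<Rightarrow> 'd2) \<Rightarrow> nat \<Rightarrow> ('b \<times> 'd \<Rightarrow> 'a) set set \<Rightarrow> ('b \<times> 'd2 \<Rightarrow> 'a) set set" where
  "Tor_map R F d N' g i =
     homology_map (tensor_complex R F N') (tensor_diff R F d N')
       (\<lambda>n. tensor_map R (F n) N' (\<lambda>x. x) g) i"

text \<open>For a free resolution \<open>(F, d)\<close> of the residue field \<open>k\<close>, the map
  \<open>\<nu>\<^sup>1\<^sub>i : Tor\<^sub>i(k, R/\<mm>\<^sup>2) \<rightarrow> Tor\<^sub>i(k, R/\<mm>)\<close>, and the property that it is zero.\<close>

definition nu1 ::
    "('a, 'c) ring_scheme \<Rightarrow> 'a set \<Rightarrow> (nat \<Rightarrow> ('a, 'b) module) \<Rightarrow> (nat \<Rightarrow> 'b \<Rightarrow> 'b) \<Rightarrow>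
     nat \<Rightarrow> ('b \<times> 'a set \<Rightarrow> 'a) set set \<Rightarrow> ('b \<times> 'a set \<Rightarrow> 'a) set set" where
  "nu1 R \<mm> F d i = Tor_map R F d (residue_module R \<mm>) (residue_map R \<mm>) i"

definition nu1_zero ::
    "('a, 'c) ring_scheme \<Rightarrow> 'a set \<Rightarrow> (nat \<Rightarrow> ('a, 'b) module) \<Rightarrow> (nat \<Rightarrow> 'b \<Rightarrow> 'b) \<Rightarrow> nat \<Rightarrow> bool"
  where
  "nu1_zero R \<mm> F d i \<longleftrightarrow>
     (\<forall>K \<in> carrier (Tor R F d (residue_module R (\<mm> \<cdot>\<^bsub>R\<^esub> \<mm>)) i).
        nu1 R \<mm> F d i K = \<zero>\<^bsub>Tor R F d (residue_module R \<mm>) i\<^esub>)"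

end

theory Submission
  imports Defs
begin

text \<open>Write \<open>J\<close> for \<open>\<mm>\<^sup>2\<close>. As \<open>M \<otimes> R/I \<cong> M/IM\<close>, the map \<open>\<nu>\<^sup>1\<^sub>i\<close> is zero iff \<open>dy \<in> JF\<close> implies \<open>y \<in> dF + \<mm>F\<close> for
  all \<open>y \<in> F\<^sub>i\<close>. If this fails for some \<open>y\<close> in degree 2, then, up to homotopy, \<open>dy\<close> is a cycle
  \<open>z = \<Sum> z\<^sub>k e\<^sub>k\<close> of the Koszul complex \<open>K\<close> on minimal generators \<open>x\<^sub>k\<close> of \<open>\<mm>\<close>, with all \<open>z\<^sub>k \<in> J\<close>. Adjoin a
  divided power variable \<open>T\<close> with \<open>dT = z\<close> to \<open>K\<close> and map \<open>K\<langle>T\<rangle>\<close> to \<open>F\<close>. The image of \<open>T\<^sup>(\<^sup>n\<^sup>)\<close> in \<open>F\<^sub>2\<^sub>n\<close> has its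
  boundary in \<open>JF\<close>, so it suffices that it is not in \<open>dF + \<mm>F\<close>. Since the \<open>x\<^sub>k\<close> are minimal
  generators and \<open>z \<in> JK\<close>, the class of \<open>T\<close> in \<open>Tor\<^sub>2(k, k)\<close> is not in the span of the classes of the
  \<open>e\<^sub>k \<and> e\<^sub>l\<close>. Hence a functional on \<open>Tor\<^sub>2(k, k)\<close> takes the value 1 on \<open>T\<close> and 0 on those. It extends to a chain map
  \<open>\<theta> : F \<rightarrow> F\<close> of degree \<open>-2\<close>, which agrees with \<open>\<partial>/\<partial>T\<close> on \<open>K\<langle>T\<rangle>\<close> up to homotopy. So \<open>\<theta>\<^sup>n\<close>
  sends \<open>T\<^sup>(\<^sup>n\<^sup>)\<close> to 1 modulo \<open>\<mm>\<close>, while it maps \<open>dF + \<mm>F\<close> to itself.\<close>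

text \<open>Neither a multiplication on \<open>F\<close> nor a differential graded algebra has to be
  constructed: \<open>K<T>\<close> enters only through the scalars in its differential, and a chain
  map out of it is just a family of elements of \<open>F\<close>. Divided powers make the argument
  independent of the characteristic: the boundary of the n-th divided power of \<open>T\<close> is
  \<open>z\<close> times the preceding one without a factor n, so the iterated derivation ends at 1
  and not at a factorial. The functional has to vanish on the products of two generators because
  \<open>\<partial>/\<partial>T\<close> does; this is the agreement in degree 0 from which the
  homotopy starts. Working up to homotopy does no harm, because all \<open>x\<^sub>k\<close> and
  \<open>z\<^sub>k\<close> lie in \<open>\<mm>\<close>: of the two terms of a homotopy, one is a
  boundary and the other lies in \<open>\<mm>F\<close>. Since the resolution need not be minimal,
  statements about bases are replaced by lifts that are linear, and linear maps carry
  \<open>JF\<close> into \<open>JF\<close>; choosing preimages one element at a time would lose that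
  control.\<close>

subsection \<open>Free modules\<close>

lemma (in abelian_group) diff_zero:
  assumes "x \<in> carrier G"
  shows "x \<ominus> \<zero> = x"
proof -
  have "\<ominus> \<zero> = \<zero>" by (rule minus_equality) simp_all
  with assms show ?thesis by (simp add: a_minus_def)
qed

lemma linear_mapsD:
  assumes "f \<in> linear_maps R M N"
  shows "x \<in> carrier M \<Longrightarrow> f x \<in> carrier N"
    and "\<lbrakk>x \<in> carrier M; y \<in> carrier M\<rbrakk> \<Longrightarrow> f (x \<oplus>\<^bsub>M\<^esub> y) = f x \<oplus>\<^bsub>N\<^esub> f y"
    and "\<lbrakk>r \<in> carrier R; x \<in> carrier M\<rbrakk> \<Longrightarrow> f (r \<odot>\<^bsub>M\<^esub> x) = r \<odot>\<^bsub>N\<^esub> f x"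
  using assms by (auto simp: linear_maps_def)

lemma linear_maps_zero:
  assumes "module R M" "module R N" "f \<in> linear_maps R M N"
  shows "f \<zero>\<^bsub>M\<^esub> = \<zero>\<^bsub>N\<^esub>"
proof -
  interpret M: module R M by fact
  interpret N: module R N by fact
  have "f (\<zero>\<^bsub>R\<^esub> \<odot>\<^bsub>M\<^esub> \<zero>\<^bsub>M\<^esub>) = \<zero>\<^bsub>R\<^esub> \<odot>\<^bsub>N\<^esub> f \<zero>\<^bsub>M\<^esub>"
    by (rule linear_mapsD(3)[OF assms(3)]) auto
  then show ?thesis
    using linear_mapsD(1)[OF assms(3)] by simp
qed

lemma linear_maps_uminus:
  assumes "module R M" "module R N" "f \<in> linear_maps R M N" "x \<in> carrier M"
  shows "f (\<ominus>\<^bsub>M\<^esub> x) = \<ominus>\<^bsub>N\<^esub> f x"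
proof -
  interpret M: module R M by fact
  interpret N: module R N by fact
  have "f ((\<ominus>\<^bsub>R\<^esub> \<one>\<^bsub>R\<^esub>) \<odot>\<^bsub>M\<^esub> x) = (\<ominus>\<^bsub>R\<^esub> \<one>\<^bsub>R\<^esub>) \<odot>\<^bsub>N\<^esub> f x"
    by (rule linear_mapsD(3)[OF assms(3)]) (use assms(4) in auto)
  then show ?thesis
    using linear_mapsD(1)[OF assms(3,4)] assms(4) by (simp add: M.smult_l_minus N.smult_l_minus)
qed

lemma linear_maps_minus:
  assumes "module R M" "module R N" "f \<in> linear_maps R M N" "x \<in> carrier M" "y \<in> carrier M"
  shows "f (x \<ominus>\<^bsub>M\<^esub> y) = f x \<ominus>\<^bsub>N\<^esub> f y"
proof -
  interpret M: module R M by fact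
  show ?thesis
    using assms(4,5)
    by (simp add: a_minus_def linear_mapsD(2)[OF assms(3)] linear_maps_uminus[OF assms(1-3)])
qed

lemma linear_maps_finsum:
  assumes "module R M" "module R N" "f \<in> linear_maps R M N" "finite A" "g \<in> A \<rightarrow> carrier M"
  shows "f (\<Oplus>\<^bsub>M\<^esub>a\<in>A. g a) = (\<Oplus>\<^bsub>N\<^esub>a\<in>A. f (g a))"
proof -
  interpret M: module R M by fact
  interpret N: module R N by fact
  show ?thesis
    using assms(4,5)
  proof (induction A rule: finite_induct)
    case empty
    then show ?case by (simp add: linear_maps_zero[OF assms(1-3)])
  next
    case (insert a A)
    then have "f (g a \<oplus>\<^bsub>M\<^esub> finsum M g A) = f (g a) \<oplus>\<^bsub>N\<^esub> f (finsum M g A)"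
      by (intro linear_mapsD(2)[OF assms(3)] M.finsum_closed) auto
    with insert show ?case
      using linear_mapsD(1)[OF assms(3)] by (subst N.finsum_insert) (auto simp: Pi_iff)
  qed
qed

lemma linear_maps_comp:
  assumes "f \<in> linear_maps R M N" "g \<in> linear_maps R N P"
  shows "(\<lambda>x. g (f x)) \<in> linear_maps R M P"
  using assms by (auto simp: linear_maps_def Pi_iff)

lemma linear_maps_id: "(\<lambda>x. x) \<in> linear_maps R M M"
  by (simp add: linear_maps_def)

lemma linear_maps_diff:
  assumes "module R M" "module R N" "f \<in> linear_maps R M N" "g \<in> linear_maps R M N"
  shows "(\<lambda>x. f x \<ominus>\<^bsub>N\<^esub> g x) \<in> linear_maps R M N"
proof -
  interpret N: module R N by fact
  note f = linear_mapsD[OF assms(3)] and g = linear_mapsD[OF assms(4)]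
  show ?thesis
    unfolding linear_maps_def
    by (simp add: f g a_minus_def N.M.minus_add N.M.a_ac N.smult_r_distr N.smult_r_minus Pi_iff)
qed

lemma module_free_module:
  assumes "cring R"
  shows "module R (free_module R S)"
proof -
  interpret cring R by fact
  have fin_add: "finite {s. f s \<oplus>\<^bsub>R\<^esub> g s \<noteq> \<zero>\<^bsub>R\<^esub>}"
    if "finite {s. f s \<noteq> \<zero>\<^bsub>R\<^esub>}" "finite {s. g s \<noteq> \<zero>\<^bsub>R\<^esub>}" for f g :: "'c \<Rightarrow> 'a"
    by (rule finite_subset[OF _ finite_UnI[OF that]]) auto
  have fin_smult: "finite {s. r \<otimes>\<^bsub>R\<^esub> f s \<noteq> \<zero>\<^bsub>R\<^esub>}"
    if "finite {s. f s \<noteq> \<zero>\<^bsub>R\<^esub>}" "r \<in> carrier R" for f :: "'c \<Rightarrow> 'a" and r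
    by (rule finite_subset[OF _ that(1)]) (use that(2) in auto)
  show ?thesis
  proof (rule moduleI)
    show "cring R" by fact
    show "abelian_group (free_module R S)"
    proof (rule abelian_groupI)
      fix f assume "f \<in> carrier (free_module R S)"
      then have "(\<lambda>s. \<ominus>\<^bsub>R\<^esub> f s) \<in> carrier (free_module R S)"
        using fin_smult[of f "\<ominus>\<^bsub>R\<^esub> \<one>\<^bsub>R\<^esub>"] by (auto simp: free_module_def l_minus)
      moreover have "(\<lambda>s. \<ominus>\<^bsub>R\<^esub> f s) \<oplus>\<^bsub>free_module R S\<^esub> f = \<zero>\<^bsub>free_module R S\<^esub>"
        using \<open>f \<in> _\<close> by (auto simp: free_module_def l_neg)
      ultimately show "\<exists>g\<in>carrier (free_module R S). g \<oplus>\<^bsub>free_module R S\<^esub> f = \<zero>\<^bsub>free_module R S\<^esub>"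
        by blast
    qed (auto simp: free_module_def a_ac fin_add)
  qed (auto simp: free_module_def fin_smult l_distr r_distr m_assoc)
qed

lemma free_gen_closed:
  assumes "cring R" "s \<in> S"
  shows "free_gen R s \<in> carrier (free_module R S)"
proof -
  interpret cring R by fact
  have "finite {t. free_gen R s t \<noteq> \<zero>\<^bsub>R\<^esub>}"
    by (rule finite_subset[of _ "{s}"]) (auto simp: free_gen_def)
  with \<open>s \<in> S\<close> show ?thesis
    by (auto simp: free_module_def free_gen_def)
qed

text \<open>\<open>lincomb\<close> is the case where \<open>g\<close> is the identity, and on the
  free module \<open>free_map\<close> is the case \<open>g s = free_gen R (h s)\<close>; so all maps
  out of free modules are treated together.\<close>

definition free_extension ::
    "('a, 'c) ring_scheme \<Rightarrow> ('a, 'b, 'e) module_scheme \<Rightarrow> ('s \<Rightarrow> 'b) \<Rightarrow> ('s \<Rightarrow> 'a) \<Rightarrow> 'b"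
  where "free_extension R M g f = (\<Oplus>\<^bsub>M\<^esub>s\<in>{s. f s \<noteq> \<zero>\<^bsub>R\<^esub>}. f s \<odot>\<^bsub>M\<^esub> g s)"

lemma free_extension_superset:
  assumes "module R M" "g \<in> S \<rightarrow> carrier M" "f \<in> carrier (free_module R S)"
    and "finite A" "A \<subseteq> S" "{s. f s \<noteq> \<zero>\<^bsub>R\<^esub>} \<subseteq> A"
  shows "free_extension R M g f = (\<Oplus>\<^bsub>M\<^esub>s\<in>A. f s \<odot>\<^bsub>M\<^esub> g s)"
proof -
  interpret module R M by fact
  show ?thesis
    unfolding free_extension_def using assms(2-6)
    by (intro add.finprod_mono_neutral_cong_left) (auto simp: free_module_def Pi_iff subset_iff)
qed

lemma free_extension_linear:
  assumes "module R M" "g \<in> S \<rightarrow> carrier M"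
  shows "free_extension R M g \<in> linear_maps R (free_module R S) M"
proof -
  interpret module R M by fact
  interpret L: module R "free_module R S" by (rule module_free_module) unfold_locales
  note sup = free_extension_superset[OF assms]
  have fin: "finite {s. f s \<noteq> \<zero>\<^bsub>R\<^esub>}" "{s. f s \<noteq> \<zero>\<^bsub>R\<^esub>} \<subseteq> S" "f s \<in> carrier R"
    if "f \<in> carrier (free_module R S)" for f s
    using that by (auto simp: free_module_def)
  have gc: "g s \<in> carrier M" if "s \<in> S" for s using assms(2) that by auto
  show ?thesis
    unfolding linear_maps_def
  proof (clarsimp, intro conjI ballI)
    show "free_extension R M g \<in> carrier (free_module R S) \<rightarrow> carrier M"
      unfolding free_extension_def using fin gc
      by (intro Pi_I finsum_closed) (blast intro: smult_closed)
  next
    fix f h assume f: "f \<in> carrier (free_module R S)" and h: "h \<in> carrier (free_module R S)"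
    let ?A = "{s. f s \<noteq> \<zero>\<^bsub>R\<^esub>} \<union> {s. h s \<noteq> \<zero>\<^bsub>R\<^esub>}"
    have A: "finite ?A" "?A \<subseteq> S" using f h fin by auto
    have sub: "{s. (f \<oplus>\<^bsub>free_module R S\<^esub> h) s \<noteq> \<zero>\<^bsub>R\<^esub>} \<subseteq> ?A"
      by (auto simp: free_module_def)
    have "free_extension R M g (f \<oplus>\<^bsub>free_module R S\<^esub> h)
        = (\<Oplus>\<^bsub>M\<^esub>s\<in>?A. (f \<oplus>\<^bsub>free_module R S\<^esub> h) s \<odot>\<^bsub>M\<^esub> g s)"
      using f h A sub by (intro sup) auto
    also have "\<dots> = (\<Oplus>\<^bsub>M\<^esub>s\<in>?A. f s \<odot>\<^bsub>M\<^esub> g s \<oplus>\<^bsub>M\<^esub> h s \<odot>\<^bsub>M\<^esub> g s)"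
      using A gc fin(3)[OF f] fin(3)[OF h]
      by (intro finsum_cong') (auto simp: free_module_def smult_l_distr subset_iff)
    also have "\<dots> = (\<Oplus>\<^bsub>M\<^esub>s\<in>?A. f s \<odot>\<^bsub>M\<^esub> g s) \<oplus>\<^bsub>M\<^esub> (\<Oplus>\<^bsub>M\<^esub>s\<in>?A. h s \<odot>\<^bsub>M\<^esub> g s)"
      using A gc fin(3)[OF f] fin(3)[OF h] by (intro finsum_addf Pi_I) (blast intro: smult_closed)+
    also have "\<dots> = free_extension R M g f \<oplus>\<^bsub>M\<^esub> free_extension R M g h"
      using f h A by (simp add: sup[of _ ?A])
    finally show "free_extension R M g (f \<oplus>\<^bsub>free_module R S\<^esub> h)
      = free_extension R M g f \<oplus>\<^bsub>M\<^esub> free_extension R M g h" .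
  next
    fix r f assume r: "r \<in> carrier R" and f: "f \<in> carrier (free_module R S)"
    let ?A = "{s. f s \<noteq> \<zero>\<^bsub>R\<^esub>}"
    have A: "finite ?A" "?A \<subseteq> S" using f fin by auto
    have sub: "{s. (r \<odot>\<^bsub>free_module R S\<^esub> f) s \<noteq> \<zero>\<^bsub>R\<^esub>} \<subseteq> ?A"
      using r by (auto simp: free_module_def)
    have "free_extension R M g (r \<odot>\<^bsub>free_module R S\<^esub> f)
        = (\<Oplus>\<^bsub>M\<^esub>s\<in>?A. (r \<odot>\<^bsub>free_module R S\<^esub> f) s \<odot>\<^bsub>M\<^esub> g s)"
      using f r A sub by (intro sup) auto
    also have "\<dots> = (\<Oplus>\<^bsub>M\<^esub>s\<in>?A. r \<odot>\<^bsub>M\<^esub> (f s \<odot>\<^bsub>M\<^esub> g s))"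
      using A gc fin(3)[OF f] r
      by (intro finsum_cong') (auto simp: free_module_def smult_assoc1 subset_iff)
    also have "\<dots> = r \<odot>\<^bsub>M\<^esub> free_extension R M g f"
      unfolding free_extension_def using A gc fin(3)[OF f] r
      by (subst finsum_smult_ldistr) auto
    finally show "free_extension R M g (r \<odot>\<^bsub>free_module R S\<^esub> f) = r \<odot>\<^bsub>M\<^esub> free_extension R M g f" .
  qed
qed

lemma free_extension_free_gen:
  assumes "module R M" "g \<in> S \<rightarrow> carrier M" "s \<in> S"
  shows "free_extension R M g (free_gen R s) = g s"
proof -
  interpret module R M by fact
  have "free_extension R M g (free_gen R s) = (\<Oplus>\<^bsub>M\<^esub>t\<in>{s}. free_gen R s t \<odot>\<^bsub>M\<^esub> g t)"
    using assms free_gen_closed[OF is_cring assms(3)]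
    by (intro free_extension_superset) (auto simp: free_gen_def)
  also have "\<dots> = g s"
    using assms by (simp add: free_gen_def Pi_iff)
  finally show ?thesis .
qed

lemma free_extension_in_submodule:
  assumes "module R M" "submodule H R M" "g \<in> S \<rightarrow> H" "f \<in> carrier (free_module R S)"
  shows "free_extension R M g f \<in> H"
proof -
  interpret module R M by fact
  interpret H: submodule H R M by fact
  have HM: "H \<subseteq> carrier M" using submoduleE[OF assms(2)] by blast
  have "(\<Oplus>\<^bsub>M\<^esub>s\<in>A. f s \<odot>\<^bsub>M\<^esub> g s) \<in> H" if "finite A" "A \<subseteq> S" for A
    using that
  proof (induction A rule: finite_induct)
    case empty
    then show ?case using submoduleE[OF assms(2)] by (auto simp: H.one_closed[simplified])
  next
    case (insert s A)
    have fg: "f t \<odot>\<^bsub>M\<^esub> g t \<in> H" if "t \<in> S" for t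
      using assms(3,4) that by (auto simp: free_module_def)
    from insert have "(\<Oplus>\<^bsub>M\<^esub>s\<in>insert s A. f s \<odot>\<^bsub>M\<^esub> g s)
        = f s \<odot>\<^bsub>M\<^esub> g s \<oplus>\<^bsub>M\<^esub> (\<Oplus>\<^bsub>M\<^esub>s\<in>A. f s \<odot>\<^bsub>M\<^esub> g s)"
      using HM fg by (intro finsum_insert) auto
    with insert fg show ?case
      using submoduleE(5)[OF assms(2)] by auto
  qed
  with assms(4) show ?thesis
    by (auto simp: free_extension_def free_module_def)
qed

lemma free_map_free_extension:
  assumes "cring R" "h \<in> S \<rightarrow> S'" "f \<in> carrier (free_module R S)"
  shows "free_map R h f = free_extension R (free_module R S') (\<lambda>s. free_gen R (h s)) f"
proof
  fix t
  interpret cring R by fact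
  let ?L = "free_module R S'"
  interpret L: module R ?L by (rule module_free_module) fact
  have f: "f s \<in> carrier R" for s using assms(3) by (auto simp: free_module_def)
  have gen: "free_gen R (h s) \<in> carrier ?L" if "s \<in> S" for s
    using that assms(2) by (intro free_gen_closed assms(1)) auto
  let ?sum = "\<lambda>A. \<Oplus>\<^bsub>?L\<^esub>s\<in>A. f s \<odot>\<^bsub>?L\<^esub> free_gen R (h s)"
  have eval: "?sum A t = (\<Oplus>\<^bsub>R\<^esub>s\<in>{s \<in> A. h s = t}. f s)" if "finite A" "A \<subseteq> S" for A
    using that
  proof (induction A rule: finite_induct)
    case empty
    show ?case by (subst L.finsum_empty) (simp add: free_module_def)
  next
    case (insert s A)
    then have "?sum (insert s A) = f s \<odot>\<^bsub>?L\<^esub> free_gen R (h s) \<oplus>\<^bsub>?L\<^esub> ?sum A"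
      using gen f by (intro L.finsum_insert) auto
    then have "?sum (insert s A) t = (f s \<odot>\<^bsub>?L\<^esub> free_gen R (h s) \<oplus>\<^bsub>?L\<^esub> ?sum A) t"
      by (rule fun_cong)
    also have "\<dots> = f s \<otimes>\<^bsub>R\<^esub> free_gen R (h s) t \<oplus>\<^bsub>R\<^esub> (\<Oplus>\<^bsub>R\<^esub>s\<in>{s \<in> A. h s = t}. f s)"
      using insert by (simp add: free_module_def)
    also have "\<dots> = (\<Oplus>\<^bsub>R\<^esub>s\<in>{s' \<in> insert s A. h s' = t}. f s)"
    proof (cases "h s = t")
      case True
      then have "{s' \<in> insert s A. h s' = t} = insert s {s \<in> A. h s = t}" by auto
      with True insert f show ?thesis by (simp add: free_gen_def)
    next
      case False
      then have "{s' \<in> insert s A. h s' = t} = {s \<in> A. h s = t}" by auto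
      with False insert f show ?thesis by (simp add: free_gen_def)
    qed
    finally show ?case .
  qed
  show "free_map R h f t = free_extension R ?L (\<lambda>s. free_gen R (h s)) f t"
    unfolding free_extension_def free_map_def
    by (subst eval) (use assms(3) in \<open>auto simp: free_module_def\<close>)
qed

lemma free_extension_free_gen_self:
  assumes "cring R" "f \<in> carrier (free_module R S)"
  shows "free_extension R (free_module R S) (free_gen R) f = f"
proof -
  interpret cring R by fact
  have "free_map R (\<lambda>s. s) f t = f t" for t
  proof (cases "f t = \<zero>\<^bsub>R\<^esub>")
    case True
    then have "{s. f s \<noteq> \<zero>\<^bsub>R\<^esub> \<and> s = t} = {}" by auto
    with True show ?thesis by (simp only: free_map_def finsum_empty)
  next
    case False
    then have "{s. f s \<noteq> \<zero>\<^bsub>R\<^esub> \<and> s = t} = {t}" by auto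
    moreover have "f t \<in> carrier R" using assms(2) by (simp add: free_module_def)
    ultimately show ?thesis by (simp add: free_map_def)
  qed
  then show ?thesis using free_map_free_extension[OF assms(1) _ assms(2), of "\<lambda>s. s" S] by auto
qed

text \<open>The elements with \<open>P\<close> form a submodule that contains the generators.
  Closure under negation comes from the scalar \<open>-1\<close>, so it needs no case of its
  own.\<close>

lemma free_module_induct [consumes 2, case_names zero gen add smult]:
  assumes "cring R" "f \<in> carrier (free_module R S)"
    and "P \<zero>\<^bsub>free_module R S\<^esub>"
    and "\<And>s. s \<in> S \<Longrightarrow> P (free_gen R s)"
    and "\<And>f g. \<lbrakk>f \<in> carrier (free_module R S); g \<in> carrier (free_module R S); P f; P g\<rbrakk>
          \<Longrightarrow> P (f \<oplus>\<^bsub>free_module R S\<^esub> g)"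
    and "\<And>r f. \<lbrakk>r \<in> carrier R; f \<in> carrier (free_module R S); P f\<rbrakk>
          \<Longrightarrow> P (r \<odot>\<^bsub>free_module R S\<^esub> f)"
  shows "P f"
proof -
  interpret cring R by fact
  interpret L: module R "free_module R S" by (rule module_free_module) unfold_locales
  let ?H = "{f \<in> carrier (free_module R S). P f}"
  have neg: "\<ominus>\<^bsub>free_module R S\<^esub> f = (\<ominus>\<^bsub>R\<^esub> \<one>\<^bsub>R\<^esub>) \<odot>\<^bsub>free_module R S\<^esub> f"
    if "f \<in> carrier (free_module R S)" for f
    using that by (simp add: L.smult_l_minus)
  have "submodule ?H R (free_module R S)"
    by (rule L.submoduleI) (use assms neg in auto)
  then have "free_extension R (free_module R S) (free_gen R) f \<in> ?H"
    using assms free_gen_closed[OF assms(1)]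
    by (intro free_extension_in_submodule[where S = S] L.module_axioms) auto
  then show ?thesis
    using assms(2) by (simp add: free_extension_free_gen_self[OF assms(1)])
qed

text \<open>Projectivity of free modules, with a condition on images in place of surjectivity of
  \<open>p\<close>. All chain maps, homotopies and functionals on \<open>F\<close> are built with
  it.\<close>

lemma linear_lift:
  assumes "is_free R M" "module R N" "module R P"
    and f: "f \<in> linear_maps R M P" and p: "p \<in> linear_maps R N P"
    and lift: "f ` carrier M \<subseteq> p ` carrier N"
  shows "\<exists>h\<in>linear_maps R M N. \<forall>x\<in>carrier M. p (h x) = f x"
proof -
  obtain B where M: "module R M" and B: "B \<subseteq> carrier M"
    and bij: "bij_betw (lincomb R M) (carrier (free_module R B)) (carrier M)"
    using assms(1) by (auto simp: is_free_def)
  interpret M: module R M by fact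
  interpret N: module R N by fact
  let ?L = "free_module R B"
  interpret L: module R ?L by (rule module_free_module) unfold_locales
  have lincomb: "lincomb R M = free_extension R M (\<lambda>b. b)"
    by (simp add: fun_eq_iff lincomb_def free_extension_def)
  have idB: "(\<lambda>b. b) \<in> B \<rightarrow> carrier M" using B by auto
  have lin: "lincomb R M \<in> linear_maps R ?L M"
    unfolding lincomb by (rule free_extension_linear[OF M idB])
  \<comment> \<open>The coordinates with respect to \<open>B\<close>. As the inverse of a linear
    bijection they are linear, and followed by the extension of chosen preimages they give the
    lift.\<close>
  define c where "c = inv_into (carrier ?L) (lincomb R M)"
  have c: "c x \<in> carrier ?L" "lincomb R M (c x) = x" if "x \<in> carrier M" for x
    using that bij unfolding c_def by (auto simp: bij_betw_def inv_into_into f_inv_into_f)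
  have cI: "c (lincomb R M f) = f" if "f \<in> carrier ?L" for f
    using that bij unfolding c_def by (auto simp: bij_betw_def)
  have "c (x \<oplus>\<^bsub>M\<^esub> y) = c x \<oplus>\<^bsub>?L\<^esub> c y" if "x \<in> carrier M" "y \<in> carrier M" for x y
    using cI[of "c x \<oplus>\<^bsub>?L\<^esub> c y"] that c by (simp add: linear_mapsD(2)[OF lin])
  moreover have "c (r \<odot>\<^bsub>M\<^esub> x) = r \<odot>\<^bsub>?L\<^esub> c x" if "r \<in> carrier R" "x \<in> carrier M" for r x
    using cI[of "r \<odot>\<^bsub>?L\<^esub> c x"] that c by (simp add: linear_mapsD(3)[OF lin])
  ultimately have c_lin: "c \<in> linear_maps R M ?L"
    using c by (auto simp: linear_maps_def)
  define g where "g x = (SOME y. y \<in> carrier N \<and> p y = f x)" for x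
  have g: "g x \<in> carrier N \<and> p (g x) = f x" if "x \<in> carrier M" for x
  proof -
    have "f x \<in> p ` carrier N" using lift that by blast
    then have "\<exists>y. y \<in> carrier N \<and> p y = f x" by (metis imageE)
    then show ?thesis unfolding g_def by (rule someI_ex)
  qed
  have gB: "g \<in> B \<rightarrow> carrier N" using g B by auto
  note g_lin = free_extension_linear[OF \<open>module R N\<close> gB]
  have eq: "p (free_extension R N g k) = f (lincomb R M k)" if "k \<in> carrier ?L" for k
    using M.is_cring that
  proof (induction k rule: free_module_induct)
    case zero
    show ?case
      using linear_maps_zero[OF L.module_axioms M lin] linear_maps_zero[OF M assms(3) f]
        linear_maps_zero[OF L.module_axioms assms(2) g_lin] linear_maps_zero[OF assms(2,3) p]
      by simp
  next
    case (gen b)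
    then show ?case
      using g B by (auto simp: lincomb free_extension_free_gen[OF M idB]
          free_extension_free_gen[OF assms(2) gB])
  next
    case (add k k')
    then show ?case
      using linear_mapsD(1)[OF lin] linear_mapsD(1)[OF g_lin]
      by (simp add: linear_mapsD(2)[OF lin] linear_mapsD(2)[OF g_lin] linear_mapsD(2)[OF f] linear_mapsD(2)[OF p])
  next
    case (smult r k)
    then show ?case
      using linear_mapsD(1)[OF lin] linear_mapsD(1)[OF g_lin]
      by (simp add: linear_mapsD(3)[OF lin] linear_mapsD(3)[OF g_lin] linear_mapsD(3)[OF f] linear_mapsD(3)[OF p])
  qed
  have "\<forall>x\<in>carrier M. p (free_extension R N g (c x)) = f x" using eq[OF c(1)] c(2) by simp
  then show ?thesis by (rule bexI[OF _ linear_maps_comp[OF c_lin g_lin]])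
qed

subsection \<open>Quotient modules\<close>

lemma submodule_coset_iff:
  assumes "module R M" "submodule H R M" "x \<in> carrier M"
  shows "y \<in> H +>\<^bsub>M\<^esub> x \<longleftrightarrow> y \<in> carrier M \<and> y \<ominus>\<^bsub>M\<^esub> x \<in> H"
proof -
  interpret module R M by fact
  interpret H: abelian_subgroup H M
    using assms(2) by (intro abelian_subgroupI3 additive_subgroup.intro abelian_group_axioms)
      (simp add: submodule_def)
  show ?thesis
    using H.a_rcos_module[of x y] assms(3) a_r_coset_subset_G[OF H.a_subset assms(3)] is_abelian_group
    by (auto simp: a_minus_def)
qed

lemma submodule_coset_eq_iff:
  assumes "module R M" "submodule H R M" "x \<in> carrier M" "y \<in> carrier M"
  shows "H +>\<^bsub>M\<^esub> x = H +>\<^bsub>M\<^esub> y \<longleftrightarrow> x \<ominus>\<^bsub>M\<^esub> y \<in> H"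
proof -
  interpret module R M by fact
  have sg: "subgroup H (add_monoid M)" using assms(2) by (simp add: submodule_def)
  have "x \<ominus>\<^bsub>M\<^esub> x \<in> H"
    using assms(3) submoduleE(2,4)[OF assms(2)] subgroup.one_closed[OF sg] by (simp add: a_minus_def r_neg)
  then have "x \<in> H +>\<^bsub>M\<^esub> x"
    using assms by (simp add: submodule_coset_iff)
  then show ?thesis
    using a_repr_independence[OF _ assms(4) sg, of x] submodule_coset_iff[OF assms(1,2,4), of x] assms(3)
    by auto
qed

lemma quotient_module_carrier:
  "carrier (quotient_module M H) = (\<lambda>x. H +>\<^bsub>M\<^esub> x) ` carrier M"
  by (auto simp: quotient_module_def A_RCOSETS_def')

lemma quotient_module_zero:
  assumes "module R M" "submodule H R M"
  shows "\<zero>\<^bsub>quotient_module M H\<^esub> = H +>\<^bsub>M\<^esub> \<zero>\<^bsub>M\<^esub>"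
proof -
  interpret module R M by fact
  show ?thesis
    using submoduleE(1)[OF assms(2)] by (simp add: quotient_module_def)
qed

lemma quotient_module_add:
  assumes "module R M" "submodule H R M" "x \<in> carrier M" "y \<in> carrier M"
  shows "(H +>\<^bsub>M\<^esub> x) \<oplus>\<^bsub>quotient_module M H\<^esub> (H +>\<^bsub>M\<^esub> y) = H +>\<^bsub>M\<^esub> (x \<oplus>\<^bsub>M\<^esub> y)"
proof -
  interpret module R M by fact
  interpret H: abelian_subgroup H M
    using assms(2) by (intro abelian_subgroupI3 additive_subgroup.intro abelian_group_axioms)
      (simp add: submodule_def)
  show ?thesis
    using assms(3,4) by (simp add: quotient_module_def H.a_rcos_sum)
qed

text \<open>The multiples by \<open>r\<close> of the elements of a coset need not fill a coset; the
  summand \<open>H\<close> in the definition of the quotient repairs this.\<close>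

lemma quotient_module_smult:
  assumes "module R M" "submodule H R M" "r \<in> carrier R" "x \<in> carrier M"
  shows "r \<odot>\<^bsub>quotient_module M H\<^esub> (H +>\<^bsub>M\<^esub> x) = H +>\<^bsub>M\<^esub> (r \<odot>\<^bsub>M\<^esub> x)"
proof -
  interpret module R M by fact
  interpret H: submodule H R M by fact
  have HM: "H \<subseteq> carrier M" using submoduleE(1)[OF assms(2)] .
  have decomp: "h \<oplus>\<^bsub>M\<^esub> r \<odot>\<^bsub>M\<^esub> (h' \<oplus>\<^bsub>M\<^esub> x) = (h \<oplus>\<^bsub>M\<^esub> r \<odot>\<^bsub>M\<^esub> h') \<oplus>\<^bsub>M\<^esub> r \<odot>\<^bsub>M\<^esub> x"
    and closed: "h \<oplus>\<^bsub>M\<^esub> r \<odot>\<^bsub>M\<^esub> h' \<in> H" if "h \<in> H" "h' \<in> H" for h h'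
  proof -
    have [simp]: "h \<in> carrier M" "h' \<in> carrier M" using that HM by auto
    show "h \<oplus>\<^bsub>M\<^esub> r \<odot>\<^bsub>M\<^esub> (h' \<oplus>\<^bsub>M\<^esub> x) = (h \<oplus>\<^bsub>M\<^esub> r \<odot>\<^bsub>M\<^esub> h') \<oplus>\<^bsub>M\<^esub> r \<odot>\<^bsub>M\<^esub> x"
      using assms(3,4) by (simp add: smult_r_distr M.a_assoc)
    show "h \<oplus>\<^bsub>M\<^esub> r \<odot>\<^bsub>M\<^esub> h' \<in> H"
      using that assms(3) submoduleE(4,5)[OF assms(2)] by blast
  qed
  have zero: "\<zero>\<^bsub>M\<^esub> \<in> H" using H.one_closed by simp
  have "{h \<oplus>\<^bsub>M\<^esub> r \<odot>\<^bsub>M\<^esub> (h' \<oplus>\<^bsub>M\<^esub> x) | h h'. h \<in> H \<and> h' \<in> H} = {h \<oplus>\<^bsub>M\<^esub> r \<odot>\<^bsub>M\<^esub> x | h. h \<in> H}"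
    (is "?A = ?B")
  proof
    show "?A \<subseteq> ?B" using decomp closed by blast
    show "?B \<subseteq> ?A"
    proof
      fix y assume "y \<in> ?B"
      then obtain h where "h \<in> H" "y = h \<oplus>\<^bsub>M\<^esub> r \<odot>\<^bsub>M\<^esub> x" by blast
      moreover from this have "y = h \<oplus>\<^bsub>M\<^esub> r \<odot>\<^bsub>M\<^esub> (\<zero>\<^bsub>M\<^esub> \<oplus>\<^bsub>M\<^esub> x)"
        using assms(4) by simp
      ultimately show "y \<in> ?A" using zero by blast
    qed
  qed
  moreover have "H <+>\<^bsub>M\<^esub> ((\<lambda>x. r \<odot>\<^bsub>M\<^esub> x) ` (H +>\<^bsub>M\<^esub> x)) = ?A"
    unfolding set_add_def' a_r_coset_def' by auto
  moreover have "H +>\<^bsub>M\<^esub> (r \<odot>\<^bsub>M\<^esub> x) = ?B"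
    unfolding a_r_coset_def' by auto
  ultimately show ?thesis
    by (simp add: quotient_module_def)
qed

lemma module_quotient_module:
  assumes "module R M" "submodule H R M"
  shows "module R (quotient_module M H)"
proof -
  interpret module R M by fact
  note simps = quotient_module_carrier quotient_module_zero[OF assms] quotient_module_add[OF assms]
    quotient_module_smult[OF assms]
  show ?thesis
  proof (rule moduleI)
    show "cring R" by unfold_locales
    show "abelian_group (quotient_module M H)"
    proof (rule abelian_groupI)
      fix K assume "K \<in> carrier (quotient_module M H)"
      then obtain x where x: "x \<in> carrier M" "K = H +>\<^bsub>M\<^esub> x" by (auto simp: simps)
      then show "\<exists>K'\<in>carrier (quotient_module M H). K' \<oplus>\<^bsub>quotient_module M H\<^esub> K = \<zero>\<^bsub>quotient_module M H\<^esub>"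
        by (intro bexI[of _ "H +>\<^bsub>M\<^esub> (\<ominus>\<^bsub>M\<^esub> x)"]) (auto simp: simps M.l_neg)
    qed (auto simp: simps M.a_ac)
  qed (auto simp: simps smult_l_distr smult_r_distr smult_assoc1)
qed

lemma quotient_projection_linear:
  assumes "module R M" "submodule H R M"
  shows "(\<lambda>x. H +>\<^bsub>M\<^esub> x) \<in> linear_maps R M (quotient_module M H)"
  using assms by (auto simp: linear_maps_def quotient_module_carrier quotient_module_add quotient_module_smult)

section \<open>The ring as a module over itself, and its residue rings\<close>

lemma module_regular_module:
  assumes "cring R"
  shows "module R (regular_module R)"
proof -
  interpret cring R by fact
  show ?thesis
  proof (rule moduleI)
    show "abelian_group (regular_module R)"
    proof (rule abelian_groupI)
      fix x assume "x \<in> carrier (regular_module R)"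
      then show "\<exists>y\<in>carrier (regular_module R). y \<oplus>\<^bsub>regular_module R\<^esub> x = \<zero>\<^bsub>regular_module R\<^esub>"
        by (intro bexI[of _ "\<ominus>\<^bsub>R\<^esub> x"]) (auto simp: regular_module_def l_neg)
    qed (auto simp: regular_module_def a_ac)
  qed (auto simp: regular_module_def l_distr r_distr m_assoc assms)
qed

lemma regular_module_simps:
  "carrier (regular_module R) = carrier R" "ring.add (regular_module R) = ring.add R"
  "ring.zero (regular_module R) = ring.zero R" "module.smult (regular_module R) = monoid.mult R"
  by (simp_all add: regular_module_def)

lemma finsum_regular_module: "finsum (regular_module R) = finsum R"
  by (simp add: finsum_def finprod_def regular_module_def fun_eq_iff)

lemma smult_right_linear:
  assumes "module R M" "v \<in> carrier M"
  shows "(\<lambda>a. a \<odot>\<^bsub>M\<^esub> v) \<in> linear_maps R (regular_module R) M"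
proof -
  interpret module R M by fact
  show ?thesis
    using assms(2) by (auto simp: linear_maps_def regular_module_simps smult_l_distr smult_assoc1)
qed

lemma free_module_coordinate_linear:
  "(\<lambda>f. f s) \<in> linear_maps R (free_module R S) (regular_module R)"
  by (auto simp: linear_maps_def free_module_def regular_module_def)

lemma regular_module_minus:
  assumes "cring R" "x \<in> carrier R" "y \<in> carrier R"
  shows "x \<ominus>\<^bsub>regular_module R\<^esub> y = x \<ominus>\<^bsub>R\<^esub> y"
proof -
  interpret cring R by fact
  interpret m: module R "regular_module R" by (rule module_regular_module) fact
  have "\<ominus>\<^bsub>regular_module R\<^esub> y = \<ominus>\<^bsub>R\<^esub> y"
    by (rule m.M.minus_equality) (use assms in \<open>auto simp: regular_module_def l_neg\<close>)
  then show ?thesis by (simp add: a_minus_def regular_module_def)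
qed

lemma submodule_regular_module:
  assumes "cring R" "ideal I R"
  shows "submodule I R (regular_module R)"
proof -
  interpret cring R by fact
  interpret ideal I R by fact
  interpret m: module R "regular_module R" by (rule module_regular_module) fact
  have neg: "\<ominus>\<^bsub>regular_module R\<^esub> y = \<ominus>\<^bsub>R\<^esub> y" if "y \<in> carrier R" for y
    by (rule m.M.minus_equality) (use that in \<open>auto simp: regular_module_def l_neg\<close>)
  show ?thesis
    by (rule m.submoduleI) (auto simp: regular_module_def I_l_closed neg[unfolded regular_module_def])
qed

lemma module_residue_module:
  assumes "cring R" "ideal I R"
  shows "module R (residue_module R I)"
  unfolding residue_module_def
  by (intro module_quotient_module module_regular_module submodule_regular_module assms)

definition residue :: "('a, 'c) ring_scheme \<Rightarrow> 'a set \<Rightarrow> 'a \<Rightarrow> 'a set"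
  where "residue R I x = I +>\<^bsub>regular_module R\<^esub> x"

lemma residue_carrier:
  "carrier (residue_module R I) = residue R I ` carrier R"
  by (simp add: residue_module_def residue_def[abs_def] quotient_module_carrier) (simp add: regular_module_def)

lemma residue_linear:
  assumes "cring R" "ideal I R"
  shows "residue R I \<in> linear_maps R (regular_module R) (residue_module R I)"
  using quotient_projection_linear[OF module_regular_module submodule_regular_module] assms
  unfolding residue_module_def residue_def[abs_def] by blast

lemma mem_residue_iff:
  assumes "cring R" "ideal I R" "x \<in> carrier R"
  shows "y \<in> residue R I x \<longleftrightarrow> y \<in> carrier R \<and> y \<ominus>\<^bsub>R\<^esub> x \<in> I"
  using submodule_coset_iff[OF module_regular_module submodule_regular_module, of R I x y] assms
  unfolding residue_def by (auto simp: regular_module_def regular_module_minus[unfolded regular_module_def])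

lemma residue_eq_iff:
  assumes "cring R" "ideal I R" "x \<in> carrier R" "y \<in> carrier R"
  shows "residue R I x = residue R I y \<longleftrightarrow> x \<ominus>\<^bsub>R\<^esub> y \<in> I"
  using submodule_coset_eq_iff[OF module_regular_module submodule_regular_module, of R I x y] assms
  unfolding residue_def by (auto simp: regular_module_def regular_module_minus[unfolded regular_module_def])

lemma residue_module_add:
  assumes "cring R" "ideal I R" "x \<in> carrier R" "y \<in> carrier R"
  shows "residue R I x \<oplus>\<^bsub>residue_module R I\<^esub> residue R I y = residue R I (x \<oplus>\<^bsub>R\<^esub> y)"
  using linear_mapsD(2)[OF residue_linear[OF assms(1,2)], of x y] assms(3,4)
  by (simp add: regular_module_def)

lemma residue_module_smult:
  assumes "cring R" "ideal I R" "x \<in> carrier R" "y \<in> carrier R"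
  shows "x \<odot>\<^bsub>residue_module R I\<^esub> residue R I y = residue R I (x \<otimes>\<^bsub>R\<^esub> y)"
  using linear_mapsD(3)[OF residue_linear[OF assms(1,2)], of x y] assms(3,4)
  by (simp add: regular_module_def)

lemma residue_module_zero:
  assumes "cring R" "ideal I R"
  shows "\<zero>\<^bsub>residue_module R I\<^esub> = residue R I \<zero>\<^bsub>R\<^esub>"
  using linear_maps_zero[OF module_regular_module[OF assms(1)] module_residue_module[OF assms] residue_linear[OF assms]]
  by (simp add: regular_module_def)

lemma residue_map_residue:
  assumes "cring R" "ideal I R" "ideal J R" "I \<subseteq> J" "x \<in> carrier R"
  shows "residue_map R J (residue R I x) = residue R J x"
proof -
  interpret cring R by fact
  interpret I: ideal I R by fact
  interpret J: ideal J R by fact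
  have "(\<Union>j\<in>J. \<Union>y\<in>residue R I x. {j \<oplus>\<^bsub>R\<^esub> y}) = residue R J x"
  proof (intro equalityI subsetI)
    fix w assume "w \<in> (\<Union>j\<in>J. \<Union>y\<in>residue R I x. {j \<oplus>\<^bsub>R\<^esub> y})"
    then obtain j y where w: "w = j \<oplus>\<^bsub>R\<^esub> y" "j \<in> J" "y \<in> carrier R" "y \<ominus>\<^bsub>R\<^esub> x \<in> I"
      using assms by (auto simp: mem_residue_iff)
    then have "w \<ominus>\<^bsub>R\<^esub> x = j \<oplus>\<^bsub>R\<^esub> (y \<ominus>\<^bsub>R\<^esub> x)" "j \<in> carrier R"
      using assms(5) by (auto simp: a_minus_def a_assoc)
    with w show "w \<in> residue R J x"
      using assms by (simp add: mem_residue_iff subset_iff)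
  next
    fix w assume "w \<in> residue R J x"
    then have w: "w \<in> carrier R" "w \<ominus>\<^bsub>R\<^esub> x \<in> J"
      using assms by (auto simp: mem_residue_iff)
    then have "w = (w \<ominus>\<^bsub>R\<^esub> x) \<oplus>\<^bsub>R\<^esub> x"
      using assms(5) by (simp add: a_minus_def a_assoc l_neg)
    moreover have "x \<in> residue R I x"
      using assms by (simp add: mem_residue_iff a_minus_def r_neg)
    ultimately show "w \<in> (\<Union>j\<in>J. \<Union>y\<in>residue R I x. {j \<oplus>\<^bsub>R\<^esub> y})"
      using w(2) by blast
  qed
  then show ?thesis
    unfolding residue_map_def quotient_map_def set_add_def' by (simp add: regular_module_def)
qed

text \<open>The submodule usually written \<open>JM\<close>. In the inductive form each fact about
  it is checked on multiples and sums.\<close>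

inductive_set ideal_smult ::
    "('a, 'c) ring_scheme \<Rightarrow> 'a set \<Rightarrow> ('a, 'b, 'e) module_scheme \<Rightarrow> 'b set"
  for R J M where
  zero: "\<zero>\<^bsub>M\<^esub> \<in> ideal_smult R J M"
| smult: "\<lbrakk>r \<in> J; x \<in> carrier M\<rbrakk> \<Longrightarrow> r \<odot>\<^bsub>M\<^esub> x \<in> ideal_smult R J M"
| add: "\<lbrakk>x \<in> ideal_smult R J M; y \<in> ideal_smult R J M\<rbrakk> \<Longrightarrow> x \<oplus>\<^bsub>M\<^esub> y \<in> ideal_smult R J M"

lemma submodule_ideal_smult:
  assumes "module R M" "ideal J R"
  shows "submodule (ideal_smult R J M) R M"
proof -
  interpret module R M by fact
  interpret J: ideal J R by fact
  have sub: "x \<in> carrier M" if "x \<in> ideal_smult R J M" for x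
    using that by induction auto
  have smult: "a \<odot>\<^bsub>M\<^esub> x \<in> ideal_smult R J M" if "x \<in> ideal_smult R J M" "a \<in> carrier R" for a x
    using that
  proof induction
    case (smult r x)
    then have "a \<odot>\<^bsub>M\<^esub> (r \<odot>\<^bsub>M\<^esub> x) = (a \<otimes>\<^bsub>R\<^esub> r) \<odot>\<^bsub>M\<^esub> x"
      by (simp add: smult_assoc1)
    with smult show ?case by (simp add: J.I_l_closed ideal_smult.smult)
  qed (auto simp: smult_r_distr sub intro: ideal_smult.intros)
  have "\<ominus>\<^bsub>M\<^esub> x = (\<ominus>\<^bsub>R\<^esub> \<one>\<^bsub>R\<^esub>) \<odot>\<^bsub>M\<^esub> x" if "x \<in> carrier M" for x
    using that by (simp add: smult_l_minus)
  then show ?thesis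
    by (intro submoduleI) (auto simp: sub smult intro: ideal_smult.intros)
qed

lemma ideal_smult_mono:
  assumes "J \<subseteq> J'" "x \<in> ideal_smult R J M"
  shows "x \<in> ideal_smult R J' M"
  using assms(2,1) by induction (auto intro: ideal_smult.intros)

lemma linear_maps_ideal_smult:
  assumes "module R M" "module R N" "ideal J R" "f \<in> linear_maps R M N" "x \<in> ideal_smult R J M"
  shows "f x \<in> ideal_smult R J N"
  using assms(5)
proof induction
  case zero
  then show ?case by (simp add: linear_maps_zero[OF assms(1,2,4)] ideal_smult.zero)
next
  case (smult r x)
  moreover from this have "f (r \<odot>\<^bsub>M\<^esub> x) = r \<odot>\<^bsub>N\<^esub> f x"
    using ideal.Icarr[OF assms(3)] by (intro linear_mapsD(3)[OF assms(4)])
  ultimately show ?case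
    using linear_mapsD(1)[OF assms(4)] by (simp add: ideal_smult.smult)
next
  case (add x y)
  then have "x \<in> carrier M" "y \<in> carrier M"
    using module.submoduleE(1)[OF assms(1) submodule_ideal_smult[OF assms(1,3)]] by auto
  then have "f (x \<oplus>\<^bsub>M\<^esub> y) = f x \<oplus>\<^bsub>N\<^esub> f y"
    by (intro linear_mapsD(2)[OF assms(4)])
  with add show ?case by (simp add: ideal_smult.add)
qed

lemma ideal_smult_regular_module:
  assumes "ideal J R" "a \<in> ideal_smult R J (regular_module R)"
  shows "a \<in> J"
proof -
  interpret J: ideal J R by fact
  from assms(2) show ?thesis
    by induction (auto simp: regular_module_simps J.I_r_closed)
qed

lemma preimage_submodule:
  assumes "module R M" "module R N" "f \<in> linear_maps R M N" "submodule H R N"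
  shows "submodule {x \<in> carrier M. f x \<in> H} R M"
proof -
  interpret M: module R M by fact
  interpret N: module R N by fact
  interpret H: submodule H R N by fact
  show ?thesis
    by (rule M.submoduleI)
      (auto simp: linear_mapsD[OF assms(3)] linear_maps_zero[OF assms(1-3)] linear_maps_uminus[OF assms(1-3)]
        N.submoduleE[OF assms(4)] H.one_closed[simplified])
qed

subsection \<open>Tensor products with residue rings\<close>

text \<open>An arbitrary choice, so representatives are compatible with sums and multiples only
  modulo the ideal. All comparisons below are therefore made modulo \<open>JM\<close>.\<close>

definition residue_rep :: "'a set \<Rightarrow> 'a" where
  "residue_rep K = (SOME r. r \<in> K)"

lemma residue_rep:
  assumes "cring R" "ideal J R" "K \<in> carrier (residue_module R J)"
  shows "residue_rep K \<in> carrier R" and "residue R J (residue_rep K) = K"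
proof -
  interpret cring R by fact
  interpret J: ideal J R by fact
  obtain r where r: "r \<in> carrier R" "K = residue R J r"
    using assms(3) by (auto simp: residue_carrier)
  have "r \<in> K" using r assms by (simp add: mem_residue_iff a_minus_def r_neg)
  then have "residue_rep K \<in> K" unfolding residue_rep_def by (rule someI)
  then have "residue_rep K \<in> carrier R" "residue_rep K \<ominus>\<^bsub>R\<^esub> r \<in> J"
    using r assms by (auto simp: mem_residue_iff)
  then show "residue_rep K \<in> carrier R" "residue R J (residue_rep K) = K"
    using r assms by (auto simp: residue_eq_iff)
qed

text \<open>The map \<open>(x, r + J) \<mapsto> r x\<close> on the free module that presents
  \<open>M \<otimes> R/J\<close>. It respects the defining relations only modulo
  \<open>JM\<close>.\<close>

definition tensor_eval ::
    "('a, 'c) ring_scheme \<Rightarrow> ('a, 'b, 'e) module_scheme \<Rightarrow> ('b \<times> 'a set \<Rightarrow> 'a) \<Rightarrow> 'b"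
  where "tensor_eval R M = free_extension R M (\<lambda>(x, K). residue_rep K \<odot>\<^bsub>M\<^esub> x)"

text \<open>The element of \<open>M \<otimes> R/J\<close> that corresponds to \<open>x + JM\<close> under \<open>M \<otimes> R/J \<cong> M/JM\<close>.\<close>

definition tensor_class ::
    "('a, 'c) ring_scheme \<Rightarrow> 'a set \<Rightarrow> ('a, 'b, 'e) module_scheme \<Rightarrow> 'b \<Rightarrow> ('b \<times> 'a set \<Rightarrow> 'a) set"
  where "tensor_class R J M x =
    {f \<in> carrier (free_module R (carrier M \<times> carrier (residue_module R J))).
      tensor_eval R M f \<ominus>\<^bsub>M\<^esub> x \<in> ideal_smult R J M}"

locale tensor_residue = module R M for R (structure) and M (structure) +
  fixes J :: "'a set"
  assumes ideal: "ideal J R"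
begin

abbreviation "N \<equiv> residue_module R J"
abbreviation "L \<equiv> free_module R (carrier M \<times> carrier N)"
abbreviation "JM \<equiv> ideal_smult R J M"
abbreviation "T \<equiv> tensor_product R M N"
abbreviation "\<Phi> \<equiv> tensor_eval R M"
abbreviation "H \<equiv> tensor_rel R M N"

lemma cring: "cring R" by unfold_locales

lemma mL: "module R L" by (rule module_free_module[OF cring])

lemma mN: "module R N" by (rule module_residue_module[OF cring ideal])

lemma mM: "module R M" by unfold_locales

sublocale N: module R N by (rule mN)

sublocale L: module R L by (rule mL)

lemma JM: "submodule JM R M" by (rule submodule_ideal_smult[OF mM ideal])

lemma Jc: "r \<in> J \<Longrightarrow> r \<in> carrier R"
  using ideal.Icarr[OF ideal] .

lemma JMc: "x \<in> JM \<Longrightarrow> x \<in> carrier M"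
  using submoduleE(1)[OF JM] by blast

lemmas rep = residue_rep[OF cring ideal]

lemma eval_gens: "(\<lambda>(x, K). residue_rep K \<odot>\<^bsub>M\<^esub> x) \<in> carrier M \<times> carrier N \<rightarrow> carrier M"
  using rep by auto

lemma eval_linear: "\<Phi> \<in> linear_maps R L M"
  unfolding tensor_eval_def by (rule free_extension_linear[OF mM eval_gens])

lemma eval_gen:
  "\<lbrakk>x \<in> carrier M; K \<in> carrier N\<rbrakk> \<Longrightarrow> \<Phi> (free_gen R (x, K)) = residue_rep K \<odot>\<^bsub>M\<^esub> x"
  unfolding tensor_eval_def by (subst free_extension_free_gen[OF mM eval_gens]) auto

lemma gen: "\<lbrakk>x \<in> carrier M; K \<in> carrier N\<rbrakk> \<Longrightarrow> free_gen R (x, K) \<in> carrier L"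
  by (intro free_gen_closed[OF cring]) auto

lemma eval_minus:
  "\<lbrakk>f \<in> carrier L; g \<in> carrier L\<rbrakk> \<Longrightarrow> \<Phi> (f \<ominus>\<^bsub>L\<^esub> g) = \<Phi> f \<ominus>\<^bsub>M\<^esub> \<Phi> g"
  by (rule linear_maps_minus[OF mL mM eval_linear])

lemma tensor_gens_closed: "tensor_gens R M N \<subseteq> carrier L"
  unfolding tensor_gens_def Let_def
  by (auto simp: gen L.M.minus_closed)

lemma rel: "submodule H R L" and rel_gens: "tensor_gens R M N \<subseteq> H"
  and rel_least: "\<And>K. \<lbrakk>submodule K R L; tensor_gens R M N \<subseteq> K\<rbrakk> \<Longrightarrow> H \<subseteq> K"
proof -
  let ?S = "{K. submodule K R L \<and> tensor_gens R M N \<subseteq> K}"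
  have H: "H = \<Inter>?S" by (simp add: tensor_rel_def submodule_span_def)
  \<comment> \<open>Without a member of the family the intersection would be the whole type and not
    a subset of the free module.\<close>
  have top: "carrier L \<in> ?S"
    using L.carrier_is_submodule tensor_gens_closed by simp
  have S: "K \<subseteq> carrier L" "\<zero>\<^bsub>L\<^esub> \<in> K" "a \<in> K \<Longrightarrow> \<ominus>\<^bsub>L\<^esub> a \<in> K"
    "\<lbrakk>a \<in> K; b \<in> K\<rbrakk> \<Longrightarrow> a \<oplus>\<^bsub>L\<^esub> b \<in> K" "\<lbrakk>r \<in> carrier R; a \<in> K\<rbrakk> \<Longrightarrow> r \<odot>\<^bsub>L\<^esub> a \<in> K"
    if "K \<in> ?S" for K a b r
  proof -
    from that have K: "submodule K R L" by simp
    show "K \<subseteq> carrier L" "a \<in> K \<Longrightarrow> \<ominus>\<^bsub>L\<^esub> a \<in> K"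
      "\<lbrakk>a \<in> K; b \<in> K\<rbrakk> \<Longrightarrow> a \<oplus>\<^bsub>L\<^esub> b \<in> K" "\<lbrakk>r \<in> carrier R; a \<in> K\<rbrakk> \<Longrightarrow> r \<odot>\<^bsub>L\<^esub> a \<in> K"
      using L.submoduleE[OF K] by auto
    show "\<zero>\<^bsub>L\<^esub> \<in> K"
      using subgroup.one_closed[OF submodule.axioms(1)[OF K]] by simp
  qed
  show "submodule H R L"
    unfolding H
  proof (rule L.submoduleI)
    show "\<Inter>?S \<subseteq> carrier L" using top by (rule Inter_lower)
    show "\<zero>\<^bsub>L\<^esub> \<in> \<Inter>?S" using S(2) by (rule InterI)
    show "\<ominus>\<^bsub>L\<^esub> a \<in> \<Inter>?S" if "a \<in> \<Inter>?S" for a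
      using S(3) that by (meson InterI InterE)
    show "a \<oplus>\<^bsub>L\<^esub> b \<in> \<Inter>?S" if "a \<in> \<Inter>?S" "b \<in> \<Inter>?S" for a b
      using S(4) that by (meson InterI InterE)
    show "r \<odot>\<^bsub>L\<^esub> a \<in> \<Inter>?S" if "r \<in> carrier R" "a \<in> \<Inter>?S" for r a
      using S(5) that by (meson InterI InterE)
  qed
  show "tensor_gens R M N \<subseteq> H" "\<And>K. \<lbrakk>submodule K R L; tensor_gens R M N \<subseteq> K\<rbrakk> \<Longrightarrow> H \<subseteq> K"
    unfolding H by auto
qed

text \<open>Relations in the first factor go to zero exactly. Those in the second compare two
  representatives of one residue class, which differ by an element of \<open>J\<close>.\<close>

lemma eval_tensor_gens:
  assumes "f \<in> tensor_gens R M N"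
  shows "\<Phi> f \<in> JM"
proof -
  have zero: "\<zero>\<^bsub>M\<^esub> \<in> JM" by (rule ideal_smult.zero)
  consider x x' K where "f = free_gen R (x \<oplus>\<^bsub>M\<^esub> x', K) \<ominus>\<^bsub>L\<^esub> (free_gen R (x, K) \<oplus>\<^bsub>L\<^esub> free_gen R (x', K))"
      "x \<in> carrier M" "x' \<in> carrier M" "K \<in> carrier N"
    | x K K' where "f = free_gen R (x, K \<oplus>\<^bsub>N\<^esub> K') \<ominus>\<^bsub>L\<^esub> (free_gen R (x, K) \<oplus>\<^bsub>L\<^esub> free_gen R (x, K'))"
      "x \<in> carrier M" "K \<in> carrier N" "K' \<in> carrier N"
    | r x K where "f = free_gen R (r \<odot>\<^bsub>M\<^esub> x, K) \<ominus>\<^bsub>L\<^esub> r \<odot>\<^bsub>L\<^esub> free_gen R (x, K)"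
      "r \<in> carrier R" "x \<in> carrier M" "K \<in> carrier N"
    | r x K where "f = free_gen R (x, r \<odot>\<^bsub>N\<^esub> K) \<ominus>\<^bsub>L\<^esub> r \<odot>\<^bsub>L\<^esub> free_gen R (x, K)"
      "r \<in> carrier R" "x \<in> carrier M" "K \<in> carrier N"
    using assms unfolding tensor_gens_def Let_def by auto
  then show ?thesis
  proof cases
    case 1
    then have "\<Phi> f = residue_rep K \<odot>\<^bsub>M\<^esub> (x \<oplus>\<^bsub>M\<^esub> x') \<ominus>\<^bsub>M\<^esub> (residue_rep K \<odot>\<^bsub>M\<^esub> x \<oplus>\<^bsub>M\<^esub> residue_rep K \<odot>\<^bsub>M\<^esub> x')"
      by (simp add: eval_minus gen linear_mapsD(2)[OF eval_linear] eval_gen)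
    also have "\<dots> = \<zero>\<^bsub>M\<^esub>"
      using 1 rep by (simp add: smult_r_distr a_minus_def M.r_neg)
    finally show ?thesis using zero by simp
  next
    case 2
    let ?r = "residue_rep (K \<oplus>\<^bsub>N\<^esub> K')" and ?s = "residue_rep K \<oplus> residue_rep K'"
    have KK: "K \<oplus>\<^bsub>N\<^esub> K' \<in> carrier N" using 2 by simp
    have c: "?r \<in> carrier R" "?s \<in> carrier R" using 2 KK rep by auto
    from 2 have "\<Phi> f = ?r \<odot>\<^bsub>M\<^esub> x \<ominus>\<^bsub>M\<^esub> (residue_rep K \<odot>\<^bsub>M\<^esub> x \<oplus>\<^bsub>M\<^esub> residue_rep K' \<odot>\<^bsub>M\<^esub> x)"
      using KK by (simp add: eval_minus gen linear_mapsD(2)[OF eval_linear] eval_gen)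
    also have "\<dots> = (?r \<ominus> ?s) \<odot>\<^bsub>M\<^esub> x"
      using 2 c rep by (simp add: a_minus_def smult_l_distr smult_l_minus)
    finally have *: "\<Phi> f = (?r \<ominus> ?s) \<odot>\<^bsub>M\<^esub> x" .
    have "residue R J ?s = residue R J (residue_rep K) \<oplus>\<^bsub>N\<^esub> residue R J (residue_rep K')"
      using rep 2 by (subst residue_module_add[OF cring ideal]) auto
    then have "residue R J ?r = residue R J ?s"
      using rep(2)[OF KK] rep(2) 2 by simp
    then have "?r \<ominus> ?s \<in> J"
      using c residue_eq_iff[OF cring ideal] by simp
    with * 2 show ?thesis by (simp add: ideal_smult.smult)
  next
    case 3
    then have "\<Phi> f = residue_rep K \<odot>\<^bsub>M\<^esub> (r \<odot>\<^bsub>M\<^esub> x) \<ominus>\<^bsub>M\<^esub> r \<odot>\<^bsub>M\<^esub> (residue_rep K \<odot>\<^bsub>M\<^esub> x)"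
      by (simp add: eval_minus gen linear_mapsD(3)[OF eval_linear] eval_gen)
    also have "\<dots> = \<zero>\<^bsub>M\<^esub>"
      using 3 rep by (simp add: smult_assoc1[symmetric] R.m_comm[of "residue_rep K" r] a_minus_def M.r_neg)
    finally show ?thesis using zero by simp
  next
    case 4
    let ?r = "residue_rep (r \<odot>\<^bsub>N\<^esub> K)" and ?s = "r \<otimes> residue_rep K"
    have KK: "r \<odot>\<^bsub>N\<^esub> K \<in> carrier N" using 4 by simp
    have c: "?r \<in> carrier R" "?s \<in> carrier R" using 4 KK rep by auto
    from 4 have "\<Phi> f = ?r \<odot>\<^bsub>M\<^esub> x \<ominus>\<^bsub>M\<^esub> r \<odot>\<^bsub>M\<^esub> (residue_rep K \<odot>\<^bsub>M\<^esub> x)"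
      using KK by (simp add: eval_minus gen linear_mapsD(3)[OF eval_linear] eval_gen)
    also have "\<dots> = (?r \<ominus> ?s) \<odot>\<^bsub>M\<^esub> x"
      using 4 c rep by (simp add: a_minus_def smult_l_distr smult_l_minus smult_assoc1)
    finally have *: "\<Phi> f = (?r \<ominus> ?s) \<odot>\<^bsub>M\<^esub> x" .
    have "residue R J ?s = r \<odot>\<^bsub>N\<^esub> residue R J (residue_rep K)"
      using rep 4 by (subst residue_module_smult[OF cring ideal]) auto
    then have "residue R J ?r = residue R J ?s"
      using rep(2)[OF KK] rep(2) 4 by simp
    then have "?r \<ominus> ?s \<in> J"
      using c residue_eq_iff[OF cring ideal] by simp
    with * 4 show ?thesis by (simp add: ideal_smult.smult)
  qed
qed

lemma eval_rel: "f \<in> H \<Longrightarrow> \<Phi> f \<in> JM"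
proof -
  have "H \<subseteq> {f \<in> carrier L. \<Phi> f \<in> JM}"
    using tensor_gens_closed eval_tensor_gens
    by (intro rel_least preimage_submodule[OF mL mM eval_linear JM]) auto
  then show "f \<in> H \<Longrightarrow> \<Phi> f \<in> JM" by auto
qed

abbreviation "p f \<equiv> H +>\<^bsub>L\<^esub> f"
abbreviation "t x K \<equiv> p (free_gen R (x, K))"

lemma mT: "module R T"
  unfolding tensor_product_def by (rule module_quotient_module[OF mL rel])

sublocale T: module R T by (rule mT)

lemma p_linear: "p \<in> linear_maps R L T"
  unfolding tensor_product_def by (rule quotient_projection_linear[OF mL rel])

lemma p_eqI:
  assumes "f \<ominus>\<^bsub>L\<^esub> g \<in> tensor_gens R M N" "f \<in> carrier L" "g \<in> carrier L"
  shows "p f = p g"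
  using assms rel_gens by (subst submodule_coset_eq_iff[OF mL rel]) auto

lemma t_closed: "\<lbrakk>x \<in> carrier M; K \<in> carrier N\<rbrakk> \<Longrightarrow> t x K \<in> carrier T"
  by (rule linear_mapsD(1)[OF p_linear gen])

lemma t_add_l:
  assumes "x \<in> carrier M" "x' \<in> carrier M" "K \<in> carrier N"
  shows "t (x \<oplus>\<^bsub>M\<^esub> x') K = t x K \<oplus>\<^bsub>T\<^esub> t x' K"
proof -
  have "t (x \<oplus>\<^bsub>M\<^esub> x') K = p (free_gen R (x, K) \<oplus>\<^bsub>L\<^esub> free_gen R (x', K))"
    by (rule p_eqI) (use assms in \<open>auto simp: tensor_gens_def Let_def gen\<close>)
  then show ?thesis
    using assms by (simp add: linear_mapsD(2)[OF p_linear] gen)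
qed

lemma t_smult_l:
  assumes "r \<in> carrier R" "x \<in> carrier M" "K \<in> carrier N"
  shows "t (r \<odot>\<^bsub>M\<^esub> x) K = r \<odot>\<^bsub>T\<^esub> t x K"
proof -
  have "t (r \<odot>\<^bsub>M\<^esub> x) K = p (r \<odot>\<^bsub>L\<^esub> free_gen R (x, K))"
    by (rule p_eqI) (use assms in \<open>auto simp: tensor_gens_def Let_def gen\<close>)
  then show ?thesis
    using assms by (simp add: linear_mapsD(3)[OF p_linear] gen)
qed

lemma t_smult_r:
  assumes "r \<in> carrier R" "x \<in> carrier M" "K \<in> carrier N"
  shows "t x (r \<odot>\<^bsub>N\<^esub> K) = r \<odot>\<^bsub>T\<^esub> t x K"
proof -
  have "t x (r \<odot>\<^bsub>N\<^esub> K) = p (r \<odot>\<^bsub>L\<^esub> free_gen R (x, K))"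
    by (rule p_eqI) (use assms in \<open>auto simp: tensor_gens_def Let_def gen\<close>)
  then show ?thesis
    using assms by (simp add: linear_mapsD(3)[OF p_linear] gen)
qed

abbreviation "u \<equiv> residue R J \<one>"

lemma u: "u \<in> carrier N" by (simp add: residue_carrier)

lemma smult_u: "r \<in> carrier R \<Longrightarrow> r \<odot>\<^bsub>N\<^esub> u = residue R J r"
  by (simp add: residue_module_smult[OF cring ideal])

lemma t_u_linear: "(\<lambda>x. t x u) \<in> linear_maps R M T"
  using t_closed t_add_l t_smult_l u by (auto simp: linear_maps_def)

text \<open>On generators this is \<open>x \<otimes> (r + J) = r x \<otimes> 1\<close>, and both
  sides are linear. So every tensor has the form \<open>m \<otimes> 1\<close>; together with the
  vanishing of \<open>m \<otimes> 1\<close> for \<open>m\<close> in \<open>JM\<close> this makes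
  \<open>M \<otimes> R/J \<rightarrow> M/JM\<close> injective.\<close>

lemma p_eval:
  assumes "f \<in> carrier L"
  shows "p f = t (\<Phi> f) u"
  using cring assms
proof (induction f rule: free_module_induct)
  case zero
  then show ?case
    by (simp add: linear_maps_zero[OF mL mM eval_linear] linear_maps_zero[OF mL mT p_linear]
        linear_maps_zero[OF mM mT t_u_linear])
next
  case (gen s)
  then obtain x K where s: "s = (x, K)" "x \<in> carrier M" "K \<in> carrier N" by auto
  then have "t (\<Phi> (free_gen R s)) u = residue_rep K \<odot>\<^bsub>T\<^esub> t x u"
    using rep u by (simp add: eval_gen t_smult_l)
  also have "\<dots> = t x (residue_rep K \<odot>\<^bsub>N\<^esub> u)"
    using s rep u by (simp add: t_smult_r)
  also have "\<dots> = t x K"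
    using s rep by (simp add: smult_u)
  finally show ?case using s by simp
next
  case (add f g)
  then show ?case
    using linear_mapsD(1)[OF eval_linear]
    by (simp add: linear_mapsD(2)[OF p_linear] linear_mapsD(2)[OF eval_linear] t_add_l u)
next
  case (smult r f)
  then show ?case
    using linear_mapsD(1)[OF eval_linear]
    by (simp add: linear_mapsD(3)[OF p_linear] linear_mapsD(3)[OF eval_linear] t_smult_l u)
qed

text \<open>For \<open>r\<close> in \<open>J\<close>, moving \<open>r\<close> across the tensor sign
  gives \<open>r x \<otimes> 1 = x \<otimes> r = x \<otimes> 0\<close>.\<close>

lemma t_u_zero:
  assumes "x \<in> JM"
  shows "t x u = \<zero>\<^bsub>T\<^esub>"
  using assms
proof induction
  case zero
  then show ?case by (rule linear_maps_zero[OF mM mT t_u_linear])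
next
  case (smult r x)
  then have r: "r \<in> carrier R" using Jc by blast
  have "residue R J r = residue R J \<zero>"
    using r smult by (subst residue_eq_iff[OF cring ideal]) (auto simp: a_minus_def)
  then have "r \<odot>\<^bsub>N\<^esub> u = \<zero> \<odot>\<^bsub>N\<^esub> u"
    using r by (simp add: smult_u)
  then have "t (r \<odot>\<^bsub>M\<^esub> x) u = t x (\<zero> \<odot>\<^bsub>N\<^esub> u)"
    using smult r u by (simp add: t_smult_l t_smult_r[symmetric])
  also have "\<dots> = \<zero> \<odot>\<^bsub>T\<^esub> t x u"
    using smult(2) u by (intro t_smult_r) auto
  also have "\<dots> = \<zero>\<^bsub>T\<^esub>"
    using smult u t_closed by simp
  finally show ?case .
next
  case (add x y)
  then show ?case using JMc u by (simp add: t_add_l)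
qed

lemma rel_iff: "f \<in> H \<longleftrightarrow> f \<in> carrier L \<and> \<Phi> f \<in> JM"
proof
  assume "f \<in> H"
  then show "f \<in> carrier L \<and> \<Phi> f \<in> JM"
    using L.submoduleE(1)[OF rel] eval_rel by auto
next
  assume f: "f \<in> carrier L \<and> \<Phi> f \<in> JM"
  then have "p f = p \<zero>\<^bsub>L\<^esub>"
    using p_eval t_u_zero linear_maps_zero[OF mL mT p_linear] by simp
  then show "f \<in> H"
    using f submodule_coset_eq_iff[OF mL rel, of f "\<zero>\<^bsub>L\<^esub>"]
    by (simp add: L.M.diff_zero)
qed

text \<open>Elements of the tensor product are literally cosets, so the identification with
  \<open>M/JM\<close> takes the form of an equality of sets, which can be used for rewriting inside
  the definition of \<open>Tor\<close>.\<close>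

lemma coset_tensor_class:
  assumes "f \<in> carrier L"
  shows "p f = tensor_class R J M (\<Phi> f)"
  using assms eval_minus
  by (auto simp: submodule_coset_iff[OF mL rel] rel_iff tensor_class_def L.M.minus_closed)

lemma tensor_class_eq_iff:
  assumes "x \<in> carrier M" "y \<in> carrier M"
  shows "tensor_class R J M x = tensor_class R J M y \<longleftrightarrow> x \<ominus>\<^bsub>M\<^esub> y \<in> JM"
    and "tensor_class R J M x \<noteq> {}"
proof -
  let ?\<delta> = "\<lambda>x. free_gen R (x, u)"
  have ge: "?\<delta> x \<in> carrier L" if "x \<in> carrier M" for x using gen u that by blast
  have rc: "residue_rep u \<in> carrier R" using rep u by blast
  \<comment> \<open>The representative chosen for the class of \<open>\<one>\<close> need not be
    \<open>\<one>\<close>, only congruent to it.\<close>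
  have J: "residue_rep u \<ominus> \<one> \<in> J"
    using residue_eq_iff[OF cring ideal rc R.one_closed] rep(2)[OF u] by blast
  have D: "\<Phi> (?\<delta> x) \<ominus>\<^bsub>M\<^esub> x \<in> JM" if "x \<in> carrier M" for x
  proof -
    have "\<Phi> (?\<delta> x) \<ominus>\<^bsub>M\<^esub> x = (residue_rep u \<ominus> \<one>) \<odot>\<^bsub>M\<^esub> x"
      using that u rc by (simp add: eval_gen a_minus_def smult_l_distr smult_l_minus)
    then show ?thesis using J that by (simp add: ideal_smult.smult)
  qed
  have mem: "?\<delta> x \<in> tensor_class R J M x" if "x \<in> carrier M" for x
    using that D ge by (simp add: tensor_class_def)
  have trans: "a \<ominus>\<^bsub>M\<^esub> c \<in> JM" if "a \<ominus>\<^bsub>M\<^esub> b \<in> JM" "b \<ominus>\<^bsub>M\<^esub> c \<in> JM"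
    "a \<in> carrier M" "b \<in> carrier M" "c \<in> carrier M" for a b c
  proof -
    have "a \<ominus>\<^bsub>M\<^esub> c = (a \<ominus>\<^bsub>M\<^esub> b) \<oplus>\<^bsub>M\<^esub> (b \<ominus>\<^bsub>M\<^esub> c)"
      using that by (simp add: a_minus_def M.a_assoc M.r_neg1)
    with that show ?thesis using submoduleE(5)[OF JM] by simp
  qed
  have sym: "b \<ominus>\<^bsub>M\<^esub> a \<in> JM" if "a \<ominus>\<^bsub>M\<^esub> b \<in> JM" "a \<in> carrier M" "b \<in> carrier M" for a b
  proof -
    have "b \<ominus>\<^bsub>M\<^esub> a = \<ominus>\<^bsub>M\<^esub> (a \<ominus>\<^bsub>M\<^esub> b)"
      using that by (simp add: a_minus_def M.minus_add M.a_comm)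
    with that show ?thesis using submoduleE(3)[OF JM] by simp
  qed
  show "tensor_class R J M x \<noteq> {}" using mem[OF assms(1)] by blast
  show "tensor_class R J M x = tensor_class R J M y \<longleftrightarrow> x \<ominus>\<^bsub>M\<^esub> y \<in> JM"
  proof
    assume "tensor_class R J M x = tensor_class R J M y"
    then have "?\<delta> x \<in> tensor_class R J M y" using mem[OF assms(1)] by simp
    then have "\<Phi> (?\<delta> x) \<ominus>\<^bsub>M\<^esub> y \<in> JM" by (simp add: tensor_class_def)
    then show "x \<ominus>\<^bsub>M\<^esub> y \<in> JM"
      using D[OF assms(1)] assms linear_mapsD(1)[OF eval_linear ge[OF assms(1)]]
      by (blast intro: trans sym)
  next
    assume xy: "x \<ominus>\<^bsub>M\<^esub> y \<in> JM"
    show "tensor_class R J M x = tensor_class R J M y"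
      unfolding tensor_class_def using xy assms linear_mapsD(1)[OF eval_linear]
      by (blast intro: trans sym)
  qed
qed

lemma tensor_class_coset:
  assumes "x \<in> carrier M"
  shows "\<exists>f\<in>carrier L. \<Phi> f \<ominus>\<^bsub>M\<^esub> x \<in> JM \<and> p f = tensor_class R J M x"
proof -
  obtain f where f: "f \<in> tensor_class R J M x" using tensor_class_eq_iff(2)[OF assms assms] by blast
  then have "f \<in> carrier L" "\<Phi> f \<ominus>\<^bsub>M\<^esub> x \<in> JM" by (auto simp: tensor_class_def)
  then show ?thesis
    using tensor_class_eq_iff(1)[of "\<Phi> f" x] linear_mapsD(1)[OF eval_linear] assms
    by (intro bexI[of _ f]) (auto simp: coset_tensor_class)
qed

lemma tensor_carrier: "carrier T = tensor_class R J M ` carrier M"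
proof -
  have "carrier T = p ` carrier L"
    by (simp add: tensor_product_def quotient_module_carrier)
  also have "\<dots> = tensor_class R J M ` carrier M"
    using tensor_class_coset coset_tensor_class linear_mapsD(1)[OF eval_linear]
    by (intro equalityI subsetI) (auto, metis image_eqI)
  finally show ?thesis .
qed

lemma tensor_add:
  assumes "x \<in> carrier M" "y \<in> carrier M"
  shows "tensor_class R J M x \<oplus>\<^bsub>T\<^esub> tensor_class R J M y = tensor_class R J M (x \<oplus>\<^bsub>M\<^esub> y)"
proof -
  obtain f g where f: "f \<in> carrier L" "\<Phi> f \<ominus>\<^bsub>M\<^esub> x \<in> JM" "p f = tensor_class R J M x"
    and g: "g \<in> carrier L" "\<Phi> g \<ominus>\<^bsub>M\<^esub> y \<in> JM" "p g = tensor_class R J M y"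
    using tensor_class_coset assms by metis
  have [simp]: "\<Phi> f \<in> carrier M" "\<Phi> g \<in> carrier M"
    using f g linear_mapsD(1)[OF eval_linear] by auto
  have "tensor_class R J M x \<oplus>\<^bsub>T\<^esub> tensor_class R J M y = p (f \<oplus>\<^bsub>L\<^esub> g)"
    using f g linear_mapsD(2)[OF p_linear, of f g] by simp
  also have "\<dots> = tensor_class R J M (\<Phi> f \<oplus>\<^bsub>M\<^esub> \<Phi> g)"
    using f g by (simp add: coset_tensor_class linear_mapsD(2)[OF eval_linear])
  also have "\<dots> = tensor_class R J M (x \<oplus>\<^bsub>M\<^esub> y)"
  proof -
    have "(\<Phi> f \<oplus>\<^bsub>M\<^esub> \<Phi> g) \<ominus>\<^bsub>M\<^esub> (x \<oplus>\<^bsub>M\<^esub> y) = (\<Phi> f \<ominus>\<^bsub>M\<^esub> x) \<oplus>\<^bsub>M\<^esub> (\<Phi> g \<ominus>\<^bsub>M\<^esub> y)"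
      using assms by (simp add: a_minus_def M.minus_add M.a_ac)
    then show ?thesis
      using f g assms submoduleE(5)[OF JM] by (subst tensor_class_eq_iff) auto
  qed
  finally show ?thesis .
qed

lemma tensor_zero: "\<zero>\<^bsub>T\<^esub> = tensor_class R J M \<zero>\<^bsub>M\<^esub>"
  using coset_tensor_class[of "\<zero>\<^bsub>L\<^esub>"] linear_maps_zero[OF mL mT p_linear]
    linear_maps_zero[OF mL mM eval_linear] by simp

end

section \<open>Naturality of the identification of \<open>M \<otimes> R/J\<close> with
  \<open>M/JM\<close>\<close>

lemma free_map_linear:
  assumes "cring R" "h \<in> S \<rightarrow> S'"
  shows "free_map R h \<in> linear_maps R (free_module R S) (free_module R S')"
proof -
  interpret L: module R "free_module R S" by (rule module_free_module) fact
  have "free_extension R (free_module R S') (\<lambda>s. free_gen R (h s)) \<in> linear_maps R (free_module R S) (free_module R S')"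
    using assms by (intro free_extension_linear module_free_module) (auto intro: free_gen_closed)
  then show ?thesis
    using free_map_free_extension[OF assms] by (auto simp: linear_maps_def Pi_iff)
qed

lemma free_map_free_gen:
  assumes "cring R" "h \<in> S \<rightarrow> S'" "s \<in> S"
  shows "free_map R h (free_gen R s) = free_gen R (h s)"
  using free_map_free_extension[OF assms(1,2) free_gen_closed[OF assms(1,3)]] assms
  by (subst (asm) free_extension_free_gen[OF module_free_module[OF assms(1)], of _ S])
    (auto intro: free_gen_closed)

lemma tensor_map_class:
  assumes "module R M" "module R M'" "ideal J R" "ideal J' R" "J \<subseteq> J'"
    and D: "D \<in> linear_maps R M M'"
    and g: "\<And>r. r \<in> carrier R \<Longrightarrow> g (residue R J r) = residue R J' r"
    and x: "x \<in> carrier M"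
  shows "tensor_map R M' (residue_module R J') D g (tensor_class R J M x) = tensor_class R J' M' (D x)"
proof -
  interpret A: tensor_residue R M J using assms by (simp add: tensor_residue_def tensor_residue_axioms_def)
  interpret B: tensor_residue R M' J' using assms by (simp add: tensor_residue_def tensor_residue_axioms_def)
  let ?h = "free_map R (map_prod D g)"
  note cring = A.cring
  have gN: "g K \<in> carrier B.N" if "K \<in> carrier A.N" for K
    using that g by (auto simp: residue_carrier)
  have h: "map_prod D g \<in> carrier M \<times> carrier A.N \<rightarrow> carrier M' \<times> carrier B.N"
    using gN linear_mapsD(1)[OF D] by auto
  note lin = free_map_linear[OF cring h]
  \<comment> \<open>The square of evaluation maps commutes only up to \<open>J'M'\<close>, because
    representatives are chosen independently modulo \<open>J\<close> and modulo
    \<open>J'\<close>.\<close>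
  have diff: "tensor_eval R M' (?h f) \<ominus>\<^bsub>M'\<^esub> D (tensor_eval R M f) \<in> B.JM" if "f \<in> carrier A.L" for f
    using cring that
  proof (induction f rule: free_module_induct)
    case zero
    have "tensor_eval R M' (?h \<zero>\<^bsub>A.L\<^esub>) = \<zero>\<^bsub>M'\<^esub>" "D (tensor_eval R M \<zero>\<^bsub>A.L\<^esub>) = \<zero>\<^bsub>M'\<^esub>"
      using linear_maps_zero[OF A.mL B.mL lin] linear_maps_zero[OF B.mL B.mM B.eval_linear]
        linear_maps_zero[OF A.mL A.mM A.eval_linear] linear_maps_zero[OF A.mM B.mM D] by auto
    then show ?case
      by (simp add: B.M.diff_zero ideal_smult.zero)
  next
    case (gen s)
    then obtain y K where s: "s = (y, K)" "y \<in> carrier M" "K \<in> carrier A.N" by auto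
    note rK = A.rep[OF s(3)] and rg = B.rep[OF gN[OF s(3)]]
    have Dy: "D y \<in> carrier M'" using s linear_mapsD(1)[OF D] by auto
    have "residue R J' (residue_rep (g K)) = residue R J' (residue_rep K)"
      using g[OF rK(1)] rK(2) rg(2) by simp
    then have "residue_rep (g K) \<ominus>\<^bsub>R\<^esub> residue_rep K \<in> J'"
      using residue_eq_iff[OF cring B.ideal rg(1) rK(1)] by simp
    moreover have "tensor_eval R M' (?h (free_gen R s)) \<ominus>\<^bsub>M'\<^esub> D (tensor_eval R M (free_gen R s))
        = (residue_rep (g K) \<ominus>\<^bsub>R\<^esub> residue_rep K) \<odot>\<^bsub>M'\<^esub> D y"
      using s gN rK(1) rg(1) Dy
      by (simp add: free_map_free_gen[OF cring h] A.eval_gen B.eval_gen linear_mapsD(3)[OF D]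
          a_minus_def B.smult_l_distr B.smult_l_minus)
    ultimately show ?case using Dy by (simp add: ideal_smult.smult)
  next
    case (add f f')
    let ?a = "tensor_eval R M' (?h f)" and ?a' = "tensor_eval R M' (?h f')"
    let ?b = "D (tensor_eval R M f)" and ?b' = "D (tensor_eval R M f')"
    have c: "?a \<in> carrier M'" "?a' \<in> carrier M'" "?b \<in> carrier M'" "?b' \<in> carrier M'"
      using add linear_mapsD(1)[OF lin] linear_mapsD(1)[OF D] linear_mapsD(1)[OF A.eval_linear]
        linear_mapsD(1)[OF B.eval_linear] by auto
    have "tensor_eval R M' (?h (f \<oplus>\<^bsub>A.L\<^esub> f')) \<ominus>\<^bsub>M'\<^esub> D (tensor_eval R M (f \<oplus>\<^bsub>A.L\<^esub> f'))
        = (?a \<oplus>\<^bsub>M'\<^esub> ?a') \<ominus>\<^bsub>M'\<^esub> (?b \<oplus>\<^bsub>M'\<^esub> ?b')"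
      using add linear_mapsD(1)[OF lin] linear_mapsD(1)[OF A.eval_linear]
      by (simp add: linear_mapsD(2)[OF lin] linear_mapsD(2)[OF D] linear_mapsD(2)[OF A.eval_linear]
          linear_mapsD(2)[OF B.eval_linear])
    also have "\<dots> = (?a \<ominus>\<^bsub>M'\<^esub> ?b) \<oplus>\<^bsub>M'\<^esub> (?a' \<ominus>\<^bsub>M'\<^esub> ?b')"
      using c by (simp add: a_minus_def B.M.minus_add B.M.a_ac)
    finally show ?case using add by (simp add: ideal_smult.add)
  next
    case (smult r f)
    let ?a = "tensor_eval R M' (?h f)" and ?b = "D (tensor_eval R M f)"
    have c: "?a \<in> carrier M'" "?b \<in> carrier M'"
      using smult linear_mapsD(1)[OF lin] linear_mapsD(1)[OF D] linear_mapsD(1)[OF A.eval_linear]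
        linear_mapsD(1)[OF B.eval_linear] by auto
    have "tensor_eval R M' (?h (r \<odot>\<^bsub>A.L\<^esub> f)) \<ominus>\<^bsub>M'\<^esub> D (tensor_eval R M (r \<odot>\<^bsub>A.L\<^esub> f))
        = r \<odot>\<^bsub>M'\<^esub> ?a \<ominus>\<^bsub>M'\<^esub> r \<odot>\<^bsub>M'\<^esub> ?b"
      using smult linear_mapsD(1)[OF lin] linear_mapsD(1)[OF A.eval_linear]
      by (simp add: linear_mapsD(3)[OF lin] linear_mapsD(3)[OF D] linear_mapsD(3)[OF A.eval_linear]
          linear_mapsD(3)[OF B.eval_linear])
    also have "\<dots> = r \<odot>\<^bsub>M'\<^esub> (?a \<ominus>\<^bsub>M'\<^esub> ?b)"
      using c smult by (simp add: a_minus_def B.smult_r_distr B.smult_r_minus)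
    finally show ?case using smult B.submoduleE(4)[OF B.JM] by simp
  qed
  have Dx: "D x \<in> carrier M'" using linear_mapsD(1)[OF D x] .
  have img: "B.p (?h f) = tensor_class R J' M' (D x)" "?h f \<in> carrier B.L"
    if "f \<in> tensor_class R J M x" for f
  proof -
    have f: "f \<in> carrier A.L" "tensor_eval R M f \<ominus>\<^bsub>M\<^esub> x \<in> A.JM"
      using that by (auto simp: tensor_class_def)
    show hf: "?h f \<in> carrier B.L" using linear_mapsD(1)[OF lin f(1)] .
    have e: "tensor_eval R M f \<in> carrier M" "tensor_eval R M' (?h f) \<in> carrier M'"
      using linear_mapsD(1)[OF A.eval_linear f(1)] linear_mapsD(1)[OF B.eval_linear hf] by auto
    have "D (tensor_eval R M f \<ominus>\<^bsub>M\<^esub> x) \<in> B.JM"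
      using f(2) by (intro ideal_smult_mono[OF \<open>J \<subseteq> J'\<close>] linear_maps_ideal_smult[OF A.mM B.mM A.ideal D])
    then have "tensor_class R J' M' (D (tensor_eval R M f)) = tensor_class R J' M' (D x)"
      using linear_maps_minus[OF A.mM B.mM D e(1) x] linear_mapsD(1)[OF D] e x
      by (subst B.tensor_class_eq_iff) auto
    moreover have "tensor_class R J' M' (tensor_eval R M' (?h f)) = tensor_class R J' M' (D (tensor_eval R M f))"
      using diff[OF f(1)] linear_mapsD(1)[OF D] e by (subst B.tensor_class_eq_iff) auto
    ultimately show "B.p (?h f) = tensor_class R J' M' (D x)"
      using B.coset_tensor_class[OF hf] by simp
  qed
  \<comment> \<open>The induced map turns a coset into the union of the cosets of the images of its
    members; by \<open>img\<close> these are all the same coset.\<close>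
  have "tensor_map R M' B.N D g (tensor_class R J M x) = (\<Union>f\<in>tensor_class R J M x. B.p (?h f))"
    unfolding tensor_map_def quotient_map_def set_add_def' a_r_coset_def' by auto
  also have "\<dots> = tensor_class R J' M' (D x)"
    using img A.tensor_class_eq_iff(2)[OF x x] by auto
  finally show ?thesis .
qed

subsection \<open>The vanishing of the map on Tor\<close>

locale module_complex = cring R for R :: "('a, 'c) ring_scheme" (structure) +
  fixes F :: "nat \<Rightarrow> ('a, 'b) module" and d :: "nat \<Rightarrow> 'b \<Rightarrow> 'b"
  assumes module: "module R (F n)"
    and linear: "d n \<in> linear_maps R (F (Suc n)) (F n)"
begin

context
  fixes J :: "'a set"
  assumes ideal: "ideal J R"
begin

lemma tensor_residue: "tensor_residue R (F n) J"
  using module ideal by (simp add: tensor_residue_def tensor_residue_axioms_def)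

abbreviation "C \<equiv> tensor_complex R F (residue_module R J)"
abbreviation "td \<equiv> tensor_diff R F d (residue_module R J)"
abbreviation "cl n \<equiv> tensor_class R J (F n)"

lemma tensor_diff_class:
  "x \<in> carrier (F (Suc n)) \<Longrightarrow> td n (cl (Suc n) x) = cl n (d n x)"
  unfolding tensor_diff_def
  by (rule tensor_map_class[OF module module ideal ideal order_refl linear]) auto

lemma tensor_complex_carrier: "carrier (C n) = cl n ` carrier (F n)"
  using tensor_residue.tensor_carrier[OF tensor_residue] by (simp add: tensor_complex_def)

lemma tensor_complex_add:
  "\<lbrakk>x \<in> carrier (F n); y \<in> carrier (F n)\<rbrakk> \<Longrightarrow> cl n x \<oplus>\<^bsub>C n\<^esub> cl n y = cl n (x \<oplus>\<^bsub>F n\<^esub> y)"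
  using tensor_residue.tensor_add[OF tensor_residue] by (simp add: tensor_complex_def)

lemma tensor_boundaries: "boundaries C td n = cl n ` d n ` carrier (F (Suc n))"
  by (simp add: boundaries_def tensor_complex_carrier image_image tensor_diff_class)

lemma tensor_cycles:
  "cycles C td (Suc n) = cl (Suc n) ` {x \<in> carrier (F (Suc n)). d n x \<in> ideal_smult R J (F n)}"
proof -
  interpret T: tensor_residue R "F n" J by (rule tensor_residue)
  have zero: "\<zero>\<^bsub>C n\<^esub> = cl n \<zero>\<^bsub>F n\<^esub>"
    using T.tensor_zero by (simp add: tensor_complex_def)
  have iff: "td n (cl (Suc n) x) = \<zero>\<^bsub>C n\<^esub> \<longleftrightarrow> d n x \<in> ideal_smult R J (F n)"
    if "x \<in> carrier (F (Suc n))" for x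
    unfolding zero tensor_diff_class[OF that] using linear_mapsD(1)[OF linear that]
    by (subst T.tensor_class_eq_iff) (auto simp: T.M.diff_zero)
  have "cycles C td (Suc n) = {y \<in> cl (Suc n) ` carrier (F (Suc n)). td n y = \<zero>\<^bsub>C n\<^esub>}"
    by (simp add: a_kernel_def kernel_def tensor_complex_carrier)
  also have "\<dots> = cl (Suc n) ` {x \<in> carrier (F (Suc n)). td n (cl (Suc n) x) = \<zero>\<^bsub>C n\<^esub>}"
    by blast
  also have "{x \<in> carrier (F (Suc n)). td n (cl (Suc n) x) = \<zero>\<^bsub>C n\<^esub>}
      = {x \<in> carrier (F (Suc n)). d n x \<in> ideal_smult R J (F n)}"
    by (intro Collect_cong conj_cong refl iff)
  finally show ?thesis .
qed

text \<open>A homology class is a coset of boundaries, hence a set of tensor classes; the inner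
  image runs through it by means of \<open>g\<close>.\<close>

lemma tensor_homology_carrier:
  "carrier (homology C td (Suc n)) =
    (\<lambda>x. (\<lambda>g. cl (Suc n) (d (Suc n) g \<oplus>\<^bsub>F (Suc n)\<^esub> x)) ` carrier (F (Suc (Suc n)))) `
      {x \<in> carrier (F (Suc n)). d n x \<in> ideal_smult R J (F n)}"
proof -
  have "(\<Union>b\<in>boundaries C td (Suc n). {b \<oplus>\<^bsub>C (Suc n)\<^esub> cl (Suc n) x})
      = (\<lambda>g. cl (Suc n) (d (Suc n) g \<oplus>\<^bsub>F (Suc n)\<^esub> x)) ` carrier (F (Suc (Suc n)))"
    if "x \<in> carrier (F (Suc n))" for x
    using that linear_mapsD(1)[OF linear] by (auto simp: tensor_boundaries tensor_complex_add)
  then show ?thesis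
    unfolding homology_def quotient_module_def A_RCOSETS_def' a_r_coset_def'
    by (auto simp: tensor_cycles simp del: cycles.simps)
qed

end

lemma nu1_zero_iff:
  assumes "ideal \<mm> R"
  shows "nu1_zero R \<mm> F d (Suc n) \<longleftrightarrow>
    (\<forall>x\<in>carrier (F (Suc n)). d n x \<in> ideal_smult R (\<mm> \<cdot> \<mm>) (F n) \<longrightarrow>
      (\<exists>g\<in>carrier (F (Suc (Suc n))). x \<ominus>\<^bsub>F (Suc n)\<^esub> d (Suc n) g \<in> ideal_smult R \<mm> (F (Suc n))))"
proof -
  interpret M: module R "F (Suc n)" by (rule module)
  interpret M2: module R "F (Suc (Suc n))" by (rule module)
  let ?F = "F (Suc n)" and ?F2 = "F (Suc (Suc n))" and ?d = "d (Suc n)"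
  let ?c = "tensor_class R \<mm> ?F" and ?c2 = "tensor_class R (\<mm> \<cdot> \<mm>) ?F"
  have sq: "ideal (\<mm> \<cdot> \<mm>) R" "\<mm> \<cdot> \<mm> \<subseteq> \<mm>"
    using ideal_prod_is_ideal[OF assms assms] ideal_prod_inter[OF assms assms] by auto
  note lin = linear[of "Suc n"]
  have dc: "?d g \<in> carrier ?F" if "g \<in> carrier ?F2" for g using linear_mapsD(1)[OF lin that] .
  let ?K = "\<lambda>x. (\<lambda>g. ?c2 (?d g \<oplus>\<^bsub>?F\<^esub> x)) ` carrier ?F2"
  \<comment> \<open>The variable \<open>g\<close> stems from the boundaries that
    \<open>homology_map\<close> adds in the target, \<open>g'\<close> from the members of the source
    coset.\<close>
  have nu: "nu1 R \<mm> F d (Suc n) (?K x)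
      = (\<lambda>(g, g'). ?c (?d g \<oplus>\<^bsub>?F\<^esub> (?d g' \<oplus>\<^bsub>?F\<^esub> x))) ` (carrier ?F2 \<times> carrier ?F2)"
    if x: "x \<in> carrier ?F" for x
  proof -
    have "tensor_map R ?F (residue_module R \<mm>) (\<lambda>x. x) (residue_map R \<mm>) (?c2 y) = ?c y"
      if "y \<in> carrier ?F" for y
      by (rule tensor_map_class[OF module module sq(1) assms sq(2) _ _ that])
        (auto simp: linear_maps_def residue_map_residue[OF is_cring sq(1) assms sq(2)])
    then have "tensor_map R ?F (residue_module R \<mm>) (\<lambda>x. x) (residue_map R \<mm>) ` ?K x
        = (\<lambda>g. ?c (?d g \<oplus>\<^bsub>?F\<^esub> x)) ` carrier ?F2"
      using dc x by (auto simp: image_image)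
    then show ?thesis
      using x dc
      unfolding nu1_def Tor_map_def homology_map_def quotient_map_def set_add_def' tensor_boundaries[OF assms]
      by (force simp: tensor_complex_add[OF assms])
  qed
  have zero: "\<zero>\<^bsub>Tor R F d (residue_module R \<mm>) (Suc n)\<^esub> = ?c ` ?d ` carrier ?F2"
    by (simp add: Tor_def homology_def quotient_module_def tensor_boundaries[OF assms])
  have "nu1 R \<mm> F d (Suc n) (?K x) = \<zero>\<^bsub>Tor R F d (residue_module R \<mm>) (Suc n)\<^esub>
      \<longleftrightarrow> (\<exists>g\<in>carrier ?F2. x \<ominus>\<^bsub>?F\<^esub> ?d g \<in> ideal_smult R \<mm> ?F)"
    if x: "x \<in> carrier ?F" for x
  proof -
    interpret T: tensor_residue R ?F \<mm> by (rule tensor_residue[OF assms])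
    have d0: "?d \<zero>\<^bsub>?F2\<^esub> = \<zero>\<^bsub>?F\<^esub>" by (rule linear_maps_zero[OF module module lin])
    show ?thesis unfolding nu[OF x] zero
    proof
      assume eq: "(\<lambda>(g, g'). ?c (?d g \<oplus>\<^bsub>?F\<^esub> (?d g' \<oplus>\<^bsub>?F\<^esub> x))) ` (carrier ?F2 \<times> carrier ?F2)
        = ?c ` ?d ` carrier ?F2"
      have "?c x \<in> (\<lambda>(g, g'). ?c (?d g \<oplus>\<^bsub>?F\<^esub> (?d g' \<oplus>\<^bsub>?F\<^esub> x))) ` (carrier ?F2 \<times> carrier ?F2)"
        by (rule image_eqI[of _ _ "(\<zero>\<^bsub>?F2\<^esub>, \<zero>\<^bsub>?F2\<^esub>)"]) (use x d0 in auto)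
      then obtain g where "g \<in> carrier ?F2" "?c x = ?c (?d g)" unfolding eq by auto
      then show "\<exists>g\<in>carrier ?F2. x \<ominus>\<^bsub>?F\<^esub> ?d g \<in> ideal_smult R \<mm> ?F"
        using T.tensor_class_eq_iff(1)[OF x dc] by auto
    next
      assume "\<exists>g\<in>carrier ?F2. x \<ominus>\<^bsub>?F\<^esub> ?d g \<in> ideal_smult R \<mm> ?F"
      then obtain h where h: "h \<in> carrier ?F2" "?c x = ?c (?d h)"
        using T.tensor_class_eq_iff(1)[OF x dc] by auto
      have sum: "?c (?d g \<oplus>\<^bsub>?F\<^esub> (?d g' \<oplus>\<^bsub>?F\<^esub> x)) = ?c (?d (g \<oplus>\<^bsub>?F2\<^esub> (g' \<oplus>\<^bsub>?F2\<^esub> h)))"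
        if "g \<in> carrier ?F2" "g' \<in> carrier ?F2" for g g'
        using that h x dc by (simp add: T.tensor_add[symmetric] linear_mapsD(2)[OF lin])
      show "(\<lambda>(g, g'). ?c (?d g \<oplus>\<^bsub>?F\<^esub> (?d g' \<oplus>\<^bsub>?F\<^esub> x))) ` (carrier ?F2 \<times> carrier ?F2)
        = ?c ` ?d ` carrier ?F2" (is "?A = ?B")
      proof
        show "?A \<subseteq> ?B" using sum h(1) by auto
        show "?B \<subseteq> ?A"
        proof
          fix y assume "y \<in> ?B"
          then obtain g where g: "g \<in> carrier ?F2" "y = ?c (?d g)" by auto
          \<comment> \<open>\<open>sum\<close> adds \<open>h\<close> to the preimage of the
            boundary; subtracting \<open>h\<close> beforehand cancels it.\<close>
          then have "y = ?c (?d (g \<ominus>\<^bsub>?F2\<^esub> h) \<oplus>\<^bsub>?F\<^esub> (?d \<zero>\<^bsub>?F2\<^esub> \<oplus>\<^bsub>?F\<^esub> x))"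
            using h(1) by (subst sum) (auto simp: a_minus_def M2.M.a_assoc M2.M.l_neg)
          then show "y \<in> ?A"
            using g(1) h(1) by (intro image_eqI[of _ _ "(g \<ominus>\<^bsub>?F2\<^esub> h, \<zero>\<^bsub>?F2\<^esub>)"]) auto
        qed
      qed
    qed
  qed
  then show ?thesis
    unfolding nu1_zero_def Tor_def[of _ _ _ "residue_module R (\<mm> \<cdot> \<mm>)"] tensor_homology_carrier[OF sq(1)]
    by auto
qed

end

subsection \<open>Submodules\<close>

lemma (in module) submodule_zero: "submodule H R M \<Longrightarrow> \<zero>\<^bsub>M\<^esub> \<in> H"
  using subgroup.one_closed[OF submodule.axioms(1)] by force

lemma (in module) submodule_minus:
  "\<lbrakk>submodule H R M; x \<in> H; y \<in> H\<rbrakk> \<Longrightarrow> x \<ominus>\<^bsub>M\<^esub> y \<in> H"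
  by (simp add: a_minus_def submoduleE(3,5))

lemma (in module) finsum_in_submodule:
  assumes "submodule H R M" "finite A" "f \<in> A \<rightarrow> H"
  shows "(\<Oplus>\<^bsub>M\<^esub>a\<in>A. f a) \<in> H"
  using assms(2,3)
proof (induction A rule: finite_induct)
  case empty
  then show ?case using submodule_zero[OF assms(1)] by simp
next
  case (insert a A)
  then have "f \<in> A \<rightarrow> carrier M" "f a \<in> carrier M"
    using submoduleE(1)[OF assms(1)] by auto
  with insert show ?case
    using submoduleE(5)[OF assms(1)] by simp
qed

lemma (in module) linear_image_submodule:
  assumes "module R N" "f \<in> linear_maps R N M"
  shows "submodule (f ` carrier N) R M"
proof -
  interpret N: module R N by fact
  have *: "\<ominus>\<^bsub>M\<^esub> f x \<in> f ` carrier N" if "x \<in> carrier N" for x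
    using that linear_maps_uminus[OF assms(1) module_axioms assms(2) that, symmetric] by simp
  have "\<zero>\<^bsub>M\<^esub> \<in> f ` carrier N"
    using linear_maps_zero[OF assms(1) module_axioms assms(2), symmetric] by simp
  then show ?thesis
    by (intro submoduleI)
      (auto simp: * linear_mapsD(1)[OF assms(2)] linear_mapsD(2,3)[OF assms(2), symmetric])
qed

lemma (in module) submodule_linear_combinations:
  assumes "finite A" "x \<in> A \<rightarrow> carrier M"
  shows "submodule {\<Oplus>\<^bsub>M\<^esub>a\<in>A. c a \<odot>\<^bsub>M\<^esub> x a | c. c \<in> A \<rightarrow> carrier R} R M" (is "submodule ?S R M")
proof -
  let ?L = "free_module R A"
  have eq: "free_extension R M x f = (\<Oplus>\<^bsub>M\<^esub>a\<in>A. f a \<odot>\<^bsub>M\<^esub> x a)" if "f \<in> carrier ?L" for f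
    using that assms by (intro free_extension_superset[OF module_axioms assms(2)]) (auto simp: free_module_def)
  have "?S = free_extension R M x ` carrier ?L"
  proof (intro equalityI subsetI)
    fix s assume "s \<in> ?S"
    then obtain c where c: "c \<in> A \<rightarrow> carrier R" "s = (\<Oplus>\<^bsub>M\<^esub>a\<in>A. c a \<odot>\<^bsub>M\<^esub> x a)" by blast
    let ?f = "\<lambda>a. if a \<in> A then c a else \<zero>\<^bsub>R\<^esub>"
    have "finite {a. ?f a \<noteq> \<zero>\<^bsub>R\<^esub>}" by (rule finite_subset[OF _ assms(1)]) auto
    then have f: "?f \<in> carrier ?L" using c(1) by (auto simp: free_module_def)
    have "s = free_extension R M x ?f"
      unfolding c(2) eq[OF f] using c(1) assms(2) by (intro M.finsum_cong') (auto simp: Pi_iff)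
    with f show "s \<in> free_extension R M x ` carrier ?L" by blast
  next
    fix s assume "s \<in> free_extension R M x ` carrier ?L"
    then obtain f where f: "f \<in> carrier ?L" "s = free_extension R M x f" by blast
    moreover have "f \<in> A \<rightarrow> carrier R" using f(1) by (auto simp: free_module_def)
    ultimately show "s \<in> ?S" by (auto simp: eq)
  qed
  then show ?thesis
    using linear_image_submodule[OF module_free_module free_extension_linear[OF module_axioms assms(2)]] is_cring
    by simp
qed

lemma (in module) submodule_sum:
  assumes "submodule H R M" "submodule K R M"
  shows "submodule {h \<oplus>\<^bsub>M\<^esub> k | h k. h \<in> H \<and> k \<in> K} R M" (is "submodule ?S R M")
proof (rule submoduleI)
  note H = submoduleE[OF assms(1)] and K = submoduleE[OF assms(2)]
  have c: "h \<in> carrier M" "k \<in> carrier M" if "h \<in> H" "k \<in> K" for h k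
    using that H(1) K(1) by auto
  show "?S \<subseteq> carrier M" using c by auto
  show "\<zero>\<^bsub>M\<^esub> \<in> ?S"
    using submodule_zero[OF assms(1)] submodule_zero[OF assms(2)] by force
  show "\<ominus>\<^bsub>M\<^esub> s \<in> ?S" if s: "s \<in> ?S" for s
  proof -
    obtain h k where "h \<in> H" "k \<in> K" "s = h \<oplus>\<^bsub>M\<^esub> k" using s by auto
    then have "\<ominus>\<^bsub>M\<^esub> s = \<ominus>\<^bsub>M\<^esub> h \<oplus>\<^bsub>M\<^esub> \<ominus>\<^bsub>M\<^esub> k" "\<ominus>\<^bsub>M\<^esub> h \<in> H" "\<ominus>\<^bsub>M\<^esub> k \<in> K"
      using c H(3) K(3) by (auto simp: M.minus_add)
    then show ?thesis by blast
  qed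
  show "s \<oplus>\<^bsub>M\<^esub> s' \<in> ?S" if s: "s \<in> ?S" "s' \<in> ?S" for s s'
  proof -
    obtain h k h' k' where "h \<in> H" "k \<in> K" "s = h \<oplus>\<^bsub>M\<^esub> k" "h' \<in> H" "k' \<in> K" "s' = h' \<oplus>\<^bsub>M\<^esub> k'"
      using s by auto
    then have "s \<oplus>\<^bsub>M\<^esub> s' = (h \<oplus>\<^bsub>M\<^esub> h') \<oplus>\<^bsub>M\<^esub> (k \<oplus>\<^bsub>M\<^esub> k')" "h \<oplus>\<^bsub>M\<^esub> h' \<in> H" "k \<oplus>\<^bsub>M\<^esub> k' \<in> K"
      using c H(5) K(5) by (auto simp: M.a_ac)
    then show ?thesis by blast
  qed
  show "r \<odot>\<^bsub>M\<^esub> s \<in> ?S" if r: "r \<in> carrier R" and s: "s \<in> ?S" for r s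
  proof -
    obtain h k where "h \<in> H" "k \<in> K" "s = h \<oplus>\<^bsub>M\<^esub> k" using s by auto
    then have "r \<odot>\<^bsub>M\<^esub> s = r \<odot>\<^bsub>M\<^esub> h \<oplus>\<^bsub>M\<^esub> r \<odot>\<^bsub>M\<^esub> k" "r \<odot>\<^bsub>M\<^esub> h \<in> H" "r \<odot>\<^bsub>M\<^esub> k \<in> K"
      using r c H(4) K(4) by (auto simp: smult_r_distr)
    then show ?thesis by blast
  qed
qed

lemma (in module) submodule_sum_superset:
  assumes "submodule H R M" "submodule K R M"
  shows "H \<subseteq> {h \<oplus>\<^bsub>M\<^esub> k | h k. h \<in> H \<and> k \<in> K}"
    and "K \<subseteq> {h \<oplus>\<^bsub>M\<^esub> k | h k. h \<in> H \<and> k \<in> K}"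
proof -
  have "x = x \<oplus>\<^bsub>M\<^esub> \<zero>\<^bsub>M\<^esub> \<and> x = \<zero>\<^bsub>M\<^esub> \<oplus>\<^bsub>M\<^esub> x" if "x \<in> H \<union> K" for x
    using that submoduleE(1)[OF assms(1)] submoduleE(1)[OF assms(2)] by auto
  then show "H \<subseteq> {h \<oplus>\<^bsub>M\<^esub> k | h k. h \<in> H \<and> k \<in> K}" "K \<subseteq> {h \<oplus>\<^bsub>M\<^esub> k | h k. h \<in> H \<and> k \<in> K}"
    using submodule_zero[OF assms(1)] submodule_zero[OF assms(2)] by blast+
qed

text \<open>Zorn's lemma. Applied to \<open>\<one>\<close> in the ring it yields a maximal ideal,
  applied to an element of \<open>F 2\<close> it yields the kernel of a functional over the residue
  field.\<close>

lemma (in module) maximal_submodule_avoiding: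
  assumes "submodule H R M" "v \<notin> H"
  obtains H' where "submodule H' R M" "H \<subseteq> H'" "v \<notin> H'"
    "\<And>K. \<lbrakk>submodule K R M; H' \<subset> K\<rbrakk> \<Longrightarrow> v \<in> K"
proof -
  let ?A = "{K. submodule K R M \<and> H \<subseteq> K \<and> v \<notin> K}"
  have "\<exists>K\<in>?A. \<forall>K'\<in>?A. K \<subseteq> K' \<longrightarrow> K' = K"
  proof (rule subset_Zorn_nonempty)
    show "?A \<noteq> {}" using assms by blast
    fix C assume C: "C \<noteq> {}" "subset.chain ?A C"
    then have sub: "submodule K R M" "H \<subseteq> K" "v \<notin> K" if "K \<in> C" for K
      using that by (auto simp: subset.chain_def)
    have tot: "K \<subseteq> K' \<or> K' \<subseteq> K" if "K \<in> C" "K' \<in> C" for K K'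
      using that C(2) unfolding subset.chain_def by blast
    have "submodule (\<Union>C) R M"
    proof (rule submoduleI)
      show "\<Union>C \<subseteq> carrier M" using submoduleE(1)[OF sub(1)] by blast
      show "\<zero>\<^bsub>M\<^esub> \<in> \<Union>C" using submodule_zero[OF sub(1)] C(1) by blast
      show "\<ominus>\<^bsub>M\<^esub> a \<in> \<Union>C" if "a \<in> \<Union>C" for a using submoduleE(3)[OF sub(1)] that by blast
      show "r \<odot>\<^bsub>M\<^esub> a \<in> \<Union>C" if "r \<in> carrier R" "a \<in> \<Union>C" for r a
        using submoduleE(4)[OF sub(1)] that by blast
      show "a \<oplus>\<^bsub>M\<^esub> b \<in> \<Union>C" if ab: "a \<in> \<Union>C" "b \<in> \<Union>C" for a b
      proof -
        obtain K where "K \<in> C" "a \<in> K" "b \<in> K" using ab tot by blast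
        then show ?thesis using submoduleE(5)[OF sub(1)] by blast
      qed
    qed
    then show "\<Union>C \<in> ?A" using sub C(1) by blast
  qed
  then obtain H' where H': "H' \<in> ?A" "\<forall>K\<in>?A. H' \<subseteq> K \<longrightarrow> K = H'" by (rule bexE)
  show ?thesis
  proof
    show "submodule H' R M" "H \<subseteq> H'" "v \<notin> H'" using H'(1) by auto
    show "v \<in> K" if K: "submodule K R M" "H' \<subset> K" for K
    proof (rule ccontr)
      assume "v \<notin> K"
      then have "K = H'" using K H' by auto
      then show False using K(2) by simp
    qed
  qed
qed

subsection \<open>Local rings\<close>

lemma ideal_regular_submodule:
  assumes "cring R" "submodule I R (regular_module R)"
  shows "ideal I R"
proof -
  interpret cring R by fact
  interpret m: module R "regular_module R" by (rule module_regular_module) fact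
  have neg: "\<ominus>\<^bsub>regular_module R\<^esub> y = \<ominus>\<^bsub>R\<^esub> y" if "y \<in> carrier R" for y
    by (rule m.M.minus_equality) (use that in \<open>auto simp: regular_module_def l_neg\<close>)
  have sub: "I \<subseteq> carrier R" using m.submoduleE(1)[OF assms(2)] by (simp add: regular_module_def)
  have cl: "x \<oplus>\<^bsub>R\<^esub> y \<in> I" "\<ominus>\<^bsub>R\<^esub> x \<in> I" if "x \<in> I" "y \<in> I" for x y
    using m.submoduleE(3)[OF assms(2), of x] m.submoduleE(5)[OF assms(2), of x y] that neg sub
    by (auto simp: regular_module_def)
  have sm: "r \<otimes>\<^bsub>R\<^esub> x \<in> I" if "x \<in> I" "r \<in> carrier R" for r x
    using m.submoduleE(4)[OF assms(2), of r x] that by (simp add: regular_module_def)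
  show ?thesis
  proof (rule idealI)
    show "ring R" by unfold_locales
    show "subgroup I (add_monoid R)"
      by (rule add.subgroupI) (use sub cl m.submoduleE(2)[OF assms(2)] in auto)
    show "x \<otimes>\<^bsub>R\<^esub> a \<in> I" "a \<otimes>\<^bsub>R\<^esub> x \<in> I" if "a \<in> I" "x \<in> carrier R" for a x
      using sm[OF that] that sub m_comm[of a x] by auto
  qed
qed

locale noetherian_local = noetherian_ring R + cring R for R (structure) +
  fixes \<mm> :: "'a set"
  assumes maximal: "maximalideal \<mm> R"
    and unique_maximal: "maximalideal I R \<Longrightarrow> I = \<mm>"
begin

sublocale \<mm>: ideal \<mm> R
  using maximal by (simp add: maximalideal_def)

sublocale regular: module R "regular_module R"
  by (rule module_regular_module) (rule is_cring)

lemma one_notin: "\<one> \<notin> \<mm>"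
  using maximalideal.I_notcarr[OF maximal] \<mm>.one_imp_carrier by blast

text \<open>A submodule of the ring that is maximal among those without \<open>\<one>\<close> is a
  maximal ideal, and there is only one of these.\<close>

lemma proper_ideal_subset:
  assumes "ideal I R" "\<one> \<notin> I"
  shows "I \<subseteq> \<mm>"
proof -
  obtain H where H: "submodule H R (regular_module R)" "I \<subseteq> H" "\<one> \<notin> H"
    and max: "\<And>K. \<lbrakk>submodule K R (regular_module R); H \<subset> K\<rbrakk> \<Longrightarrow> \<one> \<in> K"
    using regular.maximal_submodule_avoiding[OF submodule_regular_module[OF is_cring assms(1)] assms(2)]
    by metis
  have idH: "ideal H R" by (rule ideal_regular_submodule[OF is_cring H(1)])
  have "maximalideal H R"
  proof (rule maximalidealI[OF idH])
    show "carrier R \<noteq> H" using H(3) by auto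
    show "J = H \<or> J = carrier R" if "ideal J R" "H \<subseteq> J" "J \<subseteq> carrier R" for J
      using max[OF submodule_regular_module[OF is_cring that(1)]] that ideal.one_imp_carrier by blast
  qed
  then show ?thesis using unique_maximal H(2) by blast
qed

lemma unit:
  assumes "x \<in> carrier R" "x \<notin> \<mm>"
  obtains y where "y \<in> carrier R" "y \<otimes> x = \<one>"
proof -
  have "x \<in> PIdl x" "ideal (PIdl x) R" using assms(1) cgenideal_self cgenideal_ideal by auto
  then have "\<one> \<in> PIdl x" using proper_ideal_subset assms(2) by blast
  then show ?thesis using that by (auto simp: cgenideal_def)
qed

text \<open>A generating set of least cardinality: in a relation, a coefficient outside
  \<open>\<mm>\<close> would be a unit and make its generator redundant. The generators are numbered
  because the signs in the Koszul complex need an order.\<close>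

lemma minimal_generators:
  obtains e :: nat and x :: "nat \<Rightarrow> 'a"
  where "\<And>k. x k \<in> \<mm>"
    and "\<And>a. a \<in> \<mm> \<Longrightarrow> \<exists>c\<in>{..<e} \<rightarrow> carrier R. a = (\<Oplus>k\<in>{..<e}. c k \<otimes> x k)"
    and "\<And>c k. \<lbrakk>c \<in> {..<e} \<rightarrow> carrier R; (\<Oplus>k\<in>{..<e}. c k \<otimes> x k) = \<zero>; k < e\<rbrakk> \<Longrightarrow> c k \<in> \<mm>"
proof -
  define gen where "gen A \<longleftrightarrow> finite A \<and> A \<subseteq> \<mm> \<and> (\<forall>a\<in>\<mm>. \<exists>c\<in>A \<rightarrow> carrier R. a = (\<Oplus>b\<in>A. c b \<otimes> b))" for A
  let ?span = "\<lambda>A. {\<Oplus>b\<in>A. c b \<otimes> b | c. c \<in> A \<rightarrow> carrier R}"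
  have span_ideal: "ideal (?span A) R" if "finite A" "A \<subseteq> carrier R" for A
    using regular.submodule_linear_combinations[of A "\<lambda>b. b"] that
    by (intro ideal_regular_submodule is_cring)
      (simp add: finsum_regular_module, auto simp: regular_module_def)
  have in_span: "b \<in> ?span A" if "finite A" "A \<subseteq> carrier R" "b \<in> A" for A b
  proof -
    have "(\<Oplus>a\<in>A. (if a = b then \<one> else \<zero>) \<otimes> a) = (\<Oplus>a\<in>A. if b = a then a else \<zero>)"
      using that by (intro finsum_cong') auto
    also have "\<dots> = b"
      using that add.finprod_singleton[of b A "\<lambda>a. a"] by auto
    finally show ?thesis
      by (intro CollectI exI[of _ "\<lambda>a. if a = b then \<one> else \<zero>"]) auto
  qed
  have gen_span: "gen A \<longleftrightarrow> finite A \<and> A \<subseteq> \<mm> \<and> \<mm> \<subseteq> ?span A" for A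
    unfolding gen_def by (auto simp: subset_iff)
  have "\<exists>A. gen A"
  proof -
    obtain A where A: "A \<subseteq> carrier R" "finite A" "\<mm> = Idl A"
      using finetely_gen[OF \<mm>.is_ideal] by blast
    have "Idl A \<subseteq> ?span A"
      using in_span A by (intro genideal_minimal span_ideal) auto
    then have "gen A" unfolding gen_span using A genideal_self[OF A(1)] by simp
    then show ?thesis ..
  qed
  then obtain A where A: "gen A" and min: "\<And>B. gen B \<Longrightarrow> card A \<le> card B"
    using ex_has_least_nat[of gen _ card] by metis
  have finA: "finite A" and Am: "A \<subseteq> \<mm>" using A by (auto simp: gen_def)
  have Ac: "A \<subseteq> carrier R" using Am \<mm>.Icarr by blast
  have indep: "c a \<in> \<mm>" if c: "c \<in> A \<rightarrow> carrier R" and sum: "(\<Oplus>b\<in>A. c b \<otimes> b) = \<zero>" and a: "a \<in> A" for c a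
  proof (rule ccontr)
    assume "c a \<notin> \<mm>"
    then obtain y where y: "y \<in> carrier R" "y \<otimes> c a = \<one>" using unit c a by blast
    let ?B = "A - {a}"
    have B: "finite ?B" "?B \<subseteq> carrier R" "a \<in> carrier R" "c a \<in> carrier R" using finA Ac a c by auto
    have I: "ideal (?span ?B) R" by (rule span_ideal[OF B(1,2)])
    let ?s = "\<Oplus>b\<in>?B. c b \<otimes> b"
    have cb: "(\<lambda>b. c b \<otimes> b) \<in> ?B \<rightarrow> carrier R" using c Ac by auto
    have s: "?s \<in> ?span ?B" "?s \<in> carrier R" using c cb by auto
    have "(\<Oplus>b\<in>A. c b \<otimes> b) = c a \<otimes> a \<oplus> ?s"
      using finsum_insert[of ?B a "\<lambda>b. c b \<otimes> b"] B cb a by (simp add: insert_absorb)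
    then have neg: "c a \<otimes> a = \<ominus> ?s"
      using sum B s minus_equality[of "c a \<otimes> a" ?s] by simp
    have "y \<otimes> (c a \<otimes> a) \<in> ?span ?B"
      unfolding neg
      by (rule ideal.I_l_closed[OF I additive_subgroup.a_inv_closed[OF ideal.axioms(1)[OF I] s(1)] y(1)])
    then have aB: "a \<in> ?span ?B"
      using y B by (simp add: m_assoc[symmetric])
    have "?span A \<subseteq> ?span ?B"
    proof
      fix w assume "w \<in> ?span A"
      then obtain c' where c': "c' \<in> A \<rightarrow> carrier R" "w = (\<Oplus>b\<in>A. c' b \<otimes> b)" by auto
      let ?s' = "\<Oplus>b\<in>?B. c' b \<otimes> b"
      have cb': "(\<lambda>b. c' b \<otimes> b) \<in> ?B \<rightarrow> carrier R" "c' a \<in> carrier R" using c' Ac a by auto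
      have "w = c' a \<otimes> a \<oplus> ?s'"
        using finsum_insert[of ?B a "\<lambda>b. c' b \<otimes> b"] B cb' a c'(2) by (simp add: insert_absorb)
      moreover have "?s' \<in> ?span ?B" using c'(1) by auto
      ultimately show "w \<in> ?span ?B"
        using additive_subgroup.a_closed[OF ideal.axioms(1)[OF I] ideal.I_l_closed[OF I aB cb'(2)]] by simp
    qed
    then have "gen ?B"
      using A finA Am unfolding gen_span by blast
    then have "card A \<le> card ?B" by (rule min)
    then show False using card_Diff1_less[OF finA a] by simp
  qed
  obtain h where h: "bij_betw h {0..<card A} A" using ex_bij_betw_nat_finite[OF finA] by blast
  then have hb: "bij_betw h {..<card A} A" by (simp add: atLeast0LessThan)
  \<comment> \<open>The value zero beyond the generators keeps every \<open>x k\<close> in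
    \<open>\<mm>\<close>, so later statements need no bound on \<open>k\<close>.\<close>
  define x where "x k = (if k < card A then h k else \<zero>)" for k
  have hA: "h k \<in> A" if "k < card A" for k using hb that by (auto simp: bij_betw_def)
  have reindex: "(\<Oplus>k\<in>{..<card A}. g (h k) \<otimes> h k) = (\<Oplus>b\<in>A. g b \<otimes> b)" if "g \<in> A \<rightarrow> carrier R" for g
  proof -
    have "(\<Oplus>b\<in>h ` {..<card A}. g b \<otimes> b) = (\<Oplus>k\<in>{..<card A}. g (h k) \<otimes> h k)"
      using hb that Ac by (intro add.finprod_reindex) (auto simp: bij_betw_def)
    then show ?thesis using hb by (simp add: bij_betw_def)
  qed
  show ?thesis
  proof (rule that[of x "card A"])
    show "x k \<in> \<mm>" for k using hA Am by (auto simp: x_def)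
    show "\<exists>c\<in>{..<card A} \<rightarrow> carrier R. a = (\<Oplus>k\<in>{..<card A}. c k \<otimes> x k)" if "a \<in> \<mm>" for a
    proof -
      obtain c where c: "c \<in> A \<rightarrow> carrier R" "a = (\<Oplus>b\<in>A. c b \<otimes> b)" using A \<open>a \<in> \<mm>\<close> by (auto simp: gen_def)
      then have "a = (\<Oplus>k\<in>{..<card A}. c (h k) \<otimes> h k)" by (simp add: reindex)
      also have "\<dots> = (\<Oplus>k\<in>{..<card A}. c (h k) \<otimes> x k)"
        using c(1) hA Ac by (intro finsum_cong') (auto simp: x_def Pi_iff subset_iff)
      finally show ?thesis
        using c(1) hA by (intro bexI[of _ "\<lambda>k. c (h k)"]) auto
    qed
    show "c k \<in> \<mm>" if c: "c \<in> {..<card A} \<rightarrow> carrier R" and sum: "(\<Oplus>k\<in>{..<card A}. c k \<otimes> x k) = \<zero>" and k: "k < card A" for c k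
    proof -
      \<comment> \<open>A relation between the numbered generators is carried back to a relation
        indexed by \<open>A\<close>.\<close>
      define h' where "h' = the_inv_into {..<card A} h"
      have h': "h' (h k) = k" if "k < card A" for k
        unfolding h'_def using hb that by (intro the_inv_into_f_f) (auto simp: bij_betw_def)
      have cA: "(\<lambda>b. c (h' b)) \<in> A \<rightarrow> carrier R"
      proof
        fix b assume "b \<in> A"
        then obtain k where "k < card A" "b = h k" using hb by (auto simp: bij_betw_def)
        then show "c (h' b) \<in> carrier R" using c h' by auto
      qed
      have "(\<Oplus>b\<in>A. c (h' b) \<otimes> b) = (\<Oplus>k\<in>{..<card A}. c (h' (h k)) \<otimes> h k)"
        using reindex[OF cA] by simp
      also have "\<dots> = (\<Oplus>k\<in>{..<card A}. c k \<otimes> x k)"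
        using c hA Ac by (intro finsum_cong') (auto simp: x_def h' Pi_iff subset_iff)
      finally have "c (h' (h k)) \<in> \<mm>"
        using indep[OF cA _ hA[OF k]] sum by simp
      then show ?thesis using h' k by simp
    qed
  qed
qed

end

subsection \<open>A Clifford module\<close>

text \<open>Multiplication by the \<open>k\<close>-th exterior generator and contraction with it
  both link the basis elements of \<open>A\<close> and \<open>flip k A\<close>, so one index map
  serves for both.\<close>

definition flip :: "'i \<Rightarrow> 'i set \<Rightarrow> 'i set" where
  "flip k A = (if k \<in> A then A - {k} else insert k A)"

lemma flip_simps [simp]:
  "flip k (flip k A) = A"
  "finite (flip k A) \<longleftrightarrow> finite A"
  "l \<in> flip k A \<longleftrightarrow> (if l = k then k \<notin> A else l \<in> A)"
  by (auto simp: flip_def)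

lemma flip_commute: "flip k (flip l A) = flip l (flip k A)"
  by (auto simp: flip_def)

lemma card_flip:
  "finite A \<Longrightarrow> card (flip k A) = (if k \<in> A then card A - 1 else card A + 1)"
  by (auto simp: flip_def)

lemma even_card_flip:
  assumes "finite A"
  shows "even (card (flip k A)) \<longleftrightarrow> odd (card A)"
proof -
  have "card A > 0" if "k \<in> A" using that assms by (auto simp: card_gt_0_iff)
  then show ?thesis using assms by (auto simp: card_flip)
qed

text \<open>The coefficients of \<open>\<Sum>k. x\<^sub>k \<iota>\<^sub>k + z\<^sub>k \<epsilon>\<^sub>k\<close>, where \<open>\<iota>\<^sub>k\<close> and \<open>\<epsilon>\<^sub>k\<close> are the contraction and the
  multiplication by the \<open>k\<close>-th generator of an exterior algebra. The square of this operator is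
  the scalar \<open>\<Sum>k. x\<^sub>k z\<^sub>k\<close>.\<close>

definition clifford_coeff ::
    "('a, 'c) ring_scheme \<Rightarrow> (nat \<Rightarrow> 'a) \<Rightarrow> (nat \<Rightarrow> 'a) \<Rightarrow> nat \<Rightarrow> nat set \<Rightarrow> 'a"
  where "clifford_coeff R x z k A =
    (let c = if k \<in> A then x k else z k in if even (card {j \<in> A. j < k}) then c else \<ominus>\<^bsub>R\<^esub> c)"

text \<open>If \<open>v\<close> lists the values of a linear map on the basis elements
  \<open>e_A\<close>, this is its value on the differential of \<open>e_A\<close>. The exterior
  algebra itself is never formed.\<close>

definition clifford ::
    "('a, 'c) ring_scheme \<Rightarrow> ('a, 'b, 'e) module_scheme \<Rightarrow> nat \<Rightarrow> (nat \<Rightarrow> 'a) \<Rightarrow> (nat \<Rightarrow> 'a) \<Rightarrow>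
      (nat set \<Rightarrow> 'b) \<Rightarrow> nat set \<Rightarrow> 'b"
  where "clifford R M e x z v A = (\<Oplus>\<^bsub>M\<^esub>k\<in>{..<e}. clifford_coeff R x z k A \<odot>\<^bsub>M\<^esub> v (flip k A))"

text \<open>Induction on \<open>n\<close>: off the diagonal, the new row cancels against the new
  column. The diagonal stays, since it carries the scalar square of the Clifford operator.\<close>

lemma (in abelian_group) finsum_antisymmetric:
  fixes n :: nat
  assumes closed: "\<And>k l. H k l \<in> carrier G"
    and anti: "\<And>k l. \<lbrakk>k < n; l < n; k \<noteq> l\<rbrakk> \<Longrightarrow> H k l \<oplus> H l k = \<zero>"
  shows "(\<Oplus>k\<in>{..<n}. \<Oplus>l\<in>{..<n}. H k l) = (\<Oplus>k\<in>{..<n}. H k k)"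
  using anti
proof (induction n)
  case 0
  then show ?case by simp
next
  case (Suc n)
  have c: "(\<lambda>k. H k n) \<in> {..<n} \<rightarrow> carrier G" "H n \<in> {..<n} \<rightarrow> carrier G" "H k \<in> {..<n} \<rightarrow> carrier G"
    "(\<lambda>k. H k k) \<in> {..<n} \<rightarrow> carrier G" "(\<lambda>k. \<Oplus>l\<in>{..<n}. H k l) \<in> {..<n} \<rightarrow> carrier G" for k
    using closed by auto
  have fc: "(\<Oplus>l\<in>{..<n}. H k l) \<in> carrier G" "(\<Oplus>k\<in>{..<n}. H k n) \<in> carrier G"
    "(\<Oplus>k\<in>{..<n}. \<Oplus>l\<in>{..<n}. H k l) \<in> carrier G" "(\<Oplus>k\<in>{..<n}. H k k) \<in> carrier G" for k
    using closed by (auto intro!: finsum_closed)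
  have row: "(\<Oplus>l\<in>{..<Suc n}. H k l) = H k n \<oplus> (\<Oplus>l\<in>{..<n}. H k l)" for k
    using closed by (simp add: lessThan_Suc)
  have "(\<Oplus>k\<in>{..<Suc n}. \<Oplus>l\<in>{..<Suc n}. H k l)
      = (\<Oplus>l\<in>{..<Suc n}. H n l) \<oplus> (\<Oplus>k\<in>{..<n}. \<Oplus>l\<in>{..<Suc n}. H k l)"
    unfolding lessThan_Suc[of n] using closed by (subst finsum_insert) auto
  also have "(\<Oplus>k\<in>{..<n}. \<Oplus>l\<in>{..<Suc n}. H k l)
      = (\<Oplus>k\<in>{..<n}. H k n) \<oplus> (\<Oplus>k\<in>{..<n}. \<Oplus>l\<in>{..<n}. H k l)"
    unfolding row using c fc by (intro finsum_addf) auto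
  also have "(\<Oplus>k\<in>{..<n}. \<Oplus>l\<in>{..<n}. H k l) = (\<Oplus>k\<in>{..<n}. H k k)"
    by (rule Suc.IH) (use Suc.prems in auto)
  finally have "(\<Oplus>k\<in>{..<Suc n}. \<Oplus>l\<in>{..<Suc n}. H k l)
      = (H n n \<oplus> (\<Oplus>l\<in>{..<n}. H n l)) \<oplus> ((\<Oplus>k\<in>{..<n}. H k n) \<oplus> (\<Oplus>k\<in>{..<n}. H k k))"
    by (simp only: row)
  also have "\<dots> = ((\<Oplus>l\<in>{..<n}. H n l) \<oplus> (\<Oplus>k\<in>{..<n}. H k n)) \<oplus> (H n n \<oplus> (\<Oplus>k\<in>{..<n}. H k k))"
    using closed fc by (simp add: a_ac)
  also have "(\<Oplus>l\<in>{..<n}. H n l) \<oplus> (\<Oplus>k\<in>{..<n}. H k n) = (\<Oplus>k\<in>{..<n}. H n k \<oplus> H k n)"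
    using c by (intro finsum_addf[symmetric])
  also have "\<dots> = \<zero>"
    by (rule add.finprod_one_eqI) (use Suc.prems in auto)
  finally show ?case
    using closed fc by (simp add: lessThan_Suc)
qed

lemma (in module) finsum_smult_rdistr:
  assumes "finite A" "f \<in> A \<rightarrow> carrier R" "v \<in> carrier M"
  shows "(\<Oplus>\<^bsub>R\<^esub>a\<in>A. f a) \<odot>\<^bsub>M\<^esub> v = (\<Oplus>\<^bsub>M\<^esub>a\<in>A. f a \<odot>\<^bsub>M\<^esub> v)"
  using assms by (induction A rule: finite_induct) (auto simp: Pi_iff smult_l_distr)

text \<open>\<open>relation\<close> says that the combination of the exterior generators with
  coefficients \<open>z k\<close> is a cycle of the Koszul complex on the
  \<open>x k\<close>.\<close>

locale clifford_data = cring R for R (structure) +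
  fixes e :: nat and x z :: "nat \<Rightarrow> 'a"
  assumes x [simp]: "x k \<in> carrier R" and z [simp]: "z k \<in> carrier R"
    and relation: "(\<Oplus>k\<in>{..<e}. x k \<otimes> z k) = \<zero>"
begin

abbreviation "cc \<equiv> clifford_coeff R x z"

lemma cc_closed [simp]: "cc k A \<in> carrier R"
  by (simp add: clifford_coeff_def Let_def)

text \<open>A sign counts the smaller indices in the set. Flipping a larger index leaves it alone,
  flipping a smaller one reverses it; this asymmetry is the source of anticommutation.\<close>

lemma cc_less:
  assumes "k < l" "finite A"
  shows "cc k (flip l A) = cc k A" "cc l (flip k A) = \<ominus> cc l A"
proof -
  have "{j \<in> flip l A. j < k} = {j \<in> A. j < k}" using assms(1) by (auto simp: flip_def)
  then show "cc k (flip l A) = cc k A"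
    using assms(1) by (simp add: clifford_coeff_def)
  have "{j \<in> flip k A. j < l} = flip k {j \<in> A. j < l}" using assms(1) by (auto simp: flip_def)
  then have "even (card {j \<in> flip k A. j < l}) \<longleftrightarrow> odd (card {j \<in> A. j < l})"
    using assms(2) by (simp add: even_card_flip)
  then show "cc l (flip k A) = \<ominus> cc l A"
    using assms(1) by (simp add: clifford_coeff_def Let_def)
qed

lemma cc_anticommute:
  assumes "k \<noteq> l" "finite A"
  shows "cc k A \<otimes> cc l (flip k A) \<oplus> cc l A \<otimes> cc k (flip l A) = \<zero>"
  using assms by (cases "k < l") (simp_all add: cc_less r_minus l_neg r_neg m_comm linorder_not_less order_less_le)

lemma cc_square:
  assumes "finite A"
  shows "cc k A \<otimes> cc k (flip k A) = x k \<otimes> z k"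
proof -
  have "{j \<in> flip k A. j < k} = {j \<in> A. j < k}" by (auto simp: flip_def)
  then show ?thesis
    by (simp add: clifford_coeff_def Let_def l_minus r_minus m_comm)
qed

lemma clifford_closed:
  assumes "module R M" "\<And>A. v A \<in> carrier M"
  shows "clifford R M e x z v A \<in> carrier M"
proof -
  interpret module R M by fact
  show ?thesis unfolding clifford_def using assms(2) by (intro M.finsum_closed) auto
qed

text \<open>This is \<open>d\<^sup>2 = 0\<close> in \<open>K<T>\<close>. The terms with two
  different indices cancel in pairs; a repeated index contributes \<open>x k \<otimes> z k\<close>
  whether or not \<open>A\<close> contains it, and these sum to zero by
  \<open>relation\<close>.\<close>

lemma clifford_clifford:
  assumes "module R M" "\<And>A. v A \<in> carrier M" "finite A"
  shows "clifford R M e x z (clifford R M e x z v) A = \<zero>\<^bsub>M\<^esub>"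
proof -
  interpret module R M by fact
  note v = assms(2)
  define H where "H k l = (cc k A \<otimes> cc l (flip k A)) \<odot>\<^bsub>M\<^esub> v (flip l (flip k A))" for k l
  have H: "H k l \<in> carrier M" for k l using v by (simp add: H_def)
  have "clifford R M e x z (clifford R M e x z v) A = (\<Oplus>\<^bsub>M\<^esub>k\<in>{..<e}. \<Oplus>\<^bsub>M\<^esub>l\<in>{..<e}. H k l)"
    unfolding clifford_def H_def using v
    by (intro M.finsum_cong' refl)
      (auto simp: finsum_smult_ldistr smult_assoc1 intro!: M.finsum_closed)
  also have "\<dots> = (\<Oplus>\<^bsub>M\<^esub>k\<in>{..<e}. H k k)"
  proof (rule M.finsum_antisymmetric[OF H])
    fix k l assume "k < e" "l < e" "k \<noteq> l"
    have "H k l \<oplus>\<^bsub>M\<^esub> H l k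
        = (cc k A \<otimes> cc l (flip k A) \<oplus> cc l A \<otimes> cc k (flip l A)) \<odot>\<^bsub>M\<^esub> v (flip l (flip k A))"
      unfolding H_def flip_commute[of k l] using v by (simp add: smult_l_distr)
    then show "H k l \<oplus>\<^bsub>M\<^esub> H l k = \<zero>\<^bsub>M\<^esub>"
      using v assms(3) \<open>k \<noteq> l\<close> by (simp add: cc_anticommute)
  qed
  also have "\<dots> = (\<Oplus>\<^bsub>M\<^esub>k\<in>{..<e}. (x k \<otimes> z k) \<odot>\<^bsub>M\<^esub> v A)"
    unfolding H_def using assms(3) by (simp add: cc_square)
  also have "\<dots> = (\<Oplus>k\<in>{..<e}. x k \<otimes> z k) \<odot>\<^bsub>M\<^esub> v A"
    using v by (intro finsum_smult_rdistr[symmetric]) auto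
  finally show ?thesis using v relation by simp
qed

lemma linear_clifford:
  assumes "module R M" "module R N" "f \<in> linear_maps R M N" "\<And>A. v A \<in> carrier M"
  shows "f (clifford R M e x z v A) = clifford R N e x z (\<lambda>A. f (v A)) A"
proof -
  interpret M: module R M by fact
  interpret N: module R N by fact
  have "f (clifford R M e x z v A) = (\<Oplus>\<^bsub>N\<^esub>k\<in>{..<e}. f (cc k A \<odot>\<^bsub>M\<^esub> v (flip k A)))"
    unfolding clifford_def using assms(4) by (intro linear_maps_finsum[OF assms(1-3)]) auto
  also have "\<dots> = clifford R N e x z (\<lambda>A. f (v A)) A"
    unfolding clifford_def using assms(4) by (simp add: linear_mapsD(3)[OF assms(3)])
  finally show ?thesis .
qed

lemma clifford_minus:
  assumes "module R M" "\<And>A. v A \<in> carrier M" "\<And>A. w A \<in> carrier M"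
  shows "clifford R M e x z (\<lambda>A. v A \<ominus>\<^bsub>M\<^esub> w A) A = clifford R M e x z v A \<ominus>\<^bsub>M\<^esub> clifford R M e x z w A"
proof -
  interpret module R M by fact
  let ?vw = "\<lambda>A. v A \<ominus>\<^bsub>M\<^esub> w A"
  have vw: "?vw A \<oplus>\<^bsub>M\<^esub> w A = v A" for A
    using assms(2,3) by (simp add: a_minus_def M.a_assoc M.l_neg)
  have "clifford R M e x z ?vw A \<oplus>\<^bsub>M\<^esub> clifford R M e x z w A
      = (\<Oplus>\<^bsub>M\<^esub>k\<in>{..<e}. cc k A \<odot>\<^bsub>M\<^esub> ?vw (flip k A) \<oplus>\<^bsub>M\<^esub> cc k A \<odot>\<^bsub>M\<^esub> w (flip k A))"
    unfolding clifford_def using assms(2,3) by (intro M.finsum_addf[symmetric]) auto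
  also have "\<dots> = clifford R M e x z v A"
    unfolding clifford_def using assms(2,3)
    by (intro M.finsum_cong') (auto simp: smult_r_distr[symmetric] vw)
  finally have sum: "clifford R M e x z ?vw A \<oplus>\<^bsub>M\<^esub> clifford R M e x z w A = clifford R M e x z v A" .
  then show ?thesis
    using clifford_closed[OF assms(1), of ?vw A] clifford_closed[OF assms(1), of w A] assms(2,3)
    by (simp add: a_minus_def M.a_assoc M.r_neg flip: sum)
qed

lemma clifford_ideal_smult:
  assumes "module R M" "ideal J R" "\<And>A. v A \<in> carrier M" "\<And>k. x k \<in> J" "\<And>k. z k \<in> J"
  shows "clifford R M e x z v A \<in> ideal_smult R J M"
proof -
  interpret module R M by fact
  interpret J: ideal J R by fact
  have "cc k A \<in> J" for k using assms(4,5) by (auto simp: clifford_coeff_def Let_def)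
  then show ?thesis
    unfolding clifford_def using assms(3)
    by (intro finsum_in_submodule[OF submodule_ideal_smult[OF assms(1,2)]]) (auto intro: ideal_smult.smult)
qed

end

subsection \<open>Chain maps on a resolution of the residue field\<close>

locale residue_resolution = noetherian_local R \<mm> + module_complex R F d
  for R :: "('a, 'c) ring_scheme" (structure) and \<mm> :: "'a set"
    and F :: "nat \<Rightarrow> ('a, 'b) module" and d :: "nat \<Rightarrow> 'b \<Rightarrow> 'b" +
  fixes \<epsilon> :: "'b \<Rightarrow> 'a set"
  assumes free: "is_free R (F n)"
    and exact: "{x \<in> carrier (F (Suc n)). d n x = \<zero>\<^bsub>F n\<^esub>} = d (Suc n) ` carrier (F (Suc (Suc n)))"
    and aug: "\<epsilon> \<in> linear_maps R (F 0) (residue_module R \<mm>)"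
    and aug_surj: "\<epsilon> ` carrier (F 0) = carrier (residue_module R \<mm>)"
    and aug_exact: "{v \<in> carrier (F 0). \<epsilon> v = \<zero>\<^bsub>residue_module R \<mm>\<^esub>} = d 0 ` carrier (F (Suc 0))"
begin

sublocale F: module R "F n" for n by (rule module)

lemma d_closed [simp]: "x \<in> carrier (F (Suc n)) \<Longrightarrow> d n x \<in> carrier (F n)"
  by (rule linear_mapsD(1)[OF linear])

lemma d_add: "\<lbrakk>x \<in> carrier (F (Suc n)); y \<in> carrier (F (Suc n))\<rbrakk> \<Longrightarrow> d n (x \<oplus>\<^bsub>F (Suc n)\<^esub> y) = d n x \<oplus>\<^bsub>F n\<^esub> d n y"
  by (rule linear_mapsD(2)[OF linear])

lemma d_smult: "\<lbrakk>r \<in> carrier R; x \<in> carrier (F (Suc n))\<rbrakk> \<Longrightarrow> d n (r \<odot>\<^bsub>F (Suc n)\<^esub> x) = r \<odot>\<^bsub>F n\<^esub> d n x"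
  by (rule linear_mapsD(3)[OF linear])

lemma d_minus: "\<lbrakk>x \<in> carrier (F (Suc n)); y \<in> carrier (F (Suc n))\<rbrakk> \<Longrightarrow> d n (x \<ominus>\<^bsub>F (Suc n)\<^esub> y) = d n x \<ominus>\<^bsub>F n\<^esub> d n y"
  by (rule linear_maps_minus[OF module module linear])

lemma d_zero [simp]: "d n \<zero>\<^bsub>F (Suc n)\<^esub> = \<zero>\<^bsub>F n\<^esub>"
  by (rule linear_maps_zero[OF module module linear])

lemma d_d [simp]: "x \<in> carrier (F (Suc (Suc n))) \<Longrightarrow> d n (d (Suc n) x) = \<zero>\<^bsub>F n\<^esub>"
  using exact[of n] by blast

lemma exactD: "\<lbrakk>x \<in> carrier (F (Suc n)); d n x = \<zero>\<^bsub>F n\<^esub>\<rbrakk> \<Longrightarrow> x \<in> d (Suc n) ` carrier (F (Suc (Suc n)))"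
  using exact[of n] by blast

lemma module_k: "module R (residue_module R \<mm>)"
  by (rule module_residue_module[OF is_cring \<mm>.is_ideal])

text \<open>\<open>\<mm>\<close> annihilates the residue field. In degree 0 this fact starts the
  recursions: coefficients in \<open>\<mm>\<close> do there what the cycle condition does in higher
  degrees.\<close>

lemma aug_ideal_smult:
  assumes "w \<in> ideal_smult R \<mm> (F 0)"
  shows "w \<in> d 0 ` carrier (F (Suc 0))"
proof -
  interpret k: module R "residue_module R \<mm>" by (rule module_k)
  have "y = \<zero>\<^bsub>residue_module R \<mm>\<^esub>" if "y \<in> ideal_smult R \<mm> (residue_module R \<mm>)" for y
    using that
  proof induction
    case (smult r y)
    then obtain s where "s \<in> carrier R" "y = residue R \<mm> s" by (auto simp: residue_carrier)
    with smult show ?case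
      by (simp add: residue_module_smult[OF is_cring \<mm>.is_ideal] residue_module_zero[OF is_cring \<mm>.is_ideal]
          residue_eq_iff[OF is_cring \<mm>.is_ideal] diff_zero \<mm>.I_r_closed)
  qed auto
  then have "\<epsilon> w = \<zero>\<^bsub>residue_module R \<mm>\<^esub>"
    using linear_maps_ideal_smult[OF module module_k \<mm>.is_ideal aug assms] by blast
  moreover have "w \<in> carrier (F 0)"
    using F.submoduleE(1)[OF submodule_ideal_smult[OF module \<mm>.is_ideal]] assms by blast
  ultimately show ?thesis using aug_exact by blast
qed

text \<open>An element of \<open>F\<^sub>n\<close> whose image in \<open>F \<otimes> k\<close> is a cycle has zero class in \<open>Tor\<^sub>n(k, k)\<close> iff it lies
  in \<open>dF + \<mm>F\<close>. The resolution is not assumed to be minimal.\<close>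

definition inessential :: "nat \<Rightarrow> 'b set" where
  "inessential n = {h \<oplus>\<^bsub>F n\<^esub> w | h w. h \<in> d n ` carrier (F (Suc n)) \<and> w \<in> ideal_smult R \<mm> (F n)}"

lemma submodule_inessential: "submodule (inessential n) R (F n)"
  unfolding inessential_def
  by (intro F.submodule_sum F.linear_image_submodule module linear submodule_ideal_smult \<mm>.is_ideal)

lemma boundary_inessential: "x \<in> carrier (F (Suc n)) \<Longrightarrow> d n x \<in> inessential n"
  unfolding inessential_def
  by (intro CollectI exI[of _ "d n x"] exI[of _ "\<zero>\<^bsub>F n\<^esub>"]) (auto simp: ideal_smult.zero)

lemma ideal_smult_closed: "\<lbrakk>ideal J R; w \<in> ideal_smult R J (F n)\<rbrakk> \<Longrightarrow> w \<in> carrier (F n)"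
  using F.submoduleE(1)[OF submodule_ideal_smult[OF module]] by blast

lemma ideal_smult_inessential: "w \<in> ideal_smult R \<mm> (F n) \<Longrightarrow> w \<in> inessential n"
  unfolding inessential_def
  by (intro CollectI exI[of _ "\<zero>\<^bsub>F n\<^esub>"] exI[of _ w])
    (auto simp: ideal_smult_closed[OF \<mm>.is_ideal] intro: image_eqI[of _ _ "\<zero>\<^bsub>F (Suc n)\<^esub>"])

lemma inessential_iff:
  assumes "x \<in> carrier (F n)"
  shows "x \<in> inessential n \<longleftrightarrow> (\<exists>g\<in>carrier (F (Suc n)). x \<ominus>\<^bsub>F n\<^esub> d n g \<in> ideal_smult R \<mm> (F n))"
proof
  assume "x \<in> inessential n"
  then obtain g w where g: "g \<in> carrier (F (Suc n))" "w \<in> ideal_smult R \<mm> (F n)" "x = d n g \<oplus>\<^bsub>F n\<^esub> w"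
    unfolding inessential_def by blast
  moreover have "w \<in> carrier (F n)" using g(2) by (rule ideal_smult_closed[OF \<mm>.is_ideal])
  ultimately have "x \<ominus>\<^bsub>F n\<^esub> d n g = w"
    by (simp add: a_minus_def F.M.a_assoc F.M.a_comm[of w] F.M.r_neg1 F.M.r_neg2)
  with g(1,2) show "\<exists>g\<in>carrier (F (Suc n)). x \<ominus>\<^bsub>F n\<^esub> d n g \<in> ideal_smult R \<mm> (F n)" by auto
next
  assume "\<exists>g\<in>carrier (F (Suc n)). x \<ominus>\<^bsub>F n\<^esub> d n g \<in> ideal_smult R \<mm> (F n)"
  then obtain g where g: "g \<in> carrier (F (Suc n))" "x \<ominus>\<^bsub>F n\<^esub> d n g \<in> ideal_smult R \<mm> (F n)" by blast
  have "x = d n g \<oplus>\<^bsub>F n\<^esub> (x \<ominus>\<^bsub>F n\<^esub> d n g)"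
    using assms g(1) by (simp add: a_minus_def F.M.a_comm[of x] F.M.r_neg1 F.M.r_neg2)
  with g show "x \<in> inessential n" unfolding inessential_def by blast
qed

lemma inessential_0: "inessential 0 = d 0 ` carrier (F (Suc 0))"
proof
  have "submodule (d 0 ` carrier (F (Suc 0))) R (F 0)"
    by (intro F.linear_image_submodule module linear)
  then show "inessential 0 \<subseteq> d 0 ` carrier (F (Suc 0))"
    unfolding inessential_def using aug_ideal_smult F.submoduleE(5) by blast
qed (use boundary_inessential in blast)

lemma nu1_zero_inessential:
  "nu1_zero R \<mm> F d (Suc n) \<longleftrightarrow>
    (\<forall>x\<in>carrier (F (Suc n)). d n x \<in> ideal_smult R (\<mm> \<cdot> \<mm>) (F n) \<longrightarrow> x \<in> inessential (Suc n))"
  unfolding nu1_zero_iff[OF \<mm>.is_ideal] using inessential_iff by blast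

text \<open>The comparison argument with a shift by 2. In degree 0 the values on boundaries have to
  be assumed to be boundaries; in higher degrees they are cycles because
  \<open>d \<circ> d = 0\<close>, and exactness applies.\<close>

lemma chain_map_extension:
  assumes "\<theta>\<^sub>0 \<in> linear_maps R (F 2) (F 0)"
    and "\<And>y. y \<in> carrier (F 3) \<Longrightarrow> \<theta>\<^sub>0 (d 2 y) \<in> d 0 ` carrier (F 1)"
  obtains \<theta> where "\<theta> 0 = \<theta>\<^sub>0" "\<And>n. \<theta> n \<in> linear_maps R (F (Suc (Suc n))) (F n)"
    "\<And>n y. y \<in> carrier (F (Suc (Suc (Suc n)))) \<Longrightarrow> d n (\<theta> (Suc n) y) = \<theta> n (d (Suc (Suc n)) y)"
proof -
  \<comment> \<open>The clause on boundaries is what makes the next lift possible, so the recursion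
    has to carry it along.\<close>
  define P where "P n \<theta> \<longleftrightarrow> \<theta> \<in> linear_maps R (F (Suc (Suc n))) (F n)
    \<and> (\<forall>y\<in>carrier (F (Suc (Suc (Suc n)))). \<theta> (d (Suc (Suc n)) y) \<in> d n ` carrier (F (Suc n)))
    \<and> (n = 0 \<longrightarrow> \<theta> = \<theta>\<^sub>0)" for n \<theta>
  define Q where "Q n \<theta> \<theta>' \<longleftrightarrow>
    (\<forall>y\<in>carrier (F (Suc (Suc (Suc n)))). d n (\<theta>' y) = \<theta> (d (Suc (Suc n)) y))" for n \<theta> \<theta>'
  have "\<exists>\<theta>. \<forall>n. P n (\<theta> n) \<and> Q n (\<theta> n) (\<theta> (Suc n))"
  proof (rule dependent_nat_choice)
    have "P 0 \<theta>\<^sub>0" using assms by (simp add: P_def numeral_2_eq_2 numeral_3_eq_3)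
    then show "\<exists>\<theta>. P 0 \<theta>" by blast
  next
    fix \<theta> n assume "P n \<theta>"
    then have lin: "\<theta> \<in> linear_maps R (F (Suc (Suc n))) (F n)"
      and bd: "\<And>y. y \<in> carrier (F (Suc (Suc (Suc n)))) \<Longrightarrow> \<theta> (d (Suc (Suc n)) y) \<in> d n ` carrier (F (Suc n))"
      by (auto simp: P_def)
    have "(\<lambda>y. \<theta> (d (Suc (Suc n)) y)) ` carrier (F (Suc (Suc (Suc n)))) \<subseteq> d n ` carrier (F (Suc n))"
      using bd by blast
    then obtain \<theta>' where \<theta>': "\<theta>' \<in> linear_maps R (F (Suc (Suc (Suc n)))) (F (Suc n))"
      "\<And>y. y \<in> carrier (F (Suc (Suc (Suc n)))) \<Longrightarrow> d n (\<theta>' y) = \<theta> (d (Suc (Suc n)) y)"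
      using linear_lift[OF free module module linear_maps_comp[OF linear lin] linear] by metis
    have "\<theta>' (d (Suc (Suc (Suc n))) y) \<in> d (Suc n) ` carrier (F (Suc (Suc n)))"
      if "y \<in> carrier (F (Suc (Suc (Suc (Suc n)))))" for y
      using that by (intro exactD)
        (auto simp: \<theta>'(2) linear_maps_zero[OF module module lin] linear_mapsD(1)[OF \<theta>'(1)])
    then have "P (Suc n) \<theta>'" "Q n \<theta> \<theta>'" using \<theta>' by (auto simp: P_def Q_def)
    then show "\<exists>\<theta>'. P (Suc n) \<theta>' \<and> Q n \<theta> \<theta>'" by blast
  qed
  then obtain \<theta> where "\<And>n. P n (\<theta> n) \<and> Q n (\<theta> n) (\<theta> (Suc n))" by blast
  then show ?thesis by (intro that[of \<theta>]) (auto simp: P_def Q_def)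
qed

lemma chain_map_inessential:
  assumes "\<And>n. \<theta> n \<in> linear_maps R (F (Suc (Suc n))) (F n)"
    and "\<And>n y. y \<in> carrier (F (Suc (Suc (Suc n)))) \<Longrightarrow> d n (\<theta> (Suc n) y) = \<theta> n (d (Suc (Suc n)) y)"
    and "w \<in> inessential (Suc (Suc n))"
  shows "\<theta> n w \<in> inessential n"
proof -
  obtain g v where g: "g \<in> carrier (F (Suc (Suc (Suc n))))" "v \<in> ideal_smult R \<mm> (F (Suc (Suc n)))"
    "w = d (Suc (Suc n)) g \<oplus>\<^bsub>F (Suc (Suc n))\<^esub> v"
    using assms(3) unfolding inessential_def by blast
  then have "\<theta> n w = d n (\<theta> (Suc n) g) \<oplus>\<^bsub>F n\<^esub> \<theta> n v"
    by (simp add: linear_mapsD(2)[OF assms(1)] ideal_smult_closed[OF \<mm>.is_ideal] assms(2))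
  moreover have "\<theta> n v \<in> ideal_smult R \<mm> (F n)"
    by (rule linear_maps_ideal_smult[OF module module \<mm>.is_ideal assms(1) g(2)])
  ultimately show ?thesis
    using g linear_mapsD(1)[OF assms(1)] unfolding inessential_def by blast
qed

end

text \<open>A Clifford family is a chain map \<open>G \<rightarrow> F\<close>, given on the bases, where \<open>G\<close> is the Koszul complex on
  \<open>x\<close> with a divided power variable \<open>T\<close> of degree 2 and \<open>dT = z\<close> adjoined. In degree \<open>n\<close>, the basis
  element \<open>e\<^sub>A T\<^sup>(\<^sup>j\<^sup>)\<close> with \<open>j = (n - |A|)/2\<close> is represented by \<open>A\<close> alone, so that the derivation
  \<open>\<partial>/\<partial>T\<close> becomes the identity on indices.\<close>

locale clifford_resolution = residue_resolution R \<mm> F d \<epsilon> + clifford_data R e x z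
  for R :: "('a, 'c) ring_scheme" (structure) and \<mm> :: "'a set"
    and F :: "nat \<Rightarrow> ('a, 'b) module" and d :: "nat \<Rightarrow> 'b \<Rightarrow> 'b" and \<epsilon> :: "'b \<Rightarrow> 'a set"
    and e :: nat and x z :: "nat \<Rightarrow> 'a" +
  assumes x_in: "x k \<in> \<mm>" and z_in: "z k \<in> \<mm>"
begin

abbreviation "clif n \<equiv> clifford R (F n) e x z"

lemma clif_closed: "(\<And>A. v A \<in> carrier (F n)) \<Longrightarrow> clif n v A \<in> carrier (F n)"
  by (rule clifford_closed[OF module])

lemma clif_cong: "(\<And>k. v (flip k A) = w (flip k A)) \<Longrightarrow> clif n v A = clif n w A"
  by (simp add: clifford_def)

lemma d_clif: "(\<And>A. v A \<in> carrier (F (Suc n))) \<Longrightarrow> d n (clif (Suc n) v A) = clif n (\<lambda>A. d n (v A)) A"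
  by (rule linear_clifford[OF module module linear])

lemma clif_ideal_smult: "(\<And>A. v A \<in> carrier (F n)) \<Longrightarrow> clif n v A \<in> ideal_smult R \<mm> (F n)"
  by (rule clifford_ideal_smult[OF module \<mm>.is_ideal _ x_in z_in])

text \<open>Exactly the \<open>A\<close> for which \<open>e_A\<close> times a divided power of
  \<open>T\<close> occurs in degree \<open>n\<close>: the exponent \<open>(n - card A) / 2\<close>
  has to be a natural number.\<close>

definition supported :: "nat \<Rightarrow> nat set \<Rightarrow> bool" where
  "supported n A \<longleftrightarrow> A \<subseteq> {..<e} \<and> card A \<le> n \<and> even (card A + n)"

text \<open>Vanishing off the support makes the boundary formula correct where the exponent of
  \<open>T\<close> is 0: the terms with \<open>z\<close> then refer to sets too large for degree
  \<open>n\<close>, and drop out. Finiteness of \<open>A\<close> keeps cardinalities and signs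
  meaningful.\<close>

definition clifford_family :: "'b \<Rightarrow> (nat \<Rightarrow> nat set \<Rightarrow> 'b) \<Rightarrow> bool" where
  "clifford_family u\<^sub>0 u \<longleftrightarrow>
    (\<forall>n A. u n A \<in> carrier (F n)) \<and> u 0 {} = u\<^sub>0 \<and>
    (\<forall>n A. \<not> supported n A \<longrightarrow> u n A = \<zero>\<^bsub>F n\<^esub>) \<and>
    (\<forall>n A. finite A \<longrightarrow> d n (u (Suc n) A) = clif n (u n) A)"

lemma clifford_family_exists:
  assumes "u\<^sub>0 \<in> carrier (F 0)"
  obtains u where "clifford_family u\<^sub>0 u"
proof -
  \<comment> \<open>Besides the values, \<open>P\<close> records that the next right-hand side is a
    boundary: in degree 0 because the coefficients lie in \<open>\<mm>\<close>, afterwards because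
    the Clifford operator has square zero.\<close>
  define P where "P n v \<longleftrightarrow> (\<forall>A. v A \<in> carrier (F n)) \<and> (\<forall>A. \<not> supported n A \<longrightarrow> v A = \<zero>\<^bsub>F n\<^esub>)
    \<and> (\<forall>A. finite A \<longrightarrow> clif n v A \<in> d n ` carrier (F (Suc n))) \<and> (n = 0 \<longrightarrow> v {} = u\<^sub>0)" for n and v :: "nat set \<Rightarrow> 'b"
  define Q where "Q n v w \<longleftrightarrow> (\<forall>A. finite A \<longrightarrow> d n (w A) = clif n v A)" for n and v w :: "nat set \<Rightarrow> 'b"
  have "\<exists>u. \<forall>n. P n (u n) \<and> Q n (u n) (u (Suc n))"
  proof (rule dependent_nat_choice)
    let ?v = "\<lambda>A :: nat set. if A = {} then u\<^sub>0 else \<zero>\<^bsub>F 0\<^esub>"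
    have "clif 0 ?v A \<in> d 0 ` carrier (F (Suc 0))" for A
      using assms by (intro aug_ideal_smult clif_ideal_smult) auto
    then have "P 0 ?v" using assms by (auto simp: P_def supported_def)
    then show "\<exists>v. P 0 v" by (intro exI[of _ ?v])
  next
    fix v n assume "P n v"
    then have v: "\<And>A. v A \<in> carrier (F n)" "\<And>A. \<not> supported n A \<Longrightarrow> v A = \<zero>\<^bsub>F n\<^esub>"
      "\<And>A. finite A \<Longrightarrow> clif n v A \<in> d n ` carrier (F (Suc n))"
      by (auto simp: P_def)
    define w where "w A = (if supported (Suc n) A then SOME y. y \<in> carrier (F (Suc n)) \<and> d n y = clif n v A
      else \<zero>\<^bsub>F (Suc n)\<^esub>)" for A
    have some: "w A \<in> carrier (F (Suc n)) \<and> d n (w A) = clif n v A" if "supported (Suc n) A" for A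
    proof -
      have ex: "\<exists>y. y \<in> carrier (F (Suc n)) \<and> d n y = clif n v A"
        using v(3)[of A] that finite_subset[of A "{..<e}"] by (auto simp: supported_def)
      show ?thesis using someI_ex[OF ex] that by (simp add: w_def)
    qed
    have wc: "w A \<in> carrier (F (Suc n))" for A using some[of A] by (cases "supported (Suc n) A") (auto simp: w_def)
    have dw: "d n (w A) = clif n v A" if A: "finite A" for A
    proof (cases "supported (Suc n) A")
      case True
      then show ?thesis using some by blast
    next
      case False
      \<comment> \<open>A flip changes the cardinality by one, so if \<open>flip k A\<close> were
        supported in degree \<open>n\<close>, then \<open>A\<close> would be in degree
        \<open>Suc n\<close>. Hence the prescribed boundary is zero and the default value of
        \<open>w\<close> is a lift of it.\<close>
      have "\<not> supported n (flip k A)" if "k < e" for k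
      proof
        assume s: "supported n (flip k A)"
        have "card A \<le> card (flip k A) + 1" using A by (auto simp: card_flip)
        then have "supported (Suc n) A"
          using s that even_card_flip[OF A, of k] by (auto simp: supported_def flip_def split: if_splits)
        with False show False ..
      qed
      then have "clif n v A = \<zero>\<^bsub>F n\<^esub>"
        unfolding clifford_def by (intro F.M.add.finprod_one_eqI) (simp add: v(2))
      with False show ?thesis by (simp add: w_def)
    qed
    have "clif (Suc n) w A \<in> d (Suc n) ` carrier (F (Suc (Suc n)))" if A: "finite A" for A
    proof (rule exactD)
      show "clif (Suc n) w A \<in> carrier (F (Suc n))" by (rule clif_closed[OF wc])
      have "d n (clif (Suc n) w A) = clif n (clif n v) A"
        unfolding d_clif[OF wc] using A by (intro clif_cong dw) simp
      then show "d n (clif (Suc n) w A) = \<zero>\<^bsub>F n\<^esub>"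
        using clifford_clifford[OF module v(1) A] by simp
    qed
    then have "P (Suc n) w" "Q n v w"
      using wc dw by (auto simp: P_def Q_def w_def)
    then show "\<exists>w. P (Suc n) w \<and> Q n v w" by blast
  qed
  then obtain u where "\<And>n. P n (u n) \<and> Q n (u n) (u (Suc n))" by blast
  then have "clifford_family u\<^sub>0 u" unfolding clifford_family_def by (auto simp: P_def Q_def)
  then show ?thesis by (rule that)
qed

text \<open>A chain map out of \<open>K<T>\<close> whose values in degree 0 are boundaries is
  null-homotopic. One term of the homotopy formula is a boundary, the other has coefficients in
  \<open>\<mm>\<close>.\<close>

lemma clifford_homotopy:
  assumes closed: "\<And>n A. \<psi> n A \<in> carrier (F n)"
    and step: "\<And>n A. finite A \<Longrightarrow> d n (\<psi> (Suc n) A) = clif n (\<psi> n) A"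
    and base: "\<And>A. \<psi> 0 A \<in> d 0 ` carrier (F (Suc 0))"
  shows "finite A \<Longrightarrow> \<psi> n A \<in> inessential n"
proof -
  \<comment> \<open>\<open>h'\<close> is the homotopy one degree lower, zero at the start. Two
    consecutive degrees suffice: the \<open>h\<close> of one step is the \<open>h'\<close> of the
    next, and the obstruction to the next lift is the Clifford operator applied twice to
    \<open>h'\<close>.\<close>
  have "\<exists>h h'. (\<forall>A. h A \<in> carrier (F (Suc n))) \<and> (\<forall>A. h' A \<in> carrier (F n)) \<and>
      (\<forall>A. finite A \<longrightarrow> \<psi> n A = d n (h A) \<oplus>\<^bsub>F n\<^esub> clif n h' A)" for n
  proof (induction n)
    case 0
    have "\<forall>A. \<exists>h. h \<in> carrier (F (Suc 0)) \<and> \<psi> 0 A = d 0 h" using base by blast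
    then obtain h where h: "\<And>A. h A \<in> carrier (F (Suc 0))" "\<And>A. \<psi> 0 A = d 0 (h A)" by metis
    have "clif 0 (\<lambda>_. \<zero>\<^bsub>F 0\<^esub>) A = \<zero>\<^bsub>F 0\<^esub>" for A
      unfolding clifford_def by (intro F.M.add.finprod_one_eqI) simp
    then show ?case using h by (intro exI[of _ h] exI[of _ "\<lambda>_. \<zero>\<^bsub>F 0\<^esub>"]) auto
  next
    case (Suc n)
    then obtain h h' where h: "\<And>A. h A \<in> carrier (F (Suc n))" and h': "\<And>A. h' A \<in> carrier (F n)"
      and eq: "\<And>A. finite A \<Longrightarrow> \<psi> n A = d n (h A) \<oplus>\<^bsub>F n\<^esub> clif n h' A" by blast
    have "\<exists>g. g \<in> carrier (F (Suc (Suc n))) \<and> (finite A \<longrightarrow> \<psi> (Suc n) A = d (Suc n) g \<oplus>\<^bsub>F (Suc n)\<^esub> clif (Suc n) h A)" for A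
    proof (cases "finite A")
      case True
      let ?y = "\<psi> (Suc n) A \<ominus>\<^bsub>F (Suc n)\<^esub> clif (Suc n) h A"
      have c: "clif (Suc n) h A \<in> carrier (F (Suc n))" by (rule clif_closed[OF h])
      have "d n ?y = clif n (\<psi> n) A \<ominus>\<^bsub>F n\<^esub> clif n (\<lambda>A. d n (h A)) A"
        using c closed True by (simp add: d_minus step d_clif h)
      also have "\<dots> = clif n (\<lambda>A. \<psi> n A \<ominus>\<^bsub>F n\<^esub> d n (h A)) A"
        using closed h by (subst clifford_minus[OF module]) auto
      also have "\<dots> = clif n (clif n h') A"
      proof (rule clif_cong)
        fix k
        let ?B = "flip k A"
        have "clif n h' ?B \<in> carrier (F n)" by (rule clif_closed[OF h'])
        then show "\<psi> n ?B \<ominus>\<^bsub>F n\<^esub> d n (h ?B) = clif n h' ?B"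
          using h True by (simp add: eq a_minus_def F.M.a_comm[of "d n (h ?B)"] F.M.a_assoc F.M.r_neg)
      qed
      also have "\<dots> = \<zero>\<^bsub>F n\<^esub>" by (rule clifford_clifford[OF module h' True])
      finally have "?y \<in> d (Suc n) ` carrier (F (Suc (Suc n)))"
        using closed c by (intro exactD) auto
      then obtain g where g: "g \<in> carrier (F (Suc (Suc n)))" "?y = d (Suc n) g" by blast
      have "\<psi> (Suc n) A = ?y \<oplus>\<^bsub>F (Suc n)\<^esub> clif (Suc n) h A"
        using c closed by (simp add: a_minus_def F.M.a_assoc F.M.l_neg)
      then show ?thesis using g by metis
    next
      case False
      then show ?thesis using F.M.zero_closed by blast
    qed
    then obtain g where "\<And>A. g A \<in> carrier (F (Suc (Suc n))) \<and>
        (finite A \<longrightarrow> \<psi> (Suc n) A = d (Suc n) (g A) \<oplus>\<^bsub>F (Suc n)\<^esub> clif (Suc n) h A)" by metis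
    with h show ?case by blast
  qed
  then obtain h h' where h: "\<forall>A. h A \<in> carrier (F (Suc n))" "\<forall>A. h' A \<in> carrier (F n)"
    "\<forall>A. finite A \<longrightarrow> \<psi> n A = d n (h A) \<oplus>\<^bsub>F n\<^esub> clif n h' A" by blast
  have "clif n h' A \<in> ideal_smult R \<mm> (F n)" using h(2) by (intro clif_ideal_smult) auto
  with h show "finite A \<Longrightarrow> \<psi> n A \<in> inessential n"
    unfolding inessential_def by blast
qed

text \<open>A descent in steps of 2: up to inessential elements the chain map extending
  \<open>\<theta>\<^sub>0\<close> carries \<open>u (2 * n + 2) {}\<close> to
  \<open>u (2 * n) {}\<close>, and it preserves inessential elements. So an inessential start forces
  an inessential \<open>u\<^sub>0\<close>.\<close>

lemma clifford_family_essential: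
  assumes u: "clifford_family u\<^sub>0 u"
    and \<theta>\<^sub>0: "\<theta>\<^sub>0 \<in> linear_maps R (F 2) (F 0)"
      "\<And>y. y \<in> carrier (F 3) \<Longrightarrow> \<theta>\<^sub>0 (d 2 y) \<in> d 0 ` carrier (F 1)"
    and base: "\<And>A. \<theta>\<^sub>0 (u 2 A) \<ominus>\<^bsub>F 0\<^esub> u 0 A \<in> d 0 ` carrier (F 1)"
    and "u (2 * n) {} \<in> inessential (2 * n)"
  shows "u\<^sub>0 \<in> d 0 ` carrier (F 1)"
proof -
  have uc: "u n A \<in> carrier (F n)" and du: "finite A \<Longrightarrow> d n (u (Suc n) A) = clif n (u n) A" for n A
    using u by (auto simp: clifford_family_def)
  obtain \<theta> where \<theta>: "\<theta> 0 = \<theta>\<^sub>0" "\<And>n. \<theta> n \<in> linear_maps R (F (Suc (Suc n))) (F n)"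
    "\<And>n y. y \<in> carrier (F (Suc (Suc (Suc n)))) \<Longrightarrow> d n (\<theta> (Suc n) y) = \<theta> n (d (Suc (Suc n)) y)"
    using chain_map_extension[OF \<theta>\<^sub>0] by metis
  have \<theta>c: "\<theta> n (u (Suc (Suc n)) A) \<in> carrier (F n)" for n A
    using linear_mapsD(1)[OF \<theta>(2)] uc by blast
  \<comment> \<open>The subtrahend is the family composed with
    \<open>\<partial>/\<partial>T\<close>, which keeps \<open>A\<close> and lowers the degree by 2.
    Both terms are chain maps out of \<open>K<T>\<close>, hence so is the difference.\<close>
  define \<psi> where "\<psi> n A = \<theta> n (u (Suc (Suc n)) A) \<ominus>\<^bsub>F n\<^esub> u n A" for n A
  have \<psi>: "\<psi> n A \<in> inessential n" if "finite A" for n A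
  proof (rule clifford_homotopy[OF _ _ _ that])
    show "\<psi> n A \<in> carrier (F n)" for n A using \<theta>c uc by (simp add: \<psi>_def)
    show "d n (\<psi> (Suc n) A) = clif n (\<psi> n) A" if A: "finite A" for n A
    proof -
      have "d n (\<psi> (Suc n) A) = \<theta> n (clif (Suc (Suc n)) (u (Suc (Suc n))) A) \<ominus>\<^bsub>F n\<^esub> clif n (u n) A"
        using \<theta>c uc A by (simp add: \<psi>_def d_minus \<theta>(3) du)
      also have "\<dots> = clif n (\<lambda>A. \<theta> n (u (Suc (Suc n)) A)) A \<ominus>\<^bsub>F n\<^esub> clif n (u n) A"
        by (simp add: linear_clifford[OF module module \<theta>(2) uc])
      also have "\<dots> = clif n (\<psi> n) A"
        unfolding \<psi>_def using \<theta>c uc by (subst clifford_minus[OF module]) auto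
      finally show ?thesis .
    qed
    show "\<psi> 0 A \<in> d 0 ` carrier (F (Suc 0))" for A
      using base[of A] by (simp add: \<psi>_def \<theta>(1) numeral_2_eq_2)
  qed
  have "u (2 * n) {} \<in> inessential (2 * n) \<Longrightarrow> u 0 {} \<in> inessential 0"
  proof (induction n)
    case (Suc n)
    let ?m = "2 * n"
    have "\<theta> ?m (u (Suc (Suc ?m)) {}) \<in> inessential ?m"
      using Suc.prems by (intro chain_map_inessential[of \<theta>, OF \<theta>(2,3)]) auto
    then have "\<theta> ?m (u (Suc (Suc ?m)) {}) \<ominus>\<^bsub>F ?m\<^esub> \<psi> ?m {} \<in> inessential ?m"
      using \<psi> by (intro F.submodule_minus submodule_inessential) auto
    moreover have "\<theta> ?m (u (Suc (Suc ?m)) {}) \<ominus>\<^bsub>F ?m\<^esub> \<psi> ?m {} = u ?m {}"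
      using \<theta>c uc by (simp add: \<psi>_def a_minus_def F.M.minus_add F.M.r_neg1 F.M.r_neg2)
    ultimately show ?case using Suc.IH by simp
  qed auto
  then show ?thesis
    using assms(5) u by (simp add: clifford_family_def inessential_0)
qed

end

subsection \<open>A functional on the second Tor\<close>

lemma (in module) finsum_congruent:
  assumes "submodule H R M" "finite A" "f \<in> A \<rightarrow> carrier M" "g \<in> A \<rightarrow> carrier M"
    and "\<And>a. a \<in> A \<Longrightarrow> f a \<ominus>\<^bsub>M\<^esub> g a \<in> H"
  shows "(\<Oplus>\<^bsub>M\<^esub>a\<in>A. f a) \<ominus>\<^bsub>M\<^esub> (\<Oplus>\<^bsub>M\<^esub>a\<in>A. g a) \<in> H"
  using assms(2-5)
proof (induction A rule: finite_induct)
  case empty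
  then show ?case using submodule_zero[OF assms(1)] by (simp add: M.diff_zero)
next
  case (insert a A)
  then have c: "f a \<in> carrier M" "g a \<in> carrier M" "f \<in> A \<rightarrow> carrier M" "g \<in> A \<rightarrow> carrier M"
    "finsum M f A \<in> carrier M" "finsum M g A \<in> carrier M" by auto
  have "finsum M f (insert a A) \<ominus>\<^bsub>M\<^esub> finsum M g (insert a A)
      = (f a \<ominus>\<^bsub>M\<^esub> g a) \<oplus>\<^bsub>M\<^esub> (finsum M f A \<ominus>\<^bsub>M\<^esub> finsum M g A)"
    using c insert(1,2) by (simp add: a_minus_def M.minus_add M.a_ac)
  moreover have "finsum M f A \<ominus>\<^bsub>M\<^esub> finsum M g A \<in> H" "f a \<ominus>\<^bsub>M\<^esub> g a \<in> H"
    using insert c by auto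
  ultimately show ?case using submoduleE(5)[OF assms(1)] by simp
qed

lemma (in cring) ideal_finsum_congruent:
  assumes "ideal I R" "finite A" "f \<in> A \<rightarrow> carrier R" "g \<in> A \<rightarrow> carrier R"
    and "\<And>a. a \<in> A \<Longrightarrow> f a \<ominus> g a \<in> I"
  shows "(\<Oplus>a\<in>A. f a) \<ominus> (\<Oplus>a\<in>A. g a) \<in> I"
proof -
  interpret m: module R "regular_module R" by (rule module_regular_module[OF is_cring])
  have c: "f a \<in> carrier R" "g a \<in> carrier R" if "a \<in> A" for a using assms(3,4) that by auto
  then have "(\<Oplus>\<^bsub>regular_module R\<^esub>a\<in>A. f a) \<ominus>\<^bsub>regular_module R\<^esub> (\<Oplus>\<^bsub>regular_module R\<^esub>a\<in>A. g a) \<in> I"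
    using assms
    by (intro m.finsum_congruent submodule_regular_module is_cring)
      (auto simp: regular_module_simps regular_module_minus[OF is_cring])
  then show ?thesis
    using c by (simp add: finsum_regular_module regular_module_minus[OF is_cring])
qed

lemma (in cring) ideal_finsum_closed:
  assumes "ideal I R" "finite A" "f \<in> A \<rightarrow> I"
  shows "(\<Oplus>a\<in>A. f a) \<in> I"
proof -
  interpret m: module R "regular_module R" by (rule module_regular_module[OF is_cring])
  show ?thesis
    using m.finsum_in_submodule[OF submodule_regular_module[OF is_cring assms(1)] assms(2,3)]
    by (simp add: finsum_regular_module)
qed

section \<open>Linear algebra over the residue field\<close>

context noetherian_local
begin

text \<open>As \<open>\<mm>M\<close> lies in \<open>H\<close>, the quotient \<open>M/H\<close> is a
  vector space over the residue field. By maximality each of its nonzero subspaces contains the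
  class of \<open>v\<close>, so that class spans it.\<close>

lemma maximal_submodule_hyperplane:
  assumes "module R M" "submodule H R M" "v \<notin> H" "v \<in> carrier M"
    and max: "\<And>K. \<lbrakk>submodule K R M; H \<subset> K\<rbrakk> \<Longrightarrow> v \<in> K"
    and \<mm>H: "\<And>w. w \<in> ideal_smult R \<mm> M \<Longrightarrow> w \<in> H"
    and y: "y \<in> carrier M"
  shows "\<exists>a\<in>carrier R. y \<ominus>\<^bsub>M\<^esub> a \<odot>\<^bsub>M\<^esub> v \<in> H"
proof (cases "y \<in> H")
  case True
  interpret M: module R M by fact
  show ?thesis using True y assms(4) by (intro bexI[of _ \<zero>]) (auto simp: M.M.diff_zero)
next
  case False
  interpret M: module R M by fact
  note H = M.submoduleE[OF assms(2)]
  let ?Y = "(\<lambda>a. a \<odot>\<^bsub>M\<^esub> y) ` carrier R"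
  have "submodule ?Y R M"
    using M.linear_image_submodule[OF regular.module_axioms smult_right_linear[OF assms(1) y]]
    by (simp add: regular_module_simps)
  then have K: "submodule {h \<oplus>\<^bsub>M\<^esub> k | h k. h \<in> H \<and> k \<in> ?Y} R M" (is "submodule ?K R M")
    by (rule M.submodule_sum[OF assms(2)])
  have "H \<subseteq> ?K"
  proof
    fix h assume "h \<in> H"
    then have "h = h \<oplus>\<^bsub>M\<^esub> \<zero> \<odot>\<^bsub>M\<^esub> y" using H(1) y by auto
    with \<open>h \<in> H\<close> show "h \<in> ?K" by blast
  qed
  moreover have "y \<in> ?K"
  proof -
    have "y = \<zero>\<^bsub>M\<^esub> \<oplus>\<^bsub>M\<^esub> \<one> \<odot>\<^bsub>M\<^esub> y" using y by simp
    then show ?thesis using M.submodule_zero[OF assms(2)] by blast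
  qed
  ultimately have "v \<in> ?K" using False by (intro max K) blast
  then obtain h a where h: "h \<in> H" "a \<in> carrier R" "v = h \<oplus>\<^bsub>M\<^esub> a \<odot>\<^bsub>M\<^esub> y" by blast
  have hc: "h \<in> carrier M" using h(1) H(1) by blast
  have "a \<notin> \<mm>"
  proof
    assume "a \<in> \<mm>"
    then have "a \<odot>\<^bsub>M\<^esub> y \<in> H" using y by (intro \<mm>H ideal_smult.smult)
    then show False using h assms(3) H(5) by blast
  qed
  then obtain b where b: "b \<in> carrier R" "b \<otimes> a = \<one>" using unit h(2) by blast
  have "b \<odot>\<^bsub>M\<^esub> v = b \<odot>\<^bsub>M\<^esub> h \<oplus>\<^bsub>M\<^esub> y"
    using b h(2) hc y by (simp add: h(3) M.smult_r_distr M.smult_assoc1[symmetric])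
  then have "y \<ominus>\<^bsub>M\<^esub> b \<odot>\<^bsub>M\<^esub> v = \<ominus>\<^bsub>M\<^esub> (b \<odot>\<^bsub>M\<^esub> h)"
    using b hc y by (simp add: a_minus_def M.M.minus_add M.M.a_comm[of "\<ominus>\<^bsub>M\<^esub> (b \<odot>\<^bsub>M\<^esub> h)"] M.M.r_neg1 M.M.r_neg2)
  then show ?thesis using b(1) h(1) H(3,4) by (intro bexI[of _ b]) auto
qed

text \<open>In each product one factor is expanded in the generators and the other is absorbed into
  the coefficients.\<close>

lemma ideal_square_combination:
  assumes gen: "\<And>a. a \<in> \<mm> \<Longrightarrow> \<exists>c\<in>{..<e} \<rightarrow> carrier R. a = (\<Oplus>k\<in>{..<e}. c k \<otimes> x k)"
    and x: "\<And>k. x k \<in> carrier R" and w: "w \<in> \<mm> \<cdot> \<mm>"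
  shows "\<exists>c\<in>{..<e::nat} \<rightarrow> \<mm>. w = (\<Oplus>k\<in>{..<e}. c k \<otimes> x k)"
  using w
proof induction
  case (prod i j)
  obtain c where c: "c \<in> {..<e} \<rightarrow> carrier R" "j = (\<Oplus>k\<in>{..<e}. c k \<otimes> x k)" using gen prod by blast
  have "i \<otimes> j = (\<Oplus>k\<in>{..<e}. i \<otimes> (c k \<otimes> x k))"
    unfolding c(2) using c(1) x prod \<mm>.Icarr by (intro finsum_rdistr) auto
  also have "\<dots> = (\<Oplus>k\<in>{..<e}. (i \<otimes> c k) \<otimes> x k)"
    using c(1) x prod \<mm>.Icarr by (intro finsum_cong') (auto simp: m_assoc Pi_iff)
  finally show ?case
    using c(1) prod by (intro bexI[of _ "\<lambda>k. i \<otimes> c k"]) (auto intro: \<mm>.I_r_closed)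
next
  case (sum a b)
  then obtain c c' where c: "c \<in> {..<e} \<rightarrow> \<mm>" "a = (\<Oplus>k\<in>{..<e}. c k \<otimes> x k)"
    and c': "c' \<in> {..<e} \<rightarrow> \<mm>" "b = (\<Oplus>k\<in>{..<e}. c' k \<otimes> x k)" by blast
  have cc: "c k \<in> carrier R" "c' k \<in> carrier R" if "k < e" for k
    using c(1) c'(1) that by (auto intro!: \<mm>.Icarr)
  have "a \<oplus> b = (\<Oplus>k\<in>{..<e}. c k \<otimes> x k \<oplus> c' k \<otimes> x k)"
    unfolding c(2) c'(2) using cc x by (intro finsum_addf[symmetric]) auto
  also have "\<dots> = (\<Oplus>k\<in>{..<e}. (c k \<oplus> c' k) \<otimes> x k)"
    using cc x by (intro finsum_cong') (auto simp: l_distr)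
  finally show ?case
    using c(1) c'(1) by (intro bexI[of _ "\<lambda>k. c k \<oplus> c' k"]) auto
qed

end

section \<open>Degrees 0 and 1 of a resolution that need not be minimal\<close>

context residue_resolution
begin

lemma module_regular: "module R (regular_module R)" by unfold_locales

text \<open>By freeness the augmentation lifts to a functional \<open>r\<close>, and
  \<open>u\<^sub>0\<close> is normalised by it. The pair replaces the isomorphism of
  \<open>F 0\<close> with \<open>R\<close> that a minimal resolution would offer: up to boundaries,
  \<open>F 0\<close> is spanned by \<open>u\<^sub>0\<close>.\<close>

lemma augmentation_lift:
  obtains r u\<^sub>0 where "r \<in> linear_maps R (F 0) (regular_module R)" "u\<^sub>0 \<in> carrier (F 0)" "r u\<^sub>0 = \<one>"
    "\<And>v. v \<in> carrier (F 0) \<Longrightarrow> v \<ominus>\<^bsub>F 0\<^esub> r v \<odot>\<^bsub>F 0\<^esub> u\<^sub>0 \<in> d 0 ` carrier (F (Suc 0))"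
    "\<And>v. v \<in> d 0 ` carrier (F (Suc 0)) \<Longrightarrow> r v \<in> \<mm>"
proof -
  let ?k = "residue_module R \<mm>"
  interpret k: module R ?k by (rule module_k)
  note k_simps = residue_module_add[OF is_cring \<mm>.is_ideal] residue_module_smult[OF is_cring \<mm>.is_ideal]
  have "\<epsilon> ` carrier (F 0) \<subseteq> residue R \<mm> ` carrier (regular_module R)"
    by (simp add: aug_surj residue_carrier regular_module_simps)
  then obtain r where r: "r \<in> linear_maps R (F 0) (regular_module R)"
    and \<epsilon>r: "\<And>v. v \<in> carrier (F 0) \<Longrightarrow> \<epsilon> v = residue R \<mm> (r v)"
    using linear_lift[OF free module_regular module_k aug residue_linear[OF is_cring \<mm>.is_ideal]] by metis
  have rc: "r v \<in> carrier R" if "v \<in> carrier (F 0)" for v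
    using linear_mapsD(1)[OF r that] by (simp add: regular_module_simps)
  obtain w where w: "w \<in> carrier (F 0)" "\<epsilon> w = residue R \<mm> \<one>"
    using aug_surj by (metis imageE image_eqI one_closed residue_carrier)
  have "r w \<notin> \<mm>"
  proof
    assume "r w \<in> \<mm>"
    moreover have "r w \<ominus> \<one> \<in> \<mm>"
      using \<epsilon>r[OF w(1)] w rc residue_eq_iff[OF is_cring \<mm>.is_ideal, of "r w" \<one>] by simp
    ultimately have "r w \<ominus> (r w \<ominus> \<one>) \<in> \<mm>"
      by (simp add: a_minus_def)
    moreover have "r w \<ominus> (r w \<ominus> \<one>) = \<one>"
      using rc[OF w(1)] by (simp add: a_minus_def minus_add r_neg1 r_neg2)
    ultimately show False using one_notin by simp
  qed
  then obtain b where b: "b \<in> carrier R" "b \<otimes> r w = \<one>" using unit rc[OF w(1)] by blast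
  define u\<^sub>0 where "u\<^sub>0 = b \<odot>\<^bsub>F 0\<^esub> w"
  have u\<^sub>0: "u\<^sub>0 \<in> carrier (F 0)" "r u\<^sub>0 = \<one>"
    using b w(1) linear_mapsD(3)[OF r b(1) w(1)] by (auto simp: u\<^sub>0_def regular_module_simps)
  show ?thesis
  proof (rule that[OF r u\<^sub>0])
    show "v \<ominus>\<^bsub>F 0\<^esub> r v \<odot>\<^bsub>F 0\<^esub> u\<^sub>0 \<in> d 0 ` carrier (F (Suc 0))" if v: "v \<in> carrier (F 0)" for v
    proof -
      have "\<epsilon> (v \<ominus>\<^bsub>F 0\<^esub> r v \<odot>\<^bsub>F 0\<^esub> u\<^sub>0) = \<epsilon> v \<ominus>\<^bsub>?k\<^esub> r v \<odot>\<^bsub>?k\<^esub> \<epsilon> u\<^sub>0"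
        using v u\<^sub>0 rc by (simp add: linear_maps_minus[OF module module_k aug] linear_mapsD(3)[OF aug])
      also have "\<dots> = \<epsilon> v \<ominus>\<^bsub>?k\<^esub> \<epsilon> v"
        using \<epsilon>r[OF v] rc[OF v] \<epsilon>r[OF u\<^sub>0(1)] u\<^sub>0(2) by (simp add: k_simps)
      also have "\<dots> = \<zero>\<^bsub>?k\<^esub>"
        using linear_mapsD(1)[OF aug v] by (simp add: a_minus_def k.M.r_neg)
      finally have "v \<ominus>\<^bsub>F 0\<^esub> r v \<odot>\<^bsub>F 0\<^esub> u\<^sub>0 \<in> {v \<in> carrier (F 0). \<epsilon> v = \<zero>\<^bsub>?k\<^esub>}"
        using v u\<^sub>0 rc by simp
      then show ?thesis unfolding aug_exact .
    qed
    show "r v \<in> \<mm>" if "v \<in> d 0 ` carrier (F (Suc 0))" for v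
    proof -
      have v: "v \<in> carrier (F 0)" "\<epsilon> v = residue R \<mm> \<zero>"
        using that residue_module_zero[OF is_cring \<mm>.is_ideal] unfolding aug_exact[symmetric] by auto
      then have "r v \<ominus> \<zero> \<in> \<mm>"
        using \<epsilon>r[OF v(1)] rc[OF v(1)] residue_eq_iff[OF is_cring \<mm>.is_ideal, of "r v" \<zero>] by simp
      then show ?thesis using rc[OF v(1)] by (simp add: diff_zero)
    qed
  qed
qed

end

locale augmented_resolution = residue_resolution R \<mm> F d \<epsilon>
  for R :: "('a, 'c) ring_scheme" (structure) and \<mm> :: "'a set"
    and F :: "nat \<Rightarrow> ('a, 'b) module" and d :: "nat \<Rightarrow> 'b \<Rightarrow> 'b" and \<epsilon> :: "'b \<Rightarrow> 'a set" +
  fixes e :: nat and x :: "nat \<Rightarrow> 'a" and r :: "'b \<Rightarrow> 'a" and u\<^sub>0 :: 'b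
  assumes gen_in: "x k \<in> \<mm>"
    and gen: "a \<in> \<mm> \<Longrightarrow> \<exists>c\<in>{..<e} \<rightarrow> carrier R. a = (\<Oplus>k\<in>{..<e}. c k \<otimes> x k)"
    and indep: "\<lbrakk>c \<in> {..<e} \<rightarrow> carrier R; (\<Oplus>k\<in>{..<e}. c k \<otimes> x k) = \<zero>; k < e\<rbrakk> \<Longrightarrow> c k \<in> \<mm>"
    and r: "r \<in> linear_maps R (F 0) (regular_module R)"
    and u\<^sub>0: "u\<^sub>0 \<in> carrier (F 0)" and r_u\<^sub>0: "r u\<^sub>0 = \<one>"
    and r_split: "v \<in> carrier (F 0) \<Longrightarrow> v \<ominus>\<^bsub>F 0\<^esub> r v \<odot>\<^bsub>F 0\<^esub> u\<^sub>0 \<in> d 0 ` carrier (F (Suc 0))"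
    and r_boundary: "v \<in> d 0 ` carrier (F (Suc 0)) \<Longrightarrow> r v \<in> \<mm>"
begin

lemma xc [simp]: "x k \<in> carrier R" using \<mm>.Icarr[OF gen_in] .

lemma rc [simp]: "v \<in> carrier (F 0) \<Longrightarrow> r v \<in> carrier R"
  using linear_mapsD(1)[OF r] by (simp add: regular_module_simps)

lemma u\<^sub>0_not_boundary: "u\<^sub>0 \<notin> d 0 ` carrier (F (Suc 0))"
  using r_boundary r_u\<^sub>0 one_notin by metis

lemma smult_u\<^sub>0: "a \<in> carrier R \<Longrightarrow> r (a \<odot>\<^bsub>F 0\<^esub> u\<^sub>0) = a"
  using linear_mapsD(3)[OF r _ u\<^sub>0] by (simp add: r_u\<^sub>0 regular_module_simps)

lemma smult_u\<^sub>0_boundary: "a \<in> \<mm> \<Longrightarrow> a \<odot>\<^bsub>F 0\<^esub> u\<^sub>0 \<in> d 0 ` carrier (F (Suc 0))"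
  by (intro aug_ideal_smult ideal_smult.smult u\<^sub>0)

text \<open>The classes of the \<open>x k\<close> with \<open>k < e\<close> are linearly independent
  in \<open>\<mm>/\<mm>\<^sup>2\<close>: the given combination equals one with coefficients in
  \<open>\<mm>\<close>, and the difference of the two is a relation, to which \<open>indep\<close>
  applies.\<close>

lemma indep_mod_square:
  assumes c: "c \<in> {..<e} \<rightarrow> carrier R" and sum: "(\<Oplus>k\<in>{..<e}. c k \<otimes> x k) \<in> \<mm> \<cdot> \<mm>" and k: "k < e"
  shows "c k \<in> \<mm>"
proof -
  obtain b where b: "b \<in> {..<e} \<rightarrow> \<mm>" "(\<Oplus>k\<in>{..<e}. c k \<otimes> x k) = (\<Oplus>k\<in>{..<e}. b k \<otimes> x k)"
    using ideal_square_combination[OF gen xc sum] by blast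
  have bc: "b k \<in> carrier R" if "k < e" for k using b(1) that by (auto intro!: \<mm>.Icarr)
  have cc: "c k \<in> carrier R" if "k < e" for k using c that by auto
  have sc: "(\<Oplus>k\<in>{..<e}. b k \<otimes> x k) \<in> carrier R" "(\<Oplus>k\<in>{..<e}. (c k \<ominus> b k) \<otimes> x k) \<in> carrier R"
    using bc cc by (auto intro!: finsum_closed)
  have "(\<Oplus>k\<in>{..<e}. (c k \<ominus> b k) \<otimes> x k) \<oplus> (\<Oplus>k\<in>{..<e}. b k \<otimes> x k)
      = (\<Oplus>k\<in>{..<e}. (c k \<ominus> b k) \<otimes> x k \<oplus> b k \<otimes> x k)"
    using bc cc by (intro finsum_addf[symmetric]) auto
  also have "\<dots> = (\<Oplus>k\<in>{..<e}. c k \<otimes> x k)"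
    using bc cc by (intro finsum_cong') (auto simp: l_distr[symmetric] a_minus_def a_assoc l_neg)
  finally have "(\<Oplus>k\<in>{..<e}. (c k \<ominus> b k) \<otimes> x k) = \<zero>"
    using sc b(2) by simp
  then have "c k \<ominus> b k \<in> \<mm>"
    using bc cc k by (intro indep[of "\<lambda>k. c k \<ominus> b k"]) auto
  moreover have "b k \<in> \<mm>" using b(1) k by auto
  ultimately have "(c k \<ominus> b k) \<oplus> b k \<in> \<mm>" by simp
  then show ?thesis using bc[OF k] cc[OF k] by (simp add: a_minus_def a_assoc l_neg)
qed

lemma x_lifts: "\<exists>E. \<forall>k. E k \<in> carrier (F (Suc 0)) \<and> d 0 (E k) = x k \<odot>\<^bsub>F 0\<^esub> u\<^sub>0"
proof -
  have "\<exists>f. f \<in> carrier (F (Suc 0)) \<and> d 0 f = x k \<odot>\<^bsub>F 0\<^esub> u\<^sub>0" for k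
    using smult_u\<^sub>0_boundary[OF gen_in] by (metis imageE)
  then show ?thesis by metis
qed

text \<open>Degree 1 of a chain map from \<open>F\<close> to the Koszul complex:
  \<open>r \<circ> d\<close> has values in \<open>\<mm>\<close>, which the free module on
  \<open>{..<e}\<close> covers by means of the generators.\<close>

lemma coordinates:
  obtains \<rho> where "\<rho> \<in> linear_maps R (F (Suc 0)) (free_module R {..<e})"
    "\<And>f. f \<in> carrier (F (Suc 0)) \<Longrightarrow> (\<Oplus>k\<in>{..<e}. \<rho> f k \<otimes> x k) = r (d 0 f)"
proof -
  let ?L = "free_module R {..<e}" and ?p = "free_extension R (regular_module R) x"
  have xs: "x \<in> {..<e} \<rightarrow> carrier (regular_module R)" by (simp add: regular_module_simps)
  have p: "?p c = (\<Oplus>k\<in>{..<e}. c k \<otimes> x k)" if "c \<in> carrier ?L" for c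
    using that free_extension_superset[OF module_regular xs that, of "{..<e}"]
    by (auto simp: free_module_def finsum_regular_module regular_module_simps)
  have "(\<lambda>f. r (d 0 f)) ` carrier (F (Suc 0)) \<subseteq> ?p ` carrier ?L"
  proof (rule image_subsetI)
    fix f assume "f \<in> carrier (F (Suc 0))"
    then have "r (d 0 f) \<in> \<mm>" by (intro r_boundary) auto
    then obtain c where c: "c \<in> {..<e} \<rightarrow> carrier R" "r (d 0 f) = (\<Oplus>k\<in>{..<e}. c k \<otimes> x k)"
      using gen by blast
    let ?c = "\<lambda>k. if k < e then c k else \<zero>"
    have "finite {k. ?c k \<noteq> \<zero>}" by (rule finite_subset[of _ "{..<e}"]) auto
    then have cL: "?c \<in> carrier ?L" using c(1) by (auto simp: free_module_def)
    have "r (d 0 f) = ?p ?c"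
      unfolding p[OF cL] c(2) using c(1) by (intro finsum_cong') (auto simp: Pi_iff)
    then show "r (d 0 f) \<in> ?p ` carrier ?L" using cL by (rule image_eqI)
  qed
  then obtain \<rho> where \<rho>: "\<rho> \<in> linear_maps R (F (Suc 0)) ?L"
    "\<And>f. f \<in> carrier (F (Suc 0)) \<Longrightarrow> ?p (\<rho> f) = r (d 0 f)"
    using linear_lift[OF free module_free_module[OF is_cring] module_regular linear_maps_comp[OF linear r]
        free_extension_linear[OF module_regular xs]] by metis
  show ?thesis
    using \<rho> p[OF linear_mapsD(1)[OF \<rho>(1)]] by (intro that[OF \<rho>(1)]) simp
qed

text \<open>As the resolution need not be minimal, the lifts \<open>E\<close> of the \<open>x\<^sub>k\<close> generate \<open>F\<^sub>1\<close> only up to boundaries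
  and a homotopy, which vanishes on cycles.\<close>

lemma decomposition:
  assumes J: "ideal J R"
    and E: "\<And>k. E k \<in> carrier (F (Suc 0))" "\<And>k. d 0 (E k) = x k \<odot>\<^bsub>F 0\<^esub> u\<^sub>0"
    and w: "w \<in> ideal_smult R J (F (Suc 0))" "d 0 w = \<zero>\<^bsub>F 0\<^esub>"
  obtains z g where "\<And>k. z k \<in> J" "g \<in> ideal_smult R J (F (Suc (Suc 0)))"
    "w = (\<Oplus>\<^bsub>F (Suc 0)\<^esub>k\<in>{..<e}. z k \<odot>\<^bsub>F (Suc 0)\<^esub> E k) \<oplus>\<^bsub>F (Suc 0)\<^esub> d (Suc 0) g"
proof -
  let ?F1 = "F (Suc 0)" and ?F2 = "F (Suc (Suc 0))" and ?L = "free_module R {..<e}"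
  have mL: "module R ?L" by (rule module_free_module[OF is_cring])
  have split: "(\<lambda>v. v \<ominus>\<^bsub>F 0\<^esub> r v \<odot>\<^bsub>F 0\<^esub> u\<^sub>0) \<in> linear_maps R (F 0) (F 0)"
    by (intro linear_maps_diff module linear_maps_id linear_maps_comp[OF r smult_right_linear] u\<^sub>0)
  have "(\<lambda>v. v \<ominus>\<^bsub>F 0\<^esub> r v \<odot>\<^bsub>F 0\<^esub> u\<^sub>0) ` carrier (F 0) \<subseteq> d 0 ` carrier ?F1"
    using r_split by blast
  \<comment> \<open>\<open>s\<close> and the later \<open>s'\<close> form a homotopy, in degrees 0
    and 1, between the identity of \<open>F\<close> and the composite
    \<open>F \<rightarrow> K \<rightarrow> F\<close> that is given by \<open>r\<close> and
    \<open>\<rho>\<close> on the way out and by \<open>u\<^sub>0\<close> and \<open>E\<close> on the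
    way back.\<close>
  then obtain s where s: "s \<in> linear_maps R (F 0) ?F1"
    "\<And>v. v \<in> carrier (F 0) \<Longrightarrow> d 0 (s v) = v \<ominus>\<^bsub>F 0\<^esub> r v \<odot>\<^bsub>F 0\<^esub> u\<^sub>0"
    using linear_lift[OF free module module split linear] by metis
  obtain \<rho> where \<rho>: "\<rho> \<in> linear_maps R ?F1 ?L"
    "\<And>f. f \<in> carrier ?F1 \<Longrightarrow> (\<Oplus>k\<in>{..<e}. \<rho> f k \<otimes> x k) = r (d 0 f)"
    using coordinates by blast
  have \<rho>c: "\<rho> f k \<in> carrier R" if "f \<in> carrier ?F1" for f k
    using linear_mapsD(1)[OF \<rho>(1) that] by (simp add: free_module_def)
  have Es: "E \<in> {..<e} \<rightarrow> carrier ?F1" using E by blast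
  let ?P = "\<lambda>f. free_extension R ?F1 E (\<rho> f)"
  let ?\<phi> = "\<lambda>f. (f \<ominus>\<^bsub>?F1\<^esub> s (d 0 f)) \<ominus>\<^bsub>?F1\<^esub> ?P f"
  have P_lin: "?P \<in> linear_maps R ?F1 ?F1"
    by (rule linear_maps_comp[OF \<rho>(1) free_extension_linear[OF module Es]])
  have \<phi>_lin: "?\<phi> \<in> linear_maps R ?F1 ?F1"
    by (intro linear_maps_diff module linear_maps_id linear_maps_comp[OF linear s(1)] P_lin)
  have P: "?P f = (\<Oplus>\<^bsub>?F1\<^esub>k\<in>{..<e}. \<rho> f k \<odot>\<^bsub>?F1\<^esub> E k)" if "f \<in> carrier ?F1" for f
    using linear_mapsD(1)[OF \<rho>(1) that] by (intro free_extension_superset[OF module Es]) (auto simp: free_module_def)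
  have "?\<phi> ` carrier ?F1 \<subseteq> d (Suc 0) ` carrier ?F2"
  proof (intro image_subsetI exactD)
    fix f assume f: "f \<in> carrier ?F1"
    have c: "s (d 0 f) \<in> carrier ?F1" "?P f \<in> carrier ?F1"
      using linear_mapsD(1)[OF s(1)] linear_mapsD(1)[OF P_lin] f by auto
    then show "?\<phi> f \<in> carrier ?F1" using f by simp
    have "d 0 (?P f) = (\<Oplus>\<^bsub>F 0\<^esub>k\<in>{..<e}. d 0 (\<rho> f k \<odot>\<^bsub>?F1\<^esub> E k))"
      unfolding P[OF f] using \<rho>c[OF f] E by (intro linear_maps_finsum[OF module module linear]) auto
    also have "\<dots> = (\<Oplus>\<^bsub>F 0\<^esub>k\<in>{..<e}. (\<rho> f k \<otimes> x k) \<odot>\<^bsub>F 0\<^esub> u\<^sub>0)"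
      using \<rho>c[OF f] E u\<^sub>0 by (intro F.M.finsum_cong') (auto simp: d_smult F.smult_assoc1)
    also have "\<dots> = r (d 0 f) \<odot>\<^bsub>F 0\<^esub> u\<^sub>0"
      unfolding \<rho>(2)[OF f, symmetric] using \<rho>c[OF f] u\<^sub>0 by (intro F.finsum_smult_rdistr[symmetric]) auto
    finally show "d 0 (?\<phi> f) = \<zero>\<^bsub>F 0\<^esub>"
      using f c u\<^sub>0 by (simp add: d_minus s(2)) (simp add: a_minus_def F.M.minus_add F.M.r_neg1 F.M.r_neg2 F.M.r_neg)
  qed
  \<comment> \<open>Linearity of this lift and of \<open>\<rho>\<close> is the point: it puts
    \<open>s' w\<close> into \<open>J\<close> times \<open>F 2\<close> and the coordinates of
    \<open>w\<close> into \<open>J\<close>.\<close>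
  then obtain s' where s': "s' \<in> linear_maps R ?F1 ?F2" "\<And>f. f \<in> carrier ?F1 \<Longrightarrow> d (Suc 0) (s' f) = ?\<phi> f"
    using linear_lift[OF free module module \<phi>_lin linear] by metis
  have wc: "w \<in> carrier ?F1" by (rule ideal_smult_closed[OF J w(1)])
  have Pc: "?P w \<in> carrier ?F1" by (rule linear_mapsD(1)[OF P_lin wc])
  show ?thesis
  proof
    show "\<rho> w k \<in> J" for k
      by (rule ideal_smult_regular_module[OF J linear_maps_ideal_smult[OF module module_regular J
            linear_maps_comp[OF \<rho>(1) free_module_coordinate_linear] w(1)]])
    show "s' w \<in> ideal_smult R J ?F2"
      by (rule linear_maps_ideal_smult[OF module module J s'(1) w(1)])
    have "d (Suc 0) (s' w) = w \<ominus>\<^bsub>?F1\<^esub> ?P w"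
      using wc w(2) by (simp add: s'(2) linear_maps_zero[OF module module s(1)] F.M.diff_zero)
    then show "w = (\<Oplus>\<^bsub>?F1\<^esub>k\<in>{..<e}. \<rho> w k \<odot>\<^bsub>?F1\<^esub> E k) \<oplus>\<^bsub>?F1\<^esub> d (Suc 0) (s' w)"
      using wc Pc by (simp add: P[OF wc, symmetric]) (simp add: a_minus_def F.M.a_comm[of w] F.M.r_neg1 F.M.r_neg2)
  qed
qed

end

text \<open>\<open>u 1 {k}\<close> is the image of the exterior generator \<open>e_k\<close>,
  \<open>u 2 {}\<close> that of \<open>T\<close>, and \<open>u (2 * n) {}\<close> that of the n-th
  divided power of \<open>T\<close>.\<close>

locale tate_variable = augmented_resolution R \<mm> F d \<epsilon> e x r u\<^sub>0 + clifford_resolution R \<mm> F d \<epsilon> e x z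
  for R :: "('a, 'c) ring_scheme" (structure) and \<mm> :: "'a set"
    and F :: "nat \<Rightarrow> ('a, 'b) module" and d :: "nat \<Rightarrow> 'b \<Rightarrow> 'b" and \<epsilon> :: "'b \<Rightarrow> 'a set"
    and e :: nat and x :: "nat \<Rightarrow> 'a" and r :: "'b \<Rightarrow> 'a" and u\<^sub>0 :: 'b and z :: "nat \<Rightarrow> 'a" +
  fixes u :: "nat \<Rightarrow> nat set \<Rightarrow> 'b"
  assumes z_square: "z k \<in> \<mm> \<cdot> \<mm>"
    and family: "clifford_family u\<^sub>0 u"
begin

lemma square: "ideal (\<mm> \<cdot> \<mm>) R" "\<mm> \<cdot> \<mm> \<subseteq> \<mm>"
  using ideal_prod_is_ideal[OF \<mm>.is_ideal \<mm>.is_ideal] ideal_prod_inter[OF \<mm>.is_ideal \<mm>.is_ideal] by auto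

sublocale square: ideal "\<mm> \<cdot> \<mm>" R by (rule square(1))

lemma u_closed [simp]: "u n A \<in> carrier (F n)"
  and u_0: "u 0 {} = u\<^sub>0"
  and u_unsupported: "\<not> supported n A \<Longrightarrow> u n A = \<zero>\<^bsub>F n\<^esub>"
  and d_u: "finite A \<Longrightarrow> d n (u (Suc n) A) = clif n (u n) A"
  using family by (auto simp: clifford_family_def)

lemma coeff_empty: "cc k {} = z k"
  by (simp add: clifford_coeff_def)

lemma d_u_empty: "d n (u (Suc n) {}) = (\<Oplus>\<^bsub>F n\<^esub>k\<in>{..<e}. z k \<odot>\<^bsub>F n\<^esub> u n {k})"
  by (simp add: d_u clifford_def coeff_empty flip_def)

lemma d_u_empty_square: "d n (u (Suc n) {}) \<in> ideal_smult R (\<mm> \<cdot> \<mm>) (F n)"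
  unfolding d_u_empty using z_square
  by (intro F.finsum_in_submodule submodule_ideal_smult module square(1)) (auto intro: ideal_smult.smult)

lemma d_u_singleton:
  assumes "k < e"
  shows "d 0 (u (Suc 0) {k}) = x k \<odot>\<^bsub>F 0\<^esub> u\<^sub>0"
proof -
  \<comment> \<open>In degree 0 only the empty set is supported, so every term but that of
    \<open>k\<close> itself vanishes, in particular those with coefficient
    \<open>z l\<close>.\<close>
  have eq: "cc l {k} \<odot>\<^bsub>F 0\<^esub> u 0 (flip l {k}) = (if k = l then x l \<odot>\<^bsub>F 0\<^esub> u\<^sub>0 else \<zero>\<^bsub>F 0\<^esub>)" for l
  proof (cases "k = l")
    case True
    then show ?thesis by (simp add: clifford_coeff_def Collect_conv_if flip_def u_0)
  next
    case False
    then have "\<not> supported 0 (flip l {k})" by (auto simp: supported_def flip_def)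
    with False show ?thesis by (simp add: u_unsupported)
  qed
  have "clif 0 (u 0) {k} = x k \<odot>\<^bsub>F 0\<^esub> u\<^sub>0"
    unfolding clifford_def eq using assms u\<^sub>0
    by (intro F.M.add.finprod_singleton) auto
  then show ?thesis by (simp add: d_u)
qed

text \<open>If \<open>\<rho>\<close> are the coordinates of \<open>F\<^sub>1\<close> along the lifts of the \<open>x\<^sub>k\<close>, then \<open>\<rho> \<circ> d\<close> vanishes modulo \<open>\<mm>\<^sup>2\<close> on the
  first term and on the inessential elements, and sends \<open>e\<^sub>k \<and> e\<^sub>l\<close> to \<open>\<plusminus>x\<^sub>k\<close> or \<open>\<plusminus>x\<^sub>l\<close>. So a relation
  between them would give a relation modulo \<open>\<mm>\<^sup>2\<close> between the minimal generators.\<close>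

lemma not_in_span:
  assumes ess: "u 2 {} \<notin> inessential 2"
    and c: "c \<in> Pow {..<e} - {{}} \<rightarrow> carrier R"
  shows "u 2 {} \<ominus>\<^bsub>F 2\<^esub> (\<Oplus>\<^bsub>F 2\<^esub>A\<in>Pow {..<e} - {{}}. c A \<odot>\<^bsub>F 2\<^esub> u 2 A) \<notin> inessential 2"
proof
  let ?S = "Pow {..<e} - {{}}"
  let ?sum = "\<Oplus>\<^bsub>F 2\<^esub>A\<in>?S. c A \<odot>\<^bsub>F 2\<^esub> u 2 A"
  assume rel: "u 2 {} \<ominus>\<^bsub>F 2\<^esub> ?sum \<in> inessential 2"
  note two = numeral_2_eq_2
  have cc: "c A \<in> carrier R" if "A \<in> ?S" for A using c that by blast
  obtain \<rho>' where \<rho>': "\<rho>' \<in> linear_maps R (F (Suc 0)) (free_module R {..<e})"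
    "\<And>f. f \<in> carrier (F (Suc 0)) \<Longrightarrow> (\<Oplus>k\<in>{..<e}. \<rho>' f k \<otimes> x k) = r (d 0 f)"
    using coordinates by blast
  define \<rho> where "\<rho> l f = \<rho>' f l" for l f
  have \<rho>: "\<rho> l \<in> linear_maps R (F (Suc 0)) (regular_module R)" for l
    unfolding \<rho>_def[abs_def] by (rule linear_maps_comp[OF \<rho>'(1) free_module_coordinate_linear])
  note \<rho>_sum = \<rho>'(2)[folded \<rho>_def]
  have \<rho>c [simp]: "\<rho> l f \<in> carrier R" if "f \<in> carrier (F (Suc 0))" for l f
    using linear_mapsD(1)[OF \<rho> that] by (simp add: regular_module_simps)
  \<comment> \<open>Because \<open>d \<circ> d = 0\<close>, the coordinates of a boundary are the
    coefficients of a relation between the generators.\<close>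
  have \<rho>_boundary: "\<rho> l (d (Suc 0) v) \<in> \<mm>" if v: "v \<in> carrier (F (Suc (Suc 0)))" and l: "l < e" for v l
  proof (rule indep[of "\<lambda>l. \<rho> l (d (Suc 0) v)", OF _ _ l])
    show "(\<Oplus>k\<in>{..<e}. \<rho> k (d (Suc 0) v) \<otimes> x k) = \<zero>"
      using v linear_maps_zero[OF module module_regular r] by (simp add: \<rho>_sum regular_module_simps)
  qed (use v in auto)
  \<comment> \<open>The coordinates of \<open>u 1 {k}\<close> and the \<open>k\<close>-th unit
    vector both combine the generators to \<open>x k\<close>, so their difference is a
    relation.\<close>
  have \<rho>_u: "\<rho> l (u (Suc 0) {k}) \<ominus> (if l = k then \<one> else \<zero>) \<in> \<mm>" if k: "k < e" and l: "l < e" for k l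
  proof (rule indep[of "\<lambda>l. \<rho> l (u (Suc 0) {k}) \<ominus> (if l = k then \<one> else \<zero>)", OF _ _ l])
    let ?\<delta> = "\<lambda>l. if l = k then \<one> else \<zero>"
    have sc: "(\<Oplus>l\<in>{..<e}. (\<rho> l (u (Suc 0) {k}) \<ominus> ?\<delta> l) \<otimes> x l) \<in> carrier R"
      by (intro finsum_closed) auto
    have "(\<Oplus>l\<in>{..<e}. ?\<delta> l \<otimes> x l) = (\<Oplus>l\<in>{..<e}. if k = l then x l else \<zero>)"
      by (intro finsum_cong') auto
    also have "\<dots> = x k" using k by (intro add.finprod_singleton) auto
    finally have \<delta>: "(\<Oplus>l\<in>{..<e}. ?\<delta> l \<otimes> x l) = x k" .
    have "(\<Oplus>l\<in>{..<e}. (\<rho> l (u (Suc 0) {k}) \<ominus> ?\<delta> l) \<otimes> x l) \<oplus> (\<Oplus>l\<in>{..<e}. ?\<delta> l \<otimes> x l)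
        = (\<Oplus>l\<in>{..<e}. (\<rho> l (u (Suc 0) {k}) \<ominus> ?\<delta> l) \<otimes> x l \<oplus> ?\<delta> l \<otimes> x l)"
      by (intro finsum_addf[symmetric]) auto
    also have "\<dots> = (\<Oplus>l\<in>{..<e}. \<rho> l (u (Suc 0) {k}) \<otimes> x l)"
      by (intro finsum_cong') (auto simp: l_distr[symmetric] a_minus_def a_assoc l_neg)
    also have "\<dots> = x k"
      using k by (simp add: \<rho>_sum d_u_singleton smult_u\<^sub>0)
    finally show "(\<Oplus>l\<in>{..<e}. (\<rho> l (u (Suc 0) {k}) \<ominus> ?\<delta> l) \<otimes> x l) = \<zero>"
      using sc by (simp add: \<delta>)
  qed auto
  \<comment> \<open>The \<open>l\<close>-th coordinate of the boundary isolates the pairs that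
    contain \<open>l\<close>. Modulo the square of \<open>\<mm>\<close> the assumed relation becomes
    a combination of the \<open>x k\<close> with coefficients
    \<open>\<plusminus>c {k, l}\<close>.\<close>
  have coeff_in: "c {k, l} \<in> \<mm>" if k: "k < e" "k \<noteq> l" and l: "l < e" for k l
  proof -
    define D where "D v = \<rho> l (d (Suc 0) v)" for v
    have D: "D \<in> linear_maps R (F (Suc (Suc 0))) (regular_module R)"
      unfolding D_def[abs_def] by (rule linear_maps_comp[OF linear \<rho>])
    have Dc [simp]: "D v \<in> carrier R" if "v \<in> carrier (F (Suc (Suc 0)))" for v
      using linear_mapsD(1)[OF D that] by (simp add: regular_module_simps)
    \<comment> \<open>The values of \<open>D\<close> lie in \<open>\<mm>\<close> already, so a
      further factor from \<open>\<mm>\<close> brings them into the square.\<close>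
    have D_smult: "D w \<in> \<mm> \<cdot> \<mm>" if "w \<in> ideal_smult R \<mm> (F (Suc (Suc 0)))" for w
      using that
    proof induction
      case zero
      then show ?case using linear_maps_zero[OF module module_regular D] by (simp add: regular_module_simps)
    next
      case (smult q v)
      then have "D (q \<odot>\<^bsub>F (Suc (Suc 0))\<^esub> v) = q \<otimes> D v"
        using linear_mapsD(3)[OF D \<mm>.Icarr] by (simp add: regular_module_simps)
      then show ?case using smult \<rho>_boundary[OF _ l] by (simp add: D_def ideal_prod.prod)
    next
      case (add v v')
      then have "D (v \<oplus>\<^bsub>F (Suc (Suc 0))\<^esub> v') = D v \<oplus> D v'"
        using linear_mapsD(2)[OF D] ideal_smult_closed[OF \<mm>.is_ideal] by (simp add: regular_module_simps)
      with add show ?case by simp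
    qed
    have D_inessential: "D v \<in> \<mm> \<cdot> \<mm>" if "v \<in> inessential (Suc (Suc 0))" for v
    proof -
      obtain g w where g: "g \<in> carrier (F (Suc (Suc (Suc 0))))" "w \<in> ideal_smult R \<mm> (F (Suc (Suc 0)))"
        "v = d (Suc (Suc 0)) g \<oplus>\<^bsub>F (Suc (Suc 0))\<^esub> w" using \<open>v \<in> _\<close> unfolding inessential_def by blast
      have w: "w \<in> carrier (F (Suc (Suc 0)))" by (rule ideal_smult_closed[OF \<mm>.is_ideal g(2)])
      have "D (d (Suc (Suc 0)) g) = \<zero>"
        using g(1) linear_maps_zero[OF module module_regular \<rho>] by (simp add: D_def regular_module_simps)
      then have "D v = D w"
        using g w linear_mapsD(2)[OF D, of "d (Suc (Suc 0)) g" w] by (simp add: regular_module_simps)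
      then show ?thesis using D_smult[OF g(2)] by simp
    qed
    let ?t = "\<lambda>A k. clifford_coeff R x z k A \<otimes> \<rho> l (u (Suc 0) (flip k A))"
    have D_u: "D (u (Suc (Suc 0)) A) = (\<Oplus>k\<in>{..<e}. ?t A k)" if "finite A" for A
    proof -
      have "D (u (Suc (Suc 0)) A) = clifford R (regular_module R) e x z (\<lambda>A. \<rho> l (u (Suc 0) A)) A"
        unfolding D_def d_u[OF that] by (rule linear_clifford[OF module module_regular \<rho> u_closed])
      then show ?thesis
        by (simp add: clifford_def regular_module_simps finsum_regular_module)
    qed
    \<comment> \<open>Such a term has a coefficient \<open>\<plusminus>z k\<close> in the square, or
      it is the product of \<open>\<plusminus>x k\<close> and a coordinate in \<open>\<mm>\<close>.
      The excluded case is the one where the coordinate is congruent to 1.\<close>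
    have t_in: "?t A k \<in> \<mm> \<cdot> \<mm>" if A: "A \<subseteq> {..<e}" "k < e" and ne: "\<not> (k \<in> A \<and> flip k A = {l})" for A k
    proof (cases "k \<in> A")
      case False
      then have "clifford_coeff R x z k A \<in> \<mm> \<cdot> \<mm>" using z_square by (auto simp: clifford_coeff_def Let_def)
      then show ?thesis by (intro square.I_r_closed) auto
    next
      case True
      then have "clifford_coeff R x z k A \<in> \<mm>" using x_in by (auto simp: clifford_coeff_def Let_def)
      moreover have "\<rho> l (u (Suc 0) (flip k A)) \<in> \<mm>"
      proof (cases "supported (Suc 0) (flip k A)")
        case False
        then show ?thesis
          using linear_maps_zero[OF module module_regular \<rho>] by (simp add: u_unsupported regular_module_simps)
      next
        case supp: True
        then have "card (flip k A) = 1"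
          unfolding supported_def by (cases "card (flip k A)") auto
        then obtain j where j: "flip k A = {j}" by (auto simp: card_1_singleton_iff)
        have "j < e" "j \<noteq> l" using supp j ne True by (auto simp: supported_def)
        then show ?thesis using \<rho>_u[of j l] l j by (simp add: diff_zero)
      qed
      ultimately show ?thesis by (rule ideal_prod.prod)
    qed
    define sg where "sg k a = (if even (card {j \<in> {k, l}. j < k}) then a else \<ominus> a)" for k and a :: 'a
    have sgc: "sg k a \<in> carrier R" if "a \<in> carrier R" for k a using that by (simp add: sg_def)
    have D_pair: "D (u (Suc (Suc 0)) {k, l}) \<ominus> sg k (x k) \<in> \<mm> \<cdot> \<mm>" if k: "k < e" "k \<noteq> l" for k
    proof -
      let ?A = "{k, l}" and ?g = "\<lambda>j. if k = j then sg j (x j) else \<zero>"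
      have fl: "flip k ?A = {l}" using k(2) by (auto simp: flip_def)
      have t: "?t ?A j \<ominus> ?g j \<in> \<mm> \<cdot> \<mm>" if j: "j < e" for j
      proof (cases "k = j")
        case True
        have "?t ?A j = sg j (x j) \<otimes> \<rho> l (u (Suc 0) {l})"
          using True fl by (simp add: clifford_coeff_def sg_def)
        then have "?t ?A j \<ominus> ?g j = sg j (x j) \<otimes> (\<rho> l (u (Suc 0) {l}) \<ominus> \<one>)"
          using True sgc by (simp add: a_minus_def r_distr r_minus)
        moreover have "sg j (x j) \<in> \<mm>" using x_in by (simp add: sg_def)
        moreover have "\<rho> l (u (Suc 0) {l}) \<ominus> \<one> \<in> \<mm>" using \<rho>_u[OF l l] by simp
        ultimately show ?thesis by (simp add: ideal_prod.prod)
      next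
        case False
        have "?t ?A j \<in> \<mm> \<cdot> \<mm>"
        proof (rule t_in)
          show "\<not> (j \<in> ?A \<and> flip j ?A = {l})" using False k(2) by (auto simp: flip_def)
        qed (use j k l in auto)
        then show ?thesis using False by (simp add: diff_zero square.Icarr)
      qed
      have "(\<Oplus>j\<in>{..<e}. ?t ?A j) \<ominus> (\<Oplus>j\<in>{..<e}. ?g j) \<in> \<mm> \<cdot> \<mm>"
        using t sgc by (intro ideal_finsum_congruent square(1)) auto
      moreover have "(\<Oplus>j\<in>{..<e}. ?g j) = sg k (x k)"
        using k sgc by (intro add.finprod_singleton) auto
      ultimately show ?thesis by (simp add: D_u)
    qed
    \<comment> \<open>The sum over subsets is reindexed by the partner \<open>k\<close> of
      \<open>l\<close>. The coefficient at \<open>l\<close> itself is set to zero, which gives a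
      combination of all generators.\<close>
    let ?K = "{..<e} - {l}"
    let ?P = "(\<lambda>k. {k, l}) ` ?K"
    let ?b = "\<lambda>k. if k = l then \<zero> else sg k (c {k, l})"
    let ?f = "\<lambda>A. c A \<otimes> D (u (Suc (Suc 0)) A)"
    define g where "g A = (if A \<in> ?P then ?b (THE k. k \<in> ?K \<and> A = {k, l}) \<otimes> x (THE k. k \<in> ?K \<and> A = {k, l}) else \<zero>)" for A
    have the: "(THE k'. k' \<in> ?K \<and> {k, l} = {k', l}) = k" if "k \<in> ?K" for k
      using that by (intro the_equality) (auto simp: doubleton_eq_iff)
    have pair: "{k, l} \<in> ?S" if "k \<in> ?K" for k using that l by auto
    have bc: "?b k \<in> carrier R" if "k < e" for k using cc[OF pair] sgc that by auto
    have g_eq: "g {k, l} = ?b k \<otimes> x k" if "k \<in> ?K" for k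
      unfolding g_def the[OF that] using that by auto
    have g_zero: "g A = \<zero>" if "A \<notin> ?P" for A using that by (simp only: g_def if_False)
    have gc: "g A \<in> carrier R" if "A \<in> ?S" for A
    proof (cases "A \<in> ?P")
      case True
      then obtain k where k: "k \<in> ?K" "A = {k, l}" by blast
      show ?thesis unfolding k(2) g_eq[OF k(1)] by (rule m_closed[OF bc xc]) (use k(1) in simp)
    qed (simp add: g_zero)
    have "(\<Oplus>A\<in>?S. ?f A) \<ominus> (\<Oplus>A\<in>?S. g A) \<in> \<mm> \<cdot> \<mm>"
    proof (rule ideal_finsum_congruent[OF square(1)])
      show "?f A \<ominus> g A \<in> \<mm> \<cdot> \<mm>" if A: "A \<in> ?S" for A
      proof (cases "A \<in> ?P")
        case True
        then obtain k where k: "k \<in> ?K" "A = {k, l}" by blast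
        have "sg k (c {k, l}) \<otimes> x k = c {k, l} \<otimes> sg k (x k)"
          using cc[OF pair[OF k(1)]] by (simp add: sg_def l_minus r_minus)
        then have "?f A \<ominus> g A = c {k, l} \<otimes> (D (u (Suc (Suc 0)) {k, l}) \<ominus> sg k (x k))"
          unfolding k(2) g_eq[OF k(1)] using cc[OF pair[OF k(1)]] sgc k(1)
          by (simp add: a_minus_def r_distr r_minus)
        then show ?thesis
          using D_pair[of k] k(1) cc[OF pair[OF k(1)]] by (simp add: square.I_l_closed)
      next
        case False
        have fin: "finite A" using A finite_subset[of A "{..<e}"] by auto
        have "?t A k \<in> \<mm> \<cdot> \<mm>" if k: "k < e" for k
        proof (rule t_in)
          show "\<not> (k \<in> A \<and> flip k A = {l})"
          proof
            assume kA: "k \<in> A \<and> flip k A = {l}"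
            then have "k \<noteq> l" by (metis flip_simps(3) singletonI)
            then have "A = {k, l}"
              using flip_simps(1)[of k A] kA by (simp add: flip_def[of k "{l}"])
            with \<open>k \<noteq> l\<close> k have "A \<in> ?P" by (intro image_eqI[of _ _ k]) auto
            with False show False ..
          qed
        qed (use A k in auto)
        then have "D (u (Suc (Suc 0)) A) \<in> \<mm> \<cdot> \<mm>"
          unfolding D_u[OF fin] by (intro ideal_finsum_closed square(1)) auto
        then show ?thesis using g_zero[OF False] cc[OF A] by (simp add: diff_zero square.I_l_closed)
      qed
    qed (use cc gc in auto)
    \<comment> \<open>Here the assumed relation enters: \<open>D\<close> sends the inessential
      difference into the square, and also \<open>u 2 {}\<close>, whose boundary has the
      coefficients \<open>z k\<close>.\<close>
    moreover have "(\<Oplus>A\<in>?S. ?f A) \<in> \<mm> \<cdot> \<mm>"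
    proof -
      have sumc: "?sum \<in> carrier (F 2)" using cc by (intro F.M.finsum_closed) auto
      have "D (u 2 {} \<ominus>\<^bsub>F 2\<^esub> ?sum) = D (u 2 {}) \<ominus>\<^bsub>regular_module R\<^esub> D ?sum"
        using sumc by (intro linear_maps_minus[OF module module_regular]) (simp_all add: D two)
      also have "D ?sum = (\<Oplus>\<^bsub>regular_module R\<^esub>A\<in>?S. D (c A \<odot>\<^bsub>F 2\<^esub> u 2 A))"
        using cc by (intro linear_maps_finsum[OF module module_regular]) (auto simp: D two)
      also have "\<dots> = (\<Oplus>A\<in>?S. ?f A)"
        unfolding finsum_regular_module two using cc linear_mapsD(3)[OF D]
        by (intro finsum_cong') (auto simp: regular_module_simps)
      finally have "D (u 2 {} \<ominus>\<^bsub>F 2\<^esub> ?sum) = D (u 2 {}) \<ominus> (\<Oplus>A\<in>?S. ?f A)"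
        using cc by (subst (asm) regular_module_minus[OF is_cring]) (auto simp: two intro!: finsum_closed)
      moreover have "D (u 2 {} \<ominus>\<^bsub>F 2\<^esub> ?sum) \<in> \<mm> \<cdot> \<mm>"
        using rel unfolding two by (rule D_inessential)
      moreover have "D (u 2 {}) \<in> \<mm> \<cdot> \<mm>"
        unfolding two D_u[OF finite.emptyI]
        by (intro ideal_finsum_closed square(1)) (auto simp: coeff_empty intro!: square.I_r_closed z_square)
      ultimately have "D (u 2 {}) \<ominus> (D (u 2 {}) \<ominus> (\<Oplus>A\<in>?S. ?f A)) \<in> \<mm> \<cdot> \<mm>"
        by (simp add: a_minus_def)
      moreover have "(\<Oplus>A\<in>?S. ?f A) \<in> carrier R" using cc by (intro finsum_closed) auto
      moreover have "D (u 2 {}) \<in> carrier R" by (simp add: two)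
      ultimately show ?thesis by (simp add: a_minus_def minus_add r_neg1 r_neg2)
    qed
    ultimately have "(\<Oplus>A\<in>?S. ?f A) \<ominus> ((\<Oplus>A\<in>?S. ?f A) \<ominus> (\<Oplus>A\<in>?S. g A)) \<in> \<mm> \<cdot> \<mm>"
      by (simp add: a_minus_def)
    moreover have "(\<Oplus>A\<in>?S. ?f A) \<in> carrier R" using cc by (intro finsum_closed) auto
    moreover have gsc: "(\<Oplus>A\<in>?S. g A) \<in> carrier R" using gc by (intro finsum_closed) auto
    ultimately have g_in: "(\<Oplus>A\<in>?S. g A) \<in> \<mm> \<cdot> \<mm>"
      by (simp add: a_minus_def minus_add r_neg1 r_neg2)
    have "(\<Oplus>A\<in>?S. g A) = (\<Oplus>A\<in>?P. g A)"
      using gc pair g_zero by (intro add.finprod_mono_neutral_cong_right) auto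
    also have "\<dots> = (\<Oplus>k\<in>?K. g {k, l})"
      using gc[OF pair] by (intro add.finprod_reindex) (auto simp: inj_on_def doubleton_eq_iff)
    also have "\<dots> = (\<Oplus>k\<in>?K. ?b k \<otimes> x k)"
      using bc by (intro finsum_cong' refl g_eq) auto
    also have "\<dots> = (\<Oplus>k\<in>{..<e}. ?b k \<otimes> x k)"
      using bc by (intro add.finprod_mono_neutral_cong_left) auto
    finally have "(\<Oplus>k\<in>{..<e}. ?b k \<otimes> x k) \<in> \<mm> \<cdot> \<mm>" using g_in by simp
    then have "?b k \<in> \<mm>"
      using bc k(1) by (intro indep_mod_square[of ?b]) auto
    then have "sg k (c {k, l}) \<in> \<mm>" using k(2) by simp
    moreover have "c {k, l} \<in> carrier R" using k l by (intro cc) auto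
    ultimately show "c {k, l} \<in> \<mm>"
      using \<mm>.a_inv_closed[of "\<ominus> c {k, l}"] by (auto simp: sg_def split: if_splits)
  qed
  \<comment> \<open>Among the nonempty sets only the pairs are supported in degree 2: singletons
    have the wrong parity, and larger sets are too large.\<close>
  have "c A \<odot>\<^bsub>F 2\<^esub> u 2 A \<in> inessential 2" if A: "A \<in> ?S" for A
  proof (cases "supported 2 A")
    case True
    then have "card A \<noteq> 0" "card A \<noteq> 1" "card A \<le> 2"
      using A finite_subset[of A "{..<e}"] by (auto simp: supported_def)
    then have "card A = 2" by linarith
    then obtain k l where "A = {k, l}" "k \<noteq> l" by (auto simp: card_2_iff)
    then have "c A \<in> \<mm>" using coeff_in[of k l] A by auto
    then show ?thesis by (intro ideal_smult_inessential ideal_smult.smult) auto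
  next
    case False
    then show ?thesis
      using cc[OF A] F.submodule_zero[OF submodule_inessential] by (simp add: u_unsupported)
  qed
  then have "?sum \<in> inessential 2"
    by (intro F.finsum_in_submodule submodule_inessential) auto
  then have "(u 2 {} \<ominus>\<^bsub>F 2\<^esub> ?sum) \<oplus>\<^bsub>F 2\<^esub> ?sum \<in> inessential 2"
    using rel F.submoduleE(5)[OF submodule_inessential] by blast
  moreover have "?sum \<in> carrier (F 2)" using cc by (intro F.M.finsum_closed) auto
  ultimately show False
    using ess by (simp add: a_minus_def F.M.a_assoc F.M.l_neg)
qed

end

context tate_variable
begin

text \<open>The functional comes from a submodule \<open>H\<close> of \<open>F 2\<close> that
  contains all that is to be killed and is maximal without \<open>u 2 {}\<close>. The quotient by
  \<open>H\<close> is a line over the residue field, so no basis of \<open>Tor\<close> has to be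
  chosen.\<close>

lemma essential_powers:
  assumes ess: "u 2 {} \<notin> inessential 2"
  shows "u (2 * n) {} \<notin> inessential (2 * n)"
proof
  assume iness: "u (2 * n) {} \<in> inessential (2 * n)"
  let ?S = "Pow {..<e} - {{}}" and ?v = "u 2 {}"
  let ?span = "{\<Oplus>\<^bsub>F 2\<^esub>A\<in>?S. c A \<odot>\<^bsub>F 2\<^esub> u 2 A | c. c \<in> ?S \<rightarrow> carrier R}"
  let ?H0 = "{h \<oplus>\<^bsub>F 2\<^esub> k | h k. h \<in> inessential 2 \<and> k \<in> ?span}"
  have span: "submodule ?span R (F 2)"
    by (intro F.submodule_linear_combinations) auto
  have H0: "submodule ?H0 R (F 2)"
    by (rule F.submodule_sum[OF submodule_inessential span])
  have v_notin: "?v \<notin> ?H0"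
  proof
    assume "?v \<in> ?H0"
    then obtain h c where h: "h \<in> inessential 2" and c: "c \<in> ?S \<rightarrow> carrier R"
      and v: "?v = h \<oplus>\<^bsub>F 2\<^esub> (\<Oplus>\<^bsub>F 2\<^esub>A\<in>?S. c A \<odot>\<^bsub>F 2\<^esub> u 2 A)" by blast
    have "h \<in> carrier (F 2)" using h F.submoduleE(1)[OF submodule_inessential] by blast
    moreover have "(\<Oplus>\<^bsub>F 2\<^esub>A\<in>?S. c A \<odot>\<^bsub>F 2\<^esub> u 2 A) \<in> carrier (F 2)"
      using c by (intro F.M.finsum_closed) auto
    ultimately have "?v \<ominus>\<^bsub>F 2\<^esub> (\<Oplus>\<^bsub>F 2\<^esub>A\<in>?S. c A \<odot>\<^bsub>F 2\<^esub> u 2 A) = h"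
      unfolding v by (simp add: a_minus_def F.M.a_assoc F.M.r_neg)
    then show False using not_in_span[OF ess c] h by simp
  qed
  obtain H where H: "submodule H R (F 2)" "?H0 \<subseteq> H" "?v \<notin> H"
    and max: "\<And>K. \<lbrakk>submodule K R (F 2); H \<subset> K\<rbrakk> \<Longrightarrow> ?v \<in> K"
  proof (rule F.maximal_submodule_avoiding[OF H0 v_notin])
    fix H
    assume "submodule H R (F 2)" "?H0 \<subseteq> H" "?v \<notin> H" "\<And>K. \<lbrakk>submodule K R (F 2); H \<subset> K\<rbrakk> \<Longrightarrow> ?v \<in> K"
    then show thesis by (rule that)
  qed
  note HE = F.submoduleE[OF H(1)]
  have iness_H: "w \<in> H" if "w \<in> inessential 2" for w
    using that F.submodule_sum_superset(1)[OF submodule_inessential span] H(2) by (meson subsetD)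
  have u_H: "u 2 A \<in> H" if "A \<noteq> {}" for A
  proof (cases "supported 2 A")
    case True
    then have A: "A \<in> ?S" using that by (auto simp: supported_def)
    have "(\<Oplus>\<^bsub>F 2\<^esub>B\<in>?S. (if A = B then \<one> else \<zero>) \<odot>\<^bsub>F 2\<^esub> u 2 B) = (\<Oplus>\<^bsub>F 2\<^esub>B\<in>?S. if A = B then u 2 B else \<zero>\<^bsub>F 2\<^esub>)"
      by (intro F.M.finsum_cong') auto
    also have "\<dots> = u 2 A"
      using A by (intro F.M.add.finprod_singleton) auto
    finally have "u 2 A = (\<Oplus>\<^bsub>F 2\<^esub>B\<in>?S. (if A = B then \<one> else \<zero>) \<odot>\<^bsub>F 2\<^esub> u 2 B)" by simp
    then have "u 2 A \<in> ?span"
      by (intro CollectI exI[of _ "\<lambda>B. if A = B then \<one> else \<zero>"]) auto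
    then show ?thesis
      using F.submodule_sum_superset(2)[OF submodule_inessential span] H(2) by (meson subsetD)
  next
    case False
    then show ?thesis using F.submodule_zero[OF H(1)] by (simp add: u_unsupported)
  qed
  have coeff_in: "a \<in> \<mm>" if "a \<in> carrier R" "a \<odot>\<^bsub>F 2\<^esub> ?v \<in> H" for a
  proof (rule ccontr)
    assume "a \<notin> \<mm>"
    then obtain b where "b \<in> carrier R" "b \<otimes> a = \<one>" using unit \<open>a \<in> carrier R\<close> by blast
    then have "?v = b \<odot>\<^bsub>F 2\<^esub> (a \<odot>\<^bsub>F 2\<^esub> ?v)" using that by (simp add: F.smult_assoc1[symmetric])
    then show False using HE(4)[OF \<open>b \<in> carrier R\<close> that(2)] H(3) by simp
  qed
  let ?q = "\<lambda>y. H +>\<^bsub>F 2\<^esub> y"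
  have q_eq: "?q y = ?q y' \<longleftrightarrow> y \<ominus>\<^bsub>F 2\<^esub> y' \<in> H" if "y \<in> carrier (F 2)" "y' \<in> carrier (F 2)" for y y'
    by (rule submodule_coset_eq_iff[OF module H(1) that])
  have q: "?q \<in> linear_maps R (F 2) (quotient_module (F 2) H)"
    by (rule quotient_projection_linear[OF module H(1)])
  have qv: "(\<lambda>a. ?q (a \<odot>\<^bsub>F 2\<^esub> ?v)) \<in> linear_maps R (regular_module R) (quotient_module (F 2) H)"
    by (rule linear_maps_comp[OF smult_right_linear[OF module u_closed] q])
  have "?q ` carrier (F 2) \<subseteq> (\<lambda>a. ?q (a \<odot>\<^bsub>F 2\<^esub> ?v)) ` carrier (regular_module R)"
  proof (rule image_subsetI)
    fix y assume y: "y \<in> carrier (F 2)"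
    obtain a where "a \<in> carrier R" "y \<ominus>\<^bsub>F 2\<^esub> a \<odot>\<^bsub>F 2\<^esub> ?v \<in> H"
      using maximal_submodule_hyperplane[OF module H(1,3) u_closed max _ y] iness_H ideal_smult_inessential
      by blast
    then show "?q y \<in> (\<lambda>a. ?q (a \<odot>\<^bsub>F 2\<^esub> ?v)) ` carrier (regular_module R)"
      using y by (intro image_eqI[of _ _ a]) (auto simp: q_eq regular_module_simps)
  qed
  \<comment> \<open>The projection onto the line is lifted to a functional with values in
    \<open>R\<close>. Only then does \<open>t y \<odot> u\<^sub>0\<close> define a linear map into
    \<open>F 0\<close>, from which a chain map can be built.\<close>
  then obtain t where t: "t \<in> linear_maps R (F 2) (regular_module R)"
    and t_q: "\<And>y. y \<in> carrier (F 2) \<Longrightarrow> ?q (t y \<odot>\<^bsub>F 2\<^esub> ?v) = ?q y"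
    using linear_lift[OF free module_regular module_quotient_module[OF module H(1)] q qv] by metis
  have tc [simp]: "t y \<in> carrier R" if "y \<in> carrier (F 2)" for y
    using linear_mapsD(1)[OF t that] by (simp add: regular_module_simps)
  have t_H: "y \<ominus>\<^bsub>F 2\<^esub> t y \<odot>\<^bsub>F 2\<^esub> ?v \<in> H" if "y \<in> carrier (F 2)" for y
    using that t_q[OF that] q_eq[of y "t y \<odot>\<^bsub>F 2\<^esub> ?v"] by simp
  have t_in: "t y \<in> \<mm>" if y: "y \<in> H" for y
  proof -
    have yc: "y \<in> carrier (F 2)" using y HE(1) by blast
    have "y \<ominus>\<^bsub>F 2\<^esub> (y \<ominus>\<^bsub>F 2\<^esub> t y \<odot>\<^bsub>F 2\<^esub> ?v) \<in> H"
      by (rule F.submodule_minus[OF H(1) y t_H[OF yc]])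
    then show ?thesis
      using yc by (intro coeff_in) (simp_all add: a_minus_def F.M.minus_add F.M.r_neg1 F.M.r_neg2)
  qed
  have t_v: "t ?v \<ominus> \<one> \<in> \<mm>"
  proof (rule coeff_in)
    have "(t ?v \<ominus> \<one>) \<odot>\<^bsub>F 2\<^esub> ?v = \<ominus>\<^bsub>F 2\<^esub> (?v \<ominus>\<^bsub>F 2\<^esub> t ?v \<odot>\<^bsub>F 2\<^esub> ?v)"
      by (simp add: a_minus_def F.smult_l_distr F.smult_l_minus F.M.minus_add F.M.a_comm)
    then show "(t ?v \<ominus> \<one>) \<odot>\<^bsub>F 2\<^esub> ?v \<in> H" using HE(3) t_H by simp
  qed simp
  have "u\<^sub>0 \<in> d 0 ` carrier (F 1)"
  proof (rule clifford_family_essential[OF family _ _ _ iness])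
    show "(\<lambda>y. t y \<odot>\<^bsub>F 0\<^esub> u\<^sub>0) \<in> linear_maps R (F 2) (F 0)"
      by (rule linear_maps_comp[OF t smult_right_linear[OF module u\<^sub>0]])
    show "t (d 2 y) \<odot>\<^bsub>F 0\<^esub> u\<^sub>0 \<in> d 0 ` carrier (F 1)" if "y \<in> carrier (F 3)" for y
    proof -
      have "d 2 y \<in> inessential 2"
        using that by (intro boundary_inessential) (simp add: numeral_2_eq_2 numeral_3_eq_3)
      then show ?thesis using smult_u\<^sub>0_boundary[OF t_in[OF iness_H]] by simp
    qed
    \<comment> \<open>Agreement with \<open>\<partial>/\<partial>T\<close> up to boundaries: on
      \<open>T\<close> both sides are congruent to \<open>u\<^sub>0\<close>, while on the other
      basis elements \<open>\<partial>/\<partial>T\<close> is zero and \<open>t\<close> has values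
      in \<open>\<mm>\<close>.\<close>
    show "t (u 2 A) \<odot>\<^bsub>F 0\<^esub> u\<^sub>0 \<ominus>\<^bsub>F 0\<^esub> u 0 A \<in> d 0 ` carrier (F 1)" for A
    proof (cases "A = {}")
      case True
      have "t ?v \<odot>\<^bsub>F 0\<^esub> u\<^sub>0 \<ominus>\<^bsub>F 0\<^esub> u\<^sub>0 = (t ?v \<ominus> \<one>) \<odot>\<^bsub>F 0\<^esub> u\<^sub>0"
        using u\<^sub>0 by (simp add: a_minus_def F.smult_l_distr F.smult_l_minus)
      then show ?thesis using True smult_u\<^sub>0_boundary[OF t_v] by (simp add: u_0)
    next
      case False
      then have "\<not> supported 0 A" using finite_subset[of A "{..<e}"] by (auto simp: supported_def)
      then show ?thesis
        using smult_u\<^sub>0_boundary[OF t_in[OF u_H[OF False]]] u\<^sub>0 by (simp add: u_unsupported F.M.diff_zero)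
    qed
  qed
  then show False using u\<^sub>0_not_boundary by simp
qed

end

section \<open>From a counterexample in degree 2 to the variable \<open>T\<close>\<close>

context residue_resolution
begin

theorem nu1_zero_2:
  assumes "n > 0" "nu1_zero R \<mm> F d (2 * n)"
  shows "nu1_zero R \<mm> F d 2"
proof (rule ccontr)
  assume "\<not> nu1_zero R \<mm> F d 2"
  let ?F1 = "F (Suc 0)" and ?F2 = "F (Suc (Suc 0))"
  have square: "ideal (\<mm> \<cdot> \<mm>) R" "\<mm> \<cdot> \<mm> \<subseteq> \<mm>"
    using ideal_prod_is_ideal[OF \<mm>.is_ideal \<mm>.is_ideal] ideal_prod_inter[OF \<mm>.is_ideal \<mm>.is_ideal] by auto
  obtain y where y: "y \<in> carrier ?F2" "d (Suc 0) y \<in> ideal_smult R (\<mm> \<cdot> \<mm>) ?F1" "y \<notin> inessential (Suc (Suc 0))"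
    using \<open>\<not> nu1_zero R \<mm> F d 2\<close> unfolding numeral_2_eq_2 nu1_zero_inessential by blast
  obtain e and x :: "nat \<Rightarrow> 'a" where x: "\<And>k. x k \<in> \<mm>"
    "\<And>a. a \<in> \<mm> \<Longrightarrow> \<exists>c\<in>{..<e} \<rightarrow> carrier R. a = (\<Oplus>k\<in>{..<e}. c k \<otimes> x k)"
    "\<And>c k. \<lbrakk>c \<in> {..<e} \<rightarrow> carrier R; (\<Oplus>k\<in>{..<e}. c k \<otimes> x k) = \<zero>; k < e\<rbrakk> \<Longrightarrow> c k \<in> \<mm>"
  proof (rule minimal_generators)
    fix e and x :: "nat \<Rightarrow> 'a"
    assume "\<And>k. x k \<in> \<mm>" "\<And>a. a \<in> \<mm> \<Longrightarrow> \<exists>c\<in>{..<e} \<rightarrow> carrier R. a = (\<Oplus>k\<in>{..<e}. c k \<otimes> x k)"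
      "\<And>c k. \<lbrakk>c \<in> {..<e} \<rightarrow> carrier R; (\<Oplus>k\<in>{..<e}. c k \<otimes> x k) = \<zero>; k < e\<rbrakk> \<Longrightarrow> c k \<in> \<mm>"
    then show thesis by (rule that)
  qed
  obtain r u\<^sub>0 where r: "r \<in> linear_maps R (F 0) (regular_module R)" "u\<^sub>0 \<in> carrier (F 0)" "r u\<^sub>0 = \<one>"
    "\<And>v. v \<in> carrier (F 0) \<Longrightarrow> v \<ominus>\<^bsub>F 0\<^esub> r v \<odot>\<^bsub>F 0\<^esub> u\<^sub>0 \<in> d 0 ` carrier ?F1"
    "\<And>v. v \<in> d 0 ` carrier ?F1 \<Longrightarrow> r v \<in> \<mm>"
  proof (rule augmentation_lift)
    fix r u\<^sub>0
    assume "r \<in> linear_maps R (F 0) (regular_module R)" "u\<^sub>0 \<in> carrier (F 0)" "r u\<^sub>0 = \<one>"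
      "\<And>v. v \<in> carrier (F 0) \<Longrightarrow> v \<ominus>\<^bsub>F 0\<^esub> r v \<odot>\<^bsub>F 0\<^esub> u\<^sub>0 \<in> d 0 ` carrier ?F1"
      "\<And>v. v \<in> d 0 ` carrier ?F1 \<Longrightarrow> r v \<in> \<mm>"
    then show thesis by (rule that)
  qed
  interpret A: augmented_resolution R \<mm> F d \<epsilon> e x r u\<^sub>0
    using x r by unfold_locales auto
  obtain E where E: "\<And>k. E k \<in> carrier ?F1" "\<And>k. d 0 (E k) = x k \<odot>\<^bsub>F 0\<^esub> u\<^sub>0"
    using A.x_lifts by blast
  obtain z g where z: "\<And>k. z k \<in> \<mm> \<cdot> \<mm>" and g: "g \<in> ideal_smult R (\<mm> \<cdot> \<mm>) ?F2"
    and dy: "d (Suc 0) y = (\<Oplus>\<^bsub>?F1\<^esub>k\<in>{..<e}. z k \<odot>\<^bsub>?F1\<^esub> E k) \<oplus>\<^bsub>?F1\<^esub> d (Suc 0) g"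
    using A.decomposition[OF square(1) E y(2) d_d[OF y(1)]] by blast
  have zm: "z k \<in> \<mm>" and zc [simp]: "z k \<in> carrier R" for k
    using z square(2) by (auto intro!: \<mm>.Icarr)
  have gc: "g \<in> carrier ?F2" by (rule ideal_smult_closed[OF square(1) g])
  have sumc: "(\<Oplus>\<^bsub>?F1\<^esub>k\<in>{..<e}. z k \<odot>\<^bsub>?F1\<^esub> E k) \<in> carrier ?F1"
    using E by (intro F.M.finsum_closed) auto
  \<comment> \<open>The cycle condition on \<open>z\<close> is inherited from
    \<open>d (d y) = 0\<close>; the functional \<open>r\<close> turns an equation between multiples
    of \<open>u\<^sub>0\<close> into one in \<open>R\<close>.\<close>
  have relation: "(\<Oplus>k\<in>{..<e}. x k \<otimes> z k) = \<zero>"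
  proof -
    have "(\<Oplus>k\<in>{..<e}. x k \<otimes> z k) \<odot>\<^bsub>F 0\<^esub> u\<^sub>0 = (\<Oplus>\<^bsub>F 0\<^esub>k\<in>{..<e}. (x k \<otimes> z k) \<odot>\<^bsub>F 0\<^esub> u\<^sub>0)"
      using r(2) by (intro F.finsum_smult_rdistr) auto
    also have "\<dots> = (\<Oplus>\<^bsub>F 0\<^esub>k\<in>{..<e}. d 0 (z k \<odot>\<^bsub>?F1\<^esub> E k))"
      using r(2) E by (intro F.M.finsum_cong') (auto simp: d_smult F.smult_assoc1[symmetric] m_comm)
    also have "\<dots> = d 0 (\<Oplus>\<^bsub>?F1\<^esub>k\<in>{..<e}. z k \<odot>\<^bsub>?F1\<^esub> E k)"
      using E by (intro linear_maps_finsum[OF module module linear, symmetric]) auto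
    also have "\<dots> = d 0 (d (Suc 0) y)"
      unfolding dy using sumc gc by (simp add: d_add)
    finally have "(\<Oplus>k\<in>{..<e}. x k \<otimes> z k) \<odot>\<^bsub>F 0\<^esub> u\<^sub>0 = \<zero>\<^bsub>F 0\<^esub>" using y(1) by simp
    moreover have "(\<Oplus>k\<in>{..<e}. x k \<otimes> z k) \<in> carrier R" by (intro finsum_closed) auto
    ultimately show ?thesis
      using A.smult_u\<^sub>0[of "\<Oplus>k\<in>{..<e}. x k \<otimes> z k"] linear_maps_zero[OF module module_regular r(1)]
      by (simp add: regular_module_simps)
  qed
  interpret C: clifford_resolution R \<mm> F d \<epsilon> e x z
    by unfold_locales (use x zm relation in auto)
  obtain u where u: "C.clifford_family u\<^sub>0 u"
    using C.clifford_family_exists[OF r(2)] by blast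
  interpret T: tate_variable R \<mm> F d \<epsilon> e x r u\<^sub>0 z u
    by unfold_locales (use z u in auto)
  \<comment> \<open>The lifts \<open>E k\<close> were chosen before \<open>z\<close> was known, and
    the family, which depends on \<open>z\<close>, brings its own lifts \<open>u 1 {k}\<close> of
    the same elements. The two differ by boundaries.\<close>
  have "\<exists>q. q \<in> carrier ?F2 \<and> (k < e \<longrightarrow> u (Suc 0) {k} \<ominus>\<^bsub>?F1\<^esub> E k = d (Suc 0) q)" for k
  proof (cases "k < e")
    case True
    have "d 0 (u (Suc 0) {k} \<ominus>\<^bsub>?F1\<^esub> E k) = \<zero>\<^bsub>F 0\<^esub>"
      using True E r(2) by (simp add: d_minus T.d_u_singleton) (simp add: a_minus_def F.M.r_neg)
    then show ?thesis using exactD[of "u (Suc 0) {k} \<ominus>\<^bsub>?F1\<^esub> E k" 0] E True by auto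
  next
    case False
    then show ?thesis using F.M.zero_closed by blast
  qed
  then obtain q where q: "\<And>k. q k \<in> carrier ?F2"
    "\<And>k. k < e \<Longrightarrow> u (Suc 0) {k} \<ominus>\<^bsub>?F1\<^esub> E k = d (Suc 0) (q k)" by metis
  \<comment> \<open>The correction for exchanging \<open>E k\<close> with \<open>u 1 {k}\<close> in
    the boundary of \<open>T\<close>. Its coefficients \<open>z k\<close> make it
    inessential.\<close>
  define p where "p = (\<Oplus>\<^bsub>?F2\<^esub>k\<in>{..<e}. z k \<odot>\<^bsub>?F2\<^esub> q k)"
  have p: "p \<in> ideal_smult R \<mm> ?F2"
    unfolding p_def using q zm
    by (intro F.finsum_in_submodule submodule_ideal_smult module \<mm>.is_ideal) (auto intro: ideal_smult.smult)
  have pc: "p \<in> carrier ?F2" by (rule ideal_smult_closed[OF \<mm>.is_ideal p])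
  have "d (Suc 0) p = (\<Oplus>\<^bsub>?F1\<^esub>k\<in>{..<e}. z k \<odot>\<^bsub>?F1\<^esub> d (Suc 0) (q k))"
    unfolding p_def using q by (simp add: linear_maps_finsum[OF module module linear] d_smult)
  then have "d (Suc 0) p \<oplus>\<^bsub>?F1\<^esub> (\<Oplus>\<^bsub>?F1\<^esub>k\<in>{..<e}. z k \<odot>\<^bsub>?F1\<^esub> E k)
      = (\<Oplus>\<^bsub>?F1\<^esub>k\<in>{..<e}. z k \<odot>\<^bsub>?F1\<^esub> d (Suc 0) (q k) \<oplus>\<^bsub>?F1\<^esub> z k \<odot>\<^bsub>?F1\<^esub> E k)"
    using q E by (simp add: F.M.finsum_addf Pi_iff)
  also have "\<dots> = (\<Oplus>\<^bsub>?F1\<^esub>k\<in>{..<e}. z k \<odot>\<^bsub>?F1\<^esub> u (Suc 0) {k})"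
  proof (rule F.M.finsum_cong')
    fix k assume "k \<in> {..<e}"
    then have "z k \<odot>\<^bsub>?F1\<^esub> d (Suc 0) (q k) \<oplus>\<^bsub>?F1\<^esub> z k \<odot>\<^bsub>?F1\<^esub> E k
        = z k \<odot>\<^bsub>?F1\<^esub> ((u (Suc 0) {k} \<ominus>\<^bsub>?F1\<^esub> E k) \<oplus>\<^bsub>?F1\<^esub> E k)"
      using q E by (simp add: F.smult_r_distr)
    then show "z k \<odot>\<^bsub>?F1\<^esub> d (Suc 0) (q k) \<oplus>\<^bsub>?F1\<^esub> z k \<odot>\<^bsub>?F1\<^esub> E k = z k \<odot>\<^bsub>?F1\<^esub> u (Suc 0) {k}"
      using E by (simp add: a_minus_def F.M.a_assoc F.M.l_neg)
  qed auto
  finally have du: "d (Suc 0) (u (Suc (Suc 0)) {})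
      = d (Suc 0) p \<oplus>\<^bsub>?F1\<^esub> (\<Oplus>\<^bsub>?F1\<^esub>k\<in>{..<e}. z k \<odot>\<^bsub>?F1\<^esub> E k)"
    by (simp add: T.d_u_empty)
  \<comment> \<open>After corrections by inessential terms, \<open>y\<close> and the image of
    \<open>T\<close> have the same boundary. By exactness they differ by a boundary, so one is
    essential iff the other is.\<close>
  define b where "b = (y \<ominus>\<^bsub>?F2\<^esub> g) \<ominus>\<^bsub>?F2\<^esub> (u (Suc (Suc 0)) {} \<ominus>\<^bsub>?F2\<^esub> p)"
  have bc: "b \<in> carrier ?F2" using y(1) gc pc by (simp add: b_def)
  have dyg: "d (Suc 0) (y \<ominus>\<^bsub>?F2\<^esub> g) = (\<Oplus>\<^bsub>?F1\<^esub>k\<in>{..<e}. z k \<odot>\<^bsub>?F1\<^esub> E k)"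
    using y(1) gc sumc by (simp add: d_minus dy) (simp add: a_minus_def F.M.a_assoc F.M.r_neg)
  have dup: "d (Suc 0) (u (Suc (Suc 0)) {} \<ominus>\<^bsub>?F2\<^esub> p) = (\<Oplus>\<^bsub>?F1\<^esub>k\<in>{..<e}. z k \<odot>\<^bsub>?F1\<^esub> E k)"
    using pc sumc by (simp add: d_minus du) (simp add: a_minus_def F.M.a_comm[of "d (Suc 0) p"] F.M.a_assoc F.M.r_neg)
  have "d (Suc 0) b = d (Suc 0) (y \<ominus>\<^bsub>?F2\<^esub> g) \<ominus>\<^bsub>?F1\<^esub> d (Suc 0) (u (Suc (Suc 0)) {} \<ominus>\<^bsub>?F2\<^esub> p)"
    unfolding b_def using y(1) gc pc by (intro d_minus) auto
  then have "d (Suc 0) b = \<zero>\<^bsub>?F1\<^esub>"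
    unfolding dyg dup using sumc by (simp add: a_minus_def F.M.r_neg)
  then have b: "b \<in> inessential (Suc (Suc 0))"
    using exactD[OF bc] boundary_inessential by auto
  have "u (Suc (Suc 0)) {} \<notin> inessential (Suc (Suc 0))"
  proof
    assume "u (Suc (Suc 0)) {} \<in> inessential (Suc (Suc 0))"
    moreover have "g \<in> inessential (Suc (Suc 0))" "p \<in> inessential (Suc (Suc 0))"
      by (intro ideal_smult_inessential ideal_smult_mono[OF square(2) g] p)+
    ultimately have "(b \<oplus>\<^bsub>?F2\<^esub> (u (Suc (Suc 0)) {} \<ominus>\<^bsub>?F2\<^esub> p)) \<oplus>\<^bsub>?F2\<^esub> g \<in> inessential (Suc (Suc 0))"
      using b by (intro F.submoduleE(5)[OF submodule_inessential] F.submodule_minus[OF submodule_inessential])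
    moreover have "(v \<ominus>\<^bsub>?F2\<^esub> w) \<oplus>\<^bsub>?F2\<^esub> w = v" if "v \<in> carrier ?F2" "w \<in> carrier ?F2" for v w
      using that by (simp add: a_minus_def F.M.a_assoc F.M.l_neg)
    then have "(b \<oplus>\<^bsub>?F2\<^esub> (u (Suc (Suc 0)) {} \<ominus>\<^bsub>?F2\<^esub> p)) \<oplus>\<^bsub>?F2\<^esub> g = y"
      unfolding b_def using y(1) gc pc by simp
    ultimately show False using y(3) by simp
  qed
  then have "u (2 * n) {} \<notin> inessential (2 * n)"
    using T.essential_powers by (simp add: numeral_2_eq_2)
  \<comment> \<open>Positivity of \<open>n\<close> puts \<open>2 * n\<close> among the degrees for
    which the vanishing criterion is stated.\<close>
  moreover obtain m where m: "2 * n = Suc m" using assms(1) by (cases n) auto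
  moreover have "d m (u (Suc m) {}) \<in> ideal_smult R (\<mm> \<cdot> \<mm>) (F m)" by (rule T.d_u_empty_square)
  ultimately show False
    using assms(2) T.u_closed[of "Suc m" "{}"] unfolding m nu1_zero_inessential by blast
qed

end

theorem proposition4p1:
  fixes R :: "('a, 'c) ring_scheme"
    and \<mm> :: "'a set"
    and F :: "nat \<Rightarrow> ('a, 'b) module"
    and d :: "nat \<Rightarrow> 'b \<Rightarrow> 'b"
    and \<epsilon> :: "'b \<Rightarrow> 'a set"
    and n :: nat
  assumes "noetherian_local_ring R \<mm>"
    and "\<mm> \<noteq> {\<zero>\<^bsub>R\<^esub>}"
    and "free_resolution R (residue_module R \<mm>) F d \<epsilon>"
    and "n > 0"
    and "nu1_zero R \<mm> F d (2 * n)"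
  shows "nu1_zero R \<mm> F d 2"
proof -
  have R: "cring R" "noetherian_ring R" "maximalideal \<mm> R" "\<And>J. maximalideal J R \<Longrightarrow> J = \<mm>"
    using assms(1) by (auto simp: noetherian_local_ring_def)
  note res = assms(3)[unfolded free_resolution_def boundaries_def]
  have "residue_resolution R \<mm> F d \<epsilon>"
  proof (intro residue_resolution.intro noetherian_local.intro noetherian_local_axioms.intro
      module_complex.intro module_complex_axioms.intro residue_resolution_axioms.intro R)
    show "is_free R (F n)" and "d n \<in> linear_maps R (F (Suc n)) (F n)" for n using res by auto
    then show "module R (F n)" for n by (simp add: is_free_def)
    show "{x \<in> carrier (F (Suc n)). d n x = \<zero>\<^bsub>F n\<^esub>} = d (Suc n) ` carrier (F (Suc (Suc n)))" for n
      using res by (simp add: a_kernel_def kernel_def)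
    show "{v \<in> carrier (F 0). \<epsilon> v = \<zero>\<^bsub>residue_module R \<mm>\<^esub>} = d 0 ` carrier (F (Suc 0))"
      using res by (simp add: a_kernel_def kernel_def)
  qed (use res in auto)
  then show ?thesis
    using assms(4,5) by (rule residue_resolution.nu1_zero_2)
qed

end
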